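(* Let $k$ be an algebraically closed field and let $X\subset\mathbb{P}^n_k$ be a reduced Cohen–Macaulay scheme of pure dimension $d$, with irreducible components $X_1,\dots,X_k$. Let $Z=\mathbb{V}(\tilde f_1,\dots,\tilde f_{n-d})$ be constructed from linear forms $\ell_1,\dots,\ell_{n-d-1}$ and coefficients $b_{i,j}\in k$ as in the context, and for each $a$ let $z_a\in X_a$ be a smooth point of $X$ with $z_a\notin\mathbb{V}(\ell_j)$ for all $j=1,\dots,n-d-1$. Then for general $b_{i,j}$ the Jacobian matrix $J(Z)$ evaluated at each $z_a$ is of maximal rank $n-d$. In particular, $Z$ is generically reduced along $X$.
   Context: Construction. Let $I_X=(f_1,\dots,f_r)\subset k[x_0,\dots,x_n]$ be the homogeneous ideal of $X$, $d_i=\deg f_i$, $d_1\ge\dots\ge d_r$. If $n=d+1$, $I_X$ is principal and $Z=X$. If $n\ge d+2$, put $$\tilde f_1=\sum_{j=1}^rb_{1,j}\ell_1^{d_1-d_j}f_j,\qquad\tilde f_i=\sum_{j=i}^rb_{i,j}\ell_{i-1}^{d_i-d_j}f_j\quad(2\le i\le n-d),$$ where $\ell_1$ is a linear form avoiding the minimal primes of $(f_1)$, $\ell_i$ ($i\ge2$) a linear form avoiding the minimal primes of $(\tilde f_1,\dots,\tilde f_i)$, and $b_{i,j}\in k$ are general so that $\tilde f_1,\dots,\tilde f_{n-d}$ is a regular sequence, i.e. $Z$ is a complete intersection of dimension $d$ containing $X$. $J(Z)$ is the Jacobian matrix of $(\tilde f_1,\dots,\tilde f_{n-d})$. "General $b_{i,j}$"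 means that $(b_{i,j})$ lies in a suitable non-empty Zariski open subset of the affine space of coefficients. $Z$ is generically reduced along $X$ if $\mathcal O_{Z,\eta}=\mathcal O_{X,\eta}$ for each generic point $\eta$ of an irreducible component of the reduced scheme $X$. *)

theory Defs
  imports
    "HOL-Library.Poly_Mapping"
    "HOL-Library.Extended_Nat"
    "HOL-Library.FuncSet"
    "HOL-Computational_Algebra.Polynomial"
    "HOL-Computational_Algebra.Fraction_Field"
    "HOL-Algebra.QuotRing"
    "Jordan_Normal_Form.DL_Rank"
begin

section \<open>Multivariate polynomials\<close>

text \<open>Finitely supported maps from monomials (exponent vectors) to coefficients, with the
  convolution product of \<^theory>\<open>HOL-Library.Poly_Mapping\<close>.\<close>

type_synonym ('v, 'k) mpoly = "('v \<Rightarrow>\<^sub>0 nat) \<Rightarrow>\<^sub>0 'k"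

definition mvar :: "'v \<Rightarrow> ('v, 'k::comm_ring_1) mpoly" where
  "mvar v = Poly_Mapping.single (Poly_Mapping.single v 1) 1"

definition mconst :: "'k \<Rightarrow> ('v, 'k::comm_ring_1) mpoly" where
  "mconst c = Poly_Mapping.single 0 c"

definition mvars :: "('v, 'k::comm_ring_1) mpoly \<Rightarrow> 'v set" where
  "mvars p = (\<Union>m \<in> Poly_Mapping.keys p. Poly_Mapping.keys m)"

definition meval :: "('v, 'k::comm_ring_1) mpoly \<Rightarrow> ('v \<Rightarrow> 'k) \<Rightarrow> 'k" where
  "meval p x = (\<Sum>m \<in> Poly_Mapping.keys p. Poly_Mapping.lookup p m *
     (\<Prod>v \<in> Poly_Mapping.keys m. x v ^ Poly_Mapping.lookup m v))"

text \<open>Formal partial derivative. For monomials \<open>m\<close> not involving \<open>v\<close> the truncated subtraction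
  of exponents is harmless, since the coefficient is then \<open>0\<close>.\<close>

definition mderiv :: "'v \<Rightarrow> ('v, 'k::comm_ring_1) mpoly \<Rightarrow> ('v, 'k) mpoly" where
  "mderiv v p = (\<Sum>m \<in> Poly_Mapping.keys p.
     Poly_Mapping.single (m - Poly_Mapping.single v 1)
       (of_nat (Poly_Mapping.lookup m v) * Poly_Mapping.lookup p m))"

definition mdegree :: "('v \<Rightarrow>\<^sub>0 nat) \<Rightarrow> nat" where
  "mdegree m = (\<Sum>v \<in> Poly_Mapping.keys m. Poly_Mapping.lookup m v)"

definition homogeneous :: "nat \<Rightarrow> ('v, 'k::comm_ring_1) mpoly \<Rightarrow> bool" where
  "homogeneous e p \<longleftrightarrow> (\<forall>m \<in> Poly_Mapping.keys p. mdegree m = e)"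

definition coord_ring :: "nat \<Rightarrow> (nat, 'k::comm_ring_1) mpoly ring" where
  "coord_ring n = \<lparr>carrier = {p. mvars p \<subseteq> {0..n}}, mult = (*), one = 1, zero = 0, add = (+)\<rparr>"

definition linear_form :: "nat \<Rightarrow> (nat, 'k::comm_ring_1) mpoly \<Rightarrow> bool" where
  "linear_form n p \<longleftrightarrow> p \<in> carrier (coord_ring n) \<and> homogeneous 1 p"


section \<open>Commutative algebra\<close>

definition minimal_prime :: "('a, 'b) ring_scheme \<Rightarrow> 'a set \<Rightarrow> 'a set \<Rightarrow> bool" where
  "minimal_prime R I P \<longleftrightarrow> primeideal P R \<and> I \<subseteq> P \<and>
     (\<forall>Q. primeideal Q R \<and> I \<subseteq> Q \<and> Q \<subseteq> P \<longrightarrow> Q = P)"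

definition krull_dim :: "('a, 'b) ring_scheme \<Rightarrow> enat" where
  "krull_dim R = Sup {enat m | m. \<exists>P :: nat \<Rightarrow> 'a set.
     (\<forall>i\<le>m. primeideal (P i) R) \<and> (\<forall>i<m. P i \<subset> P (Suc i))}"

definition regular_sequence :: "('a, 'b) ring_scheme \<Rightarrow> 'a list \<Rightarrow> bool" where
  "regular_sequence R xs \<longleftrightarrow> set xs \<subseteq> carrier R \<and>
     (\<forall>i < length xs. \<forall>a \<in> carrier R.
        xs ! i \<otimes>\<^bsub>R\<^esub> a \<in> Idl\<^bsub>R\<^esub> (set (take i xs)) \<longrightarrow> a \<in> Idl\<^bsub>R\<^esub> (set (take i xs))) \<and>
     Idl\<^bsub>R\<^esub> (set xs) \<noteq> carrier R"

text \<open>The maximal ideal of a local ring.\<close>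

definition nonunits :: "('a, 'b) ring_scheme \<Rightarrow> 'a set" where
  "nonunits R = carrier R - Units R"

text \<open>The following three notions are meant for Noetherian local rings only.\<close>

definition local_depth :: "('a, 'b) ring_scheme \<Rightarrow> enat" where
  "local_depth R = Sup {enat (length xs) | xs. regular_sequence R xs \<and> set xs \<subseteq> nonunits R}"

definition cohen_macaulay_local :: "('a, 'b) ring_scheme \<Rightarrow> bool" where
  "cohen_macaulay_local R \<longleftrightarrow> local_depth R = krull_dim R"

definition regular_local :: "('a, 'b) ring_scheme \<Rightarrow> bool" where
  "regular_local R \<longleftrightarrow>
     (\<exists>A \<subseteq> carrier R. finite A \<and> enat (card A) = krull_dim R \<and> Idl\<^bsub>R\<^esub> A = nonunits R)"

definition reduced_ring :: "('a, 'b) ring_scheme \<Rightarrow> bool" where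
  "reduced_ring R \<longleftrightarrow>
     (\<forall>x \<in> carrier R. \<forall>m :: nat. x [^]\<^bsub>R\<^esub> m = \<zero>\<^bsub>R\<^esub> \<longrightarrow> x = \<zero>\<^bsub>R\<^esub>)"


section \<open>Closed subschemes of projective space\<close>

definition homogeneous_ideal :: "nat \<Rightarrow> (nat, 'k::comm_ring_1) mpoly set \<Rightarrow> bool" where
  "homogeneous_ideal n I \<longleftrightarrow> ideal I (coord_ring n) \<and>
     I = Idl\<^bsub>coord_ring n\<^esub> {p \<in> I. \<exists>e. homogeneous e p}"

text \<open>Closed subschemes of \<open>P\<^sup>n\<close> correspond bijectively to saturated homogeneous ideals of
  \<open>k[x\<^sub>0, \<dots>, x\<^sub>n]\<close>; the subscheme of such an ideal \<open>I\<close> is \<open>Proj (k[x\<^sub>0, \<dots>, x\<^sub>n] / I)\<close>, and \<open>I\<close> is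
  its homogeneous ideal.\<close>

definition saturated_ideal :: "nat \<Rightarrow> (nat, 'k::comm_ring_1) mpoly set \<Rightarrow> bool" where
  "saturated_ideal n I \<longleftrightarrow>
     (\<forall>p \<in> carrier (coord_ring n). (\<forall>i\<le>n. \<exists>N. mvar i ^ N * p \<in> I) \<longrightarrow> p \<in> I)"

definition proj_ideal :: "nat \<Rightarrow> (nat, 'k::comm_ring_1) mpoly set \<Rightarrow> bool" where
  "proj_ideal n I \<longleftrightarrow> homogeneous_ideal n I \<and> saturated_ideal n I"

text \<open>The (scheme-theoretic) points of \<open>Proj (k[x\<^sub>0, \<dots>, x\<^sub>n] / I)\<close>.\<close>

definition proj_points :: "nat \<Rightarrow> (nat, 'k::comm_ring_1) mpoly set
    \<Rightarrow> (nat, 'k) mpoly set set" where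
  "proj_points n I = {P. primeideal P (coord_ring n) \<and> homogeneous_ideal n P \<and> I \<subseteq> P \<and>
     (\<exists>i\<le>n. mvar i \<notin> P)}"

text \<open>The stalk of the structure sheaf of \<open>P\<^sup>n\<close> at \<open>P\<close>, i.e. the degree \<open>0\<close> part of the
  homogeneous localisation at \<open>P\<close>, as a subring of the fraction field.\<close>

definition proj_stalk :: "nat \<Rightarrow> (nat, 'k::field) mpoly set \<Rightarrow> (nat, 'k) mpoly fract ring" where
  "proj_stalk n P = \<lparr>carrier = {Fract a s | a s.
       a \<in> carrier (coord_ring n) \<and> s \<in> carrier (coord_ring n) \<and> s \<notin> P \<and>
       (\<exists>e. homogeneous e a \<and> homogeneous e s)},
     mult = (*), one = 1, zero = 0, add = (+)\<rparr>"

definition ideal_stalk :: "nat \<Rightarrow> (nat, 'k::field) mpoly set \<Rightarrow> (nat, 'k) mpoly set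
    \<Rightarrow> (nat, 'k) mpoly fract set" where
  "ideal_stalk n I P = {Fract a s | a s.
     a \<in> I \<and> s \<in> carrier (coord_ring n) \<and> s \<notin> P \<and> (\<exists>e. homogeneous e a \<and> homogeneous e s)}"

text \<open>The local ring at \<open>P\<close> of the closed subscheme of \<open>P\<^sup>n\<close> defined by \<open>I\<close>. For \<open>J \<subseteq> I\<close>, the
  equation \<open>local_ring n J P = local_ring n I P\<close> says exactly that the canonical surjection from
  the left to the right hand side is bijective, both being quotients of the same ring.\<close>

definition local_ring :: "nat \<Rightarrow> (nat, 'k::field) mpoly set \<Rightarrow> (nat, 'k) mpoly set
    \<Rightarrow> (nat, 'k) mpoly fract set ring" where
  "local_ring n I P = proj_stalk n P Quot ideal_stalk n I P"

definition reduced_scheme :: "nat \<Rightarrow> (nat, 'k::field) mpoly set \<Rightarrow> bool" where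
  "reduced_scheme n I \<longleftrightarrow> (\<forall>P \<in> proj_points n I. reduced_ring (local_ring n I P))"

definition cohen_macaulay_scheme :: "nat \<Rightarrow> (nat, 'k::field) mpoly set \<Rightarrow> bool" where
  "cohen_macaulay_scheme n I \<longleftrightarrow>
     (\<forall>P \<in> proj_points n I. cohen_macaulay_local (local_ring n I P))"

text \<open>An irreducible component is represented by its generic point.\<close>

definition generic_points :: "nat \<Rightarrow> (nat, 'k::field) mpoly set \<Rightarrow> (nat, 'k) mpoly set set" where
  "generic_points n I = {P \<in> proj_points n I. \<forall>Q \<in> proj_points n I. Q \<subseteq> P \<longrightarrow> Q = P}"

text \<open>The Krull dimension of the closure of the point \<open>P\<close>: irreducible closed subsets of it
  correspond to the points containing \<open>P\<close>, with inclusions reversed.\<close>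

definition closure_dim :: "nat \<Rightarrow> (nat, 'k::field) mpoly set \<Rightarrow> enat" where
  "closure_dim n P = Sup {enat m | m. \<exists>Q :: nat \<Rightarrow> (nat, 'k) mpoly set.
     (\<forall>i\<le>m. Q i \<in> proj_points n P) \<and> (\<forall>i<m. Q i \<subset> Q (Suc i))}"

definition pure_dimensional :: "nat \<Rightarrow> (nat, 'k::field) mpoly set \<Rightarrow> nat \<Rightarrow> bool" where
  "pure_dimensional n I d \<longleftrightarrow> (\<forall>P \<in> generic_points n I. closure_dim n P = enat d)"

text \<open>Closed points are given by homogeneous coordinate vectors \<open>z\<close>, of which only the entries
  \<open>z 0, \<dots>, z n\<close> matter.\<close>

definition hom_coords :: "nat \<Rightarrow> (nat \<Rightarrow> 'k::field) \<Rightarrow> bool" where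
  "hom_coords n z \<longleftrightarrow> (\<exists>i\<le>n. z i \<noteq> 0)"

definition closed_point :: "nat \<Rightarrow> (nat \<Rightarrow> 'k::field) \<Rightarrow> (nat, 'k) mpoly set" where
  "closed_point n z = Idl\<^bsub>coord_ring n\<^esub>
     {p \<in> carrier (coord_ring n). (\<exists>e. homogeneous e p) \<and> meval p z = 0}"

text \<open>Over an algebraically closed field, a closed point is smooth iff its local ring is
  regular.\<close>

definition smooth_point :: "nat \<Rightarrow> (nat, 'k::alg_closed_field) mpoly set \<Rightarrow> (nat \<Rightarrow> 'k) \<Rightarrow> bool" where
  "smooth_point n I z \<longleftrightarrow> hom_coords n z \<and> closed_point n z \<in> proj_points n I \<and>
     regular_local (local_ring n I (closed_point n z))"

definition generically_reduced_along ::
    "nat \<Rightarrow> (nat, 'k::field) mpoly set \<Rightarrow> (nat, 'k) mpoly set \<Rightarrow> bool" where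
  "generically_reduced_along n J I \<longleftrightarrow>
     (\<forall>P \<in> generic_points n I. local_ring n J P = local_ring n I P)"

text \<open>The Jacobian matrix of \<open>g 1, \<dots>, g c\<close> with respect to \<open>x\<^sub>0, \<dots>, x\<^sub>n\<close>, evaluated at \<open>z\<close>.\<close>

definition jacobian_at :: "nat \<Rightarrow> nat \<Rightarrow> (nat \<Rightarrow> (nat, 'k::field) mpoly) \<Rightarrow> (nat \<Rightarrow> 'k) \<Rightarrow> 'k mat" where
  "jacobian_at n c g z = mat c (n + 1) (\<lambda>(i, j). meval (mderiv j (g (i + 1))) z)"


section \<open>Zariski topology on affine space and general elements\<close>

text \<open>The affine space with coordinates indexed by \<open>T\<close> is \<open>T \<rightarrow>\<^sub>E UNIV\<close>.\<close>

definition zariski_open :: "'v set \<Rightarrow> ('v \<Rightarrow> 'k::field) set \<Rightarrow> bool" where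
  "zariski_open T U \<longleftrightarrow> (\<exists>F. (\<forall>p \<in> F. mvars p \<subseteq> T) \<and>
     U = {b \<in> T \<rightarrow>\<^sub>E UNIV. \<exists>p \<in> F. meval p b \<noteq> 0})"

definition for_general :: "'v set \<Rightarrow> (('v \<Rightarrow> 'k::field) \<Rightarrow> bool) \<Rightarrow> bool" where
  "for_general T \<Phi> \<longleftrightarrow> (\<exists>U. zariski_open T U \<and> U \<noteq> {} \<and> (\<forall>b \<in> U. \<Phi> b))"


section \<open>The construction of the complete intersection\<close>

text \<open>Throughout, \<open>c = n - d\<close> is the codimension, \<open>f 1, \<dots>, f r\<close> are generators of the homogeneous
  ideal of \<open>X\<close>, homogeneous of degrees \<open>\<delta> 1 \<ge> \<dots> \<ge> \<delta> r\<close>, and \<open>l 1, \<dots>, l (c - 1)\<close> are linear forms.\<close>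

definition coeff_index :: "nat \<Rightarrow> nat \<Rightarrow> (nat \<times> nat) set" where
  "coeff_index c r = {(i, j). 1 \<le> i \<and> i \<le> c \<and> i \<le> j \<and> j \<le> r}"

text \<open>For \<open>c = 1\<close> the ideal of \<open>X\<close> is generated by \<open>f 1\<close> alone and \<open>Z = X\<close>.\<close>

definition ftilde :: "nat \<Rightarrow> nat \<Rightarrow> (nat \<Rightarrow> (nat, 'k::field) mpoly) \<Rightarrow> (nat \<Rightarrow> nat)
    \<Rightarrow> (nat \<Rightarrow> (nat, 'k) mpoly) \<Rightarrow> (nat \<times> nat \<Rightarrow> 'k) \<Rightarrow> nat \<Rightarrow> (nat, 'k) mpoly" where
  "ftilde c r f \<delta> l b i =
     (if c = 1 then f 1
      else (\<Sum>j = i..r. mconst (b (i, j)) *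
              (if i = 1 then l 1 else l (i - 1)) ^ (\<delta> i - \<delta> j) * f j))"

definition Z_ideal :: "nat \<Rightarrow> nat \<Rightarrow> nat \<Rightarrow> (nat \<Rightarrow> (nat, 'k::field) mpoly) \<Rightarrow> (nat \<Rightarrow> nat)
    \<Rightarrow> (nat \<Rightarrow> (nat, 'k) mpoly) \<Rightarrow> (nat \<times> nat \<Rightarrow> 'k) \<Rightarrow> (nat, 'k) mpoly set" where
  "Z_ideal n c r f \<delta> l b = Idl\<^bsub>coord_ring n\<^esub> (ftilde c r f \<delta> l b ` {1..c})"

text \<open>The conditions of the construction that involve the coefficients \<open>b\<close>.\<close>

definition admissible :: "nat \<Rightarrow> nat \<Rightarrow> nat \<Rightarrow> (nat \<Rightarrow> (nat, 'k::field) mpoly) \<Rightarrow> (nat \<Rightarrow> nat)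
    \<Rightarrow> (nat \<Rightarrow> (nat, 'k) mpoly) \<Rightarrow> (nat \<times> nat \<Rightarrow> 'k) \<Rightarrow> bool" where
  "admissible n c r f \<delta> l b \<longleftrightarrow>
     (\<forall>i \<in> {2..c - 1}. \<forall>P.
        minimal_prime (coord_ring n) (Idl\<^bsub>coord_ring n\<^esub> (ftilde c r f \<delta> l b ` {1..i})) P
          \<longrightarrow> l i \<notin> P) \<and>
     regular_sequence (coord_ring n) (map (ftilde c r f \<delta> l b) [1..<c + 1])"

end

theory Submission
  imports Defs "HOL-Computational_Algebra.Formal_Power_Series"
begin

text \<open>Let \<open>c = n - d\<close>. If \<open>J = (g\<^sub>1, \<dots>, g\<^sub>c)\<close> is generated by a regular sequence of forms, dividing by each
  \<open>g\<^sub>i\<close> lowers the growth order of the Hilbert function by one, while each step of a chain of graded primes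
  lowers it by at least one. Hence chains of graded primes above \<open>J\<close> have length at most \<open>d\<close>.

  Applied to \<open>J \<subseteq> I\<close>, this bounds the dimension of the local ring of \<open>X\<close> at \<open>z\<^sub>a\<close> by \<open>d\<close>; as that ring is regular,
  its maximal ideal needs at most \<open>d\<close> generators, so the gradients of the \<open>f\<^sub>j\<close> at \<open>z\<^sub>a\<close> have rank at least \<open>c\<close>.
  Since the \<open>f\<^sub>j\<close> vanish and the \<open>l\<^sub>i\<close> do not vanish at \<open>z\<^sub>a\<close>, a general upper triangular combination keeps rank \<open>c\<close>.

  For generic reducedness, the rank condition yields, by Newton iteration, a formal arc through \<open>z\<^sub>a\<close> in a
  generic tangent direction of \<open>Z\<close>. Its kernel \<open>E\<close> is prime, contains \<open>J\<close>, and by Krull's intersection theorem equals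
  \<open>J\<close> locally at \<open>z\<^sub>a\<close>. In particular \<open>E\<close> is contained in the prime \<open>P\<close> of the component through \<open>z\<^sub>a\<close> (on forms), and if they differed,
  a chain of length \<open>d\<close> above \<open>P\<close> would extend to one of length \<open>d + 1\<close> above \<open>J\<close>. So \<open>J\<close> and \<open>P\<close>, hence
  also \<open>J\<close> and \<open>I\<close>, agree locally.\<close>

section \<open>Evaluation of multivariate polynomials\<close>

text \<open>Dimension enters only by counting independent forms in high degree:
  \<open>growth n Q l\<close> is a lower bound for a Hilbert function, and the only upper bound is
  the number of monomials, at most \<open>(N + 1) ^ n\<close> in degree \<open>N\<close>. Membership
  is tested on forms only, so a chain may contain sets that are not homogeneous ideals. This matters
  for primes contracted from a local ring and for the kernel of an arc, which passes through a
  chosen coordinate vector \<open>z\<close> and need not be homogeneous.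

  The velocities of the arc are indeterminates because an arc with constant velocities follows one
  direction only and in general has a far larger kernel. With indeterminates, the lowest coefficient
  of a polynomial along the arc still records its whole leading form on the tangent space. The
  coefficients lie in a polynomial ring over a field, so the power series form a domain and the
  kernel is prime.

  The regular sequence that bounds the growth of \<open>I\<close> comes from an admissible choice of
  coefficients. One choice \<open>b0\<close> suffices, since the bound concerns \<open>I\<close>
  alone; if there is none, the claim is vacuous.\<close>

definition msubst :: "('k::comm_ring_1 \<Rightarrow> 'b::comm_ring_1) \<Rightarrow> ('v \<Rightarrow> 'b) \<Rightarrow> ('v, 'k) mpoly \<Rightarrow> 'b" where
  "msubst h \<rho> p = (\<Sum>m \<in> Poly_Mapping.keys p. h (Poly_Mapping.lookup p m) *
     (\<Prod>v \<in> Poly_Mapping.keys m. \<rho> v ^ Poly_Mapping.lookup m v))"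

definition coeff_hom :: "('k::comm_ring_1 \<Rightarrow> 'b::comm_ring_1) \<Rightarrow> bool" where
  "coeff_hom h \<longleftrightarrow> h 0 = 0 \<and> h 1 = 1 \<and> (\<forall>a b. h (a + b) = h a + h b) \<and> (\<forall>a b. h (a * b) = h a * h b)"

text \<open>All evaluations of the development are instances of \<open>msubst\<close>: values at
  points, the grading, first-order expansion, formal arcs, restriction to a line. Their homomorphism
  laws are thus proved once.\<close>

lemma meval_conv_msubst: "meval p x = msubst (\<lambda>c. c) x p"
  by (simp add: meval_def msubst_def)

lemma coeff_hom_id [simp]: "coeff_hom (\<lambda>c. c)"
  by (simp add: coeff_hom_def)

definition mon_eval :: "('v \<Rightarrow> 'b::comm_ring_1) \<Rightarrow> ('v \<Rightarrow>\<^sub>0 nat) \<Rightarrow> 'b" where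
  "mon_eval \<rho> m = (\<Prod>v \<in> Poly_Mapping.keys m. \<rho> v ^ Poly_Mapping.lookup m v)"

lemma mon_eval_superset:
  assumes "finite V" "Poly_Mapping.keys m \<subseteq> V"
  shows "mon_eval \<rho> m = (\<Prod>v \<in> V. \<rho> v ^ Poly_Mapping.lookup m v)"
  unfolding mon_eval_def using assms
  by (intro prod.mono_neutral_left) (auto simp: in_keys_iff)

lemma mon_eval_0 [simp]: "mon_eval \<rho> 0 = 1"
  by (simp add: mon_eval_def)

lemma mon_eval_add: "mon_eval \<rho> (m + m') = mon_eval \<rho> m * mon_eval \<rho> m'"
proof -
  let ?V = "Poly_Mapping.keys m \<union> Poly_Mapping.keys m'"
  have fin: "finite ?V" by simp
  have "Poly_Mapping.keys (m + m') \<subseteq> ?V" by (rule Poly_Mapping.keys_add)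
  then show ?thesis
    by (simp add: mon_eval_superset[OF fin] lookup_add power_add prod.distrib)
qed

lemma mon_eval_single [simp]: "mon_eval \<rho> (Poly_Mapping.single v k) = \<rho> v ^ k"
  by (simp add: mon_eval_def)

lemma msubst_superset:
  assumes "coeff_hom h" "finite A" "Poly_Mapping.keys p \<subseteq> A"
  shows "msubst h \<rho> p = (\<Sum>m\<in>A. h (Poly_Mapping.lookup p m) * mon_eval \<rho> m)"
  unfolding msubst_def mon_eval_def using assms
  by (intro sum.mono_neutral_left) (auto simp: in_keys_iff coeff_hom_def)

lemma msubst_add:
  assumes h: "coeff_hom h"
  shows "msubst h \<rho> (p + q) = msubst h \<rho> p + msubst h \<rho> q"
proof -
  let ?A = "Poly_Mapping.keys p \<union> Poly_Mapping.keys q"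
  have fin: "finite ?A" by simp
  have "Poly_Mapping.keys (p + q) \<subseteq> ?A" by (rule Poly_Mapping.keys_add)
  then show ?thesis using h
    by (simp add: msubst_superset[OF h fin] lookup_add coeff_hom_def distrib_right sum.distrib)
qed

lemma msubst_0 [simp]: "msubst h \<rho> 0 = 0"
  by (simp add: msubst_def)

lemma msubst_single:
  assumes h: "coeff_hom h"
  shows "msubst h \<rho> (Poly_Mapping.single m c) = h c * mon_eval \<rho> m"
  using msubst_superset[OF h, of "{m}" "Poly_Mapping.single m c"] by simp

lemma msubst_sum:
  assumes h: "coeff_hom h"
  shows "msubst h \<rho> (\<Sum>i\<in>A. g i) = (\<Sum>i\<in>A. msubst h \<rho> (g i))"
  by (induction A rule: infinite_finite_induct) (auto simp: msubst_add[OF h])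

lemma poly_mapping_monomials: "p = (\<Sum>m\<in>Poly_Mapping.keys p. Poly_Mapping.single m (Poly_Mapping.lookup p m))"
  by (rule poly_mapping_eqI)
     (auto simp: lookup_sum lookup_single when_def in_keys_iff sum.delta')

lemma msubst_mult:
  assumes h: "coeff_hom h"
  shows "msubst h \<rho> (p * q) = msubst h \<rho> p * msubst h \<rho> q"
proof -
  have "p * q = (\<Sum>m\<in>Poly_Mapping.keys p. \<Sum>m'\<in>Poly_Mapping.keys q.
      Poly_Mapping.single (m + m') (Poly_Mapping.lookup p m * Poly_Mapping.lookup q m'))"
    by (subst (1) poly_mapping_monomials[of p], subst (1) poly_mapping_monomials[of q])
       (simp add: sum_product mult_single)
  then have "msubst h \<rho> (p * q) = (\<Sum>m\<in>Poly_Mapping.keys p. \<Sum>m'\<in>Poly_Mapping.keys q.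
      (h (Poly_Mapping.lookup p m) * mon_eval \<rho> m) * (h (Poly_Mapping.lookup q m') * mon_eval \<rho> m'))"
    using h by (simp add: msubst_sum[OF h] msubst_single[OF h] mon_eval_add coeff_hom_def mult_ac)
  also have "\<dots> = msubst h \<rho> p * msubst h \<rho> q"
    by (simp add: msubst_def mon_eval_def sum_product)
  finally show ?thesis .
qed

lemma msubst_mconst [simp]: "coeff_hom h \<Longrightarrow> msubst h \<rho> (mconst c) = h c"
  by (simp add: mconst_def msubst_single)

lemma msubst_mvar [simp]: "coeff_hom h \<Longrightarrow> msubst h \<rho> (mvar v) = \<rho> v"
  by (simp add: mvar_def msubst_single coeff_hom_def)

lemma mconst_1 [simp]: "mconst 1 = 1" and mconst_0 [simp]: "mconst 0 = 0"
  and mconst_add: "mconst (a + b) = mconst a + mconst b"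
  and mconst_mult: "mconst (a * b) = mconst a * mconst b"
  by (simp_all add: mconst_def single_add mult_single)

lemma mconst_uminus: "mconst (- a) = - mconst a"
  by (simp add: mconst_def single_uminus)

lemma coeff_hom_mconst [simp]: "coeff_hom mconst"
  by (simp add: coeff_hom_def mconst_add mconst_mult)

lemma msubst_1 [simp]: "coeff_hom h \<Longrightarrow> msubst h \<rho> 1 = 1"
  using msubst_mconst[of h \<rho> 1] by (simp add: coeff_hom_def)

lemma msubst_uminus: "coeff_hom h \<Longrightarrow> msubst h \<rho> (- p) = - msubst h \<rho> p"
  using msubst_add[of h \<rho> p "-p"] by (simp add: eq_neg_iff_add_eq_0 add.commute)

lemma msubst_diff: "coeff_hom h \<Longrightarrow> msubst h \<rho> (p - q) = msubst h \<rho> p - msubst h \<rho> q"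
  using msubst_add[of h \<rho> p "-q"] by (simp add: msubst_uminus)

lemma msubst_power: "coeff_hom h \<Longrightarrow> msubst h \<rho> (p ^ k) = msubst h \<rho> p ^ k"
  by (induction k) (simp_all add: msubst_mult)

lemma msubst_prod:
  assumes h: "coeff_hom h"
  shows "msubst h \<rho> (\<Prod>i\<in>A. g i) = (\<Prod>i\<in>A. msubst h \<rho> (g i))"
  by (induction A rule: infinite_finite_induct) (auto simp: msubst_mult[OF h] h)

lemmas msubst_hom = msubst_add msubst_mult msubst_diff msubst_uminus msubst_power msubst_sum msubst_prod

lemma meval_hom:
  "meval (p + q) x = meval p x + meval q x" "meval (p * q) x = meval p x * meval q x"
  "meval (p - q) x = meval p x - meval q x" "meval (- p) x = - meval p x"
  "meval (p ^ k) x = meval p x ^ k" "meval (sum g A) x = (\<Sum>i\<in>A. meval (g i) x)"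
  "meval (prod g A) x = (\<Prod>i\<in>A. meval (g i) x)"
  "meval (mconst c) x = c" "meval (mvar v) x = x v" "meval 0 x = 0" "meval 1 x = 1"
  by (simp_all add: meval_conv_msubst msubst_hom)

lemma mvars_add: "mvars p \<subseteq> V \<Longrightarrow> mvars q \<subseteq> V \<Longrightarrow> mvars (p + q) \<subseteq> V"
  unfolding mvars_def using Poly_Mapping.keys_add[of p q] by blast

lemma mvars_mult: "mvars p \<subseteq> V \<Longrightarrow> mvars q \<subseteq> V \<Longrightarrow> mvars (p * q) \<subseteq> V"
proof -
  assume a: "mvars p \<subseteq> V" "mvars q \<subseteq> V"
  show ?thesis
  proof
    fix v assume "v \<in> mvars (p * q)"
    then obtain m where m: "m \<in> Poly_Mapping.keys (p * q)" "v \<in> Poly_Mapping.keys m" by (auto simp: mvars_def)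
    then obtain m1 m2 where "m = m1 + m2" "m1 \<in> Poly_Mapping.keys p" "m2 \<in> Poly_Mapping.keys q"
      using keys_mult[of p q] by blast
    then show "v \<in> V" using m Poly_Mapping.keys_add[of m1 m2] a unfolding mvars_def by blast
  qed
qed

lemma mvars_uminus: "mvars (- p) = mvars p"
  by (auto simp: mvars_def in_keys_iff)

lemma mvars_mconst [simp]: "mvars (mconst c) = {}"
  by (auto simp: mvars_def mconst_def)

lemma mvars_mvar: "mvars (mvar v) \<subseteq> {v}"
  by (auto simp: mvars_def mvar_def)

lemma mvars_0 [simp]: "mvars 0 = {}" and mvars_1 [simp]: "mvars 1 = {}"
  by (auto simp: mvars_def)

lemma mvars_power: "mvars p \<subseteq> V \<Longrightarrow> mvars (p ^ k) \<subseteq> V"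
  by (induction k) (simp_all add: mvars_mult)

lemma mvars_sum: "(\<And>i. i \<in> A \<Longrightarrow> mvars (g i) \<subseteq> V) \<Longrightarrow> mvars (sum g A) \<subseteq> V"
  by (induction A rule: infinite_finite_induct) (simp_all add: mvars_add)

lemma mvars_prod: "(\<And>i. i \<in> A \<Longrightarrow> mvars (g i) \<subseteq> V) \<Longrightarrow> mvars (prod g A) \<subseteq> V"
  by (induction A rule: infinite_finite_induct) (simp_all add: mvars_mult)

lemma single_conv_prod: "Poly_Mapping.single m c = mconst c * mon_eval mvar m"
proof -
  have pw: "(mvar v ^ k :: ('a,'b) mpoly) = Poly_Mapping.single (Poly_Mapping.single v k) 1" for v :: 'a and k
  proof (induction k)
    case (Suc k)
    have "mvar v ^ Suc k = (mvar v * Poly_Mapping.single (Poly_Mapping.single v k) 1 :: ('a,'b) mpoly)"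
      by (simp add: Suc)
    then show ?case
      by (simp add: mvar_def mult_single flip: single_add)
  qed simp
  have "(\<Prod>v\<in>V. Poly_Mapping.single (Poly_Mapping.single v (g v)) 1) =
      (Poly_Mapping.single (\<Sum>v\<in>V. Poly_Mapping.single v (g v)) 1 :: ('a,'b) mpoly)" for V and g :: "'a \<Rightarrow> nat"
    by (induction V rule: infinite_finite_induct) (simp_all add: mult_single)
  then have "mon_eval mvar m = (Poly_Mapping.single m 1 :: ('a,'b) mpoly)"
    using poly_mapping_monomials[of m] by (simp add: mon_eval_def pw)
  then show ?thesis by (simp add: mconst_def mult_single)
qed

text \<open>The polynomials with variables in \<open>V\<close> form the ring generated by constants
  and these variables. Identities between substitutions or derivations become a check on generators,
  sums and products.\<close>

lemma mpoly_induct [consumes 1, case_names const var add mult]: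
  assumes p: "mvars p \<subseteq> V"
    and const: "\<And>c. P (mconst c)"
    and var: "\<And>v. v \<in> V \<Longrightarrow> P (mvar v)"
    and add: "\<And>p q. mvars p \<subseteq> V \<Longrightarrow> mvars q \<subseteq> V \<Longrightarrow> P p \<Longrightarrow> P q \<Longrightarrow> P (p + q)"
    and mult: "\<And>p q. mvars p \<subseteq> V \<Longrightarrow> mvars q \<subseteq> V \<Longrightarrow> P p \<Longrightarrow> P q \<Longrightarrow> P (p * q)"
  shows "P p"
proof -
  let ?P = "\<lambda>p. mvars p \<subseteq> V \<and> P p"
  have c: "?P (mconst c)" for c by (simp add: const)
  have v: "?P (mvar v)" if "v \<in> V" for v using mvars_mvar[of v] that var by auto
  have a: "?P (p + q)" if "?P p" "?P q" for p q using that add mvars_add by blast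
  have m: "?P (p * q)" if "?P p" "?P q" for p q using that mult mvars_mult by blast
  have one: "?P 1" using c[of 1] by simp
  have zero: "?P 0" using c[of 0] by simp
  have pw: "?P (q ^ k)" if "?P q" for q k
    by (induction k) (use one m that in auto)
  have pr: "?P (\<Prod>i\<in>A. g i)" if "finite A" "\<And>i. i \<in> A \<Longrightarrow> ?P (g i)" for A and g :: "'a \<Rightarrow> ('a,'b) mpoly"
    using that by (induction A rule: finite_induct) (use one m in auto)
  have sm: "?P (\<Sum>i\<in>A. g i)" if "finite A" "\<And>i. i \<in> A \<Longrightarrow> ?P (g i)" for A :: "('a \<Rightarrow>\<^sub>0 nat) set" and g
    using that by (induction A rule: finite_induct) (use zero a in auto)
  have "?P (Poly_Mapping.single k (Poly_Mapping.lookup p k))" if "k \<in> Poly_Mapping.keys p" for k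
    unfolding single_conv_prod mon_eval_def
    by (intro m c pr pw v) (use p that in \<open>auto simp: mvars_def\<close>)
  then have "?P (\<Sum>k\<in>Poly_Mapping.keys p. Poly_Mapping.single k (Poly_Mapping.lookup p k))"
    by (intro sm) auto
  then show ?thesis using poly_mapping_monomials[of p] by simp
qed

section \<open>Homogeneous components\<close>

text \<open>The grading is encoded by the substitution \<open>x\<^sub>v \<mapsto> x\<^sub>v T\<close>.\<close>

definition grad :: "('v, 'k::comm_ring_1) mpoly \<Rightarrow> ('v, 'k) mpoly poly" where
  "grad p = msubst (\<lambda>c. [:mconst c:]) (\<lambda>v. [:0, mvar v:]) p"

lemma coeff_hom_const_poly [simp]: "coeff_hom (\<lambda>c. [:mconst c:])" "coeff_hom (\<lambda>c. [:c:])"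
  by (simp_all add: coeff_hom_def mconst_add mconst_mult one_pCons)

lemmas grad_hom = msubst_hom[of "\<lambda>c. [:mconst c:]" "\<lambda>v. [:0, mvar v:]", folded grad_def, simplified]

lemma grad_mconst [simp]: "grad (mconst c) = [:mconst c:]"
  and grad_mvar [simp]: "grad (mvar v) = [:0, mvar v:]"
  and grad_0 [simp]: "grad 0 = 0" and grad_1 [simp]: "grad 1 = 1"
  by (simp_all add: grad_def)

text \<open>Setting T = 1 forgets the grading: p is the sum of the coefficients of
  \<open>grad p\<close>, its homogeneous components.\<close>

lemma poly_grad_1: "poly (grad p) 1 = p"
proof -
  have "mvars p \<subseteq> UNIV" by simp
  then show ?thesis by (induction p rule: mpoly_induct) (auto simp: grad_hom)
qed

lemma pvar_power: "[:0, a:] ^ k = monom (a ^ k) k" for a :: "'a::comm_ring_1"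
  by (induction k) (simp_all add: monom_0 monom_Suc mult_monom one_pCons smult_monom)

lemma grad_single: "grad (Poly_Mapping.single m c) = monom (Poly_Mapping.single m c) (mdegree m)"
proof -
  have "(\<Prod>v\<in>A. monom (g v) (k v)) = monom (\<Prod>v\<in>A. g v) (\<Sum>v\<in>A. k v)" for A and g :: "'a \<Rightarrow> ('a,'b) mpoly" and k
    by (induction A rule: infinite_finite_induct) (simp_all add: mult_monom)
  then have "mon_eval (\<lambda>v. [:0, mvar v:]) m = (monom (mon_eval mvar m) (mdegree m) :: ('a,'b) mpoly poly)"
    by (simp add: mon_eval_def mdegree_def pvar_power)
  then have "grad (Poly_Mapping.single m c) = monom (mconst c * mon_eval mvar m) (mdegree m)"
    by (simp add: grad_def msubst_single smult_monom)
  then show ?thesis by (simp only: single_conv_prod)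
qed

lemma grad_conv_sum: "grad p = (\<Sum>m\<in>Poly_Mapping.keys p. monom (Poly_Mapping.single m (Poly_Mapping.lookup p m)) (mdegree m))"
  by (subst poly_mapping_monomials[of p]) (simp only: grad_hom grad_single)

lemma lookup_coeff_grad: "Poly_Mapping.lookup (coeff (grad p) e) m = (if mdegree m = e then Poly_Mapping.lookup p m else 0)"
proof -
  have "Poly_Mapping.lookup (coeff (grad p) e) m = (\<Sum>x\<in>Poly_Mapping.keys p.
      if x = m then (if mdegree x = e then Poly_Mapping.lookup p m else 0) else 0)"
    unfolding grad_conv_sum coeff_sum lookup_sum
    by (intro sum.cong) (auto simp: lookup_single when_def)
  then show ?thesis by (auto simp: sum.delta in_keys_iff)
qed

lemma homogeneous_coeff_grad: "homogeneous e (coeff (grad p) e)"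
  by (auto simp: homogeneous_def in_keys_iff lookup_coeff_grad split: if_splits)

lemma mvars_coeff_grad: "mvars (coeff (grad p) e) \<subseteq> mvars p"
  by (auto simp: mvars_def in_keys_iff lookup_coeff_grad split: if_splits)

text \<open>Turns homogeneity into an equation, so that its closure laws follow from
  \<open>grad\<close> being a ring homomorphism.\<close>

lemma homogeneous_iff_grad: "homogeneous e p \<longleftrightarrow> grad p = monom p e"
proof
  assume h: "homogeneous e p"
  show "grad p = monom p e"
  proof (intro poly_eqI poly_mapping_eqI)
    fix i m
    show "Poly_Mapping.lookup (coeff (grad p) i) m = Poly_Mapping.lookup (coeff (monom p e) i) m"
      using h by (auto simp: lookup_coeff_grad homogeneous_def in_keys_iff)
  qed
next
  assume "grad p = monom p e"
  then show "homogeneous e p" using homogeneous_coeff_grad[of e p] by simp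
qed

lemma homogeneous_mult: "homogeneous a p \<Longrightarrow> homogeneous b q \<Longrightarrow> homogeneous (a + b) (p * q)"
  by (simp add: homogeneous_iff_grad grad_hom mult_monom)

lemma homogeneous_add: "homogeneous a p \<Longrightarrow> homogeneous a q \<Longrightarrow> homogeneous a (p + q)"
  by (simp add: homogeneous_iff_grad grad_hom add_monom)

lemma homogeneous_uminus: "homogeneous a p \<Longrightarrow> homogeneous a (- p)"
  by (simp add: homogeneous_iff_grad grad_hom minus_monom)

lemma homogeneous_0 [simp]: "homogeneous a 0"
  by (simp add: homogeneous_iff_grad)

lemma homogeneous_sum: "(\<And>i. i \<in> A \<Longrightarrow> homogeneous a (g i)) \<Longrightarrow> homogeneous a (sum g A)"
  by (induction A rule: infinite_finite_induct) (auto intro: homogeneous_add)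

lemma homogeneous_mconst [simp]: "homogeneous 0 (mconst c)"
  by (simp add: homogeneous_iff_grad monom_0)

lemma homogeneous_1 [simp]: "homogeneous 0 1"
  using homogeneous_mconst[of 1] by simp

lemma homogeneous_mvar [simp]: "homogeneous 1 (mvar v)"
  by (simp add: homogeneous_iff_grad monom_Suc monom_0)

lemma homogeneous_power: "homogeneous a p \<Longrightarrow> homogeneous (a * k) (p ^ k)"
  by (induction k) (auto dest: homogeneous_mult)

lemma homogeneous_unique: "homogeneous a p \<Longrightarrow> homogeneous b p \<Longrightarrow> p \<noteq> 0 \<Longrightarrow> a = b"
  by (metis homogeneous_iff_grad coeff_monom)

section \<open>Derivatives at a point\<close>

definition dat :: "('v \<Rightarrow> 'k::comm_ring_1) \<Rightarrow> 'v \<Rightarrow> ('v, 'k) mpoly \<Rightarrow> 'k" where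
  "dat z i p = meval (mderiv i p) z"

text \<open>First-order expansion: x_i is replaced by z_i + \<epsilon>. Ordinary polynomials in
  \<epsilon> replace dual numbers, as only the coefficients 0 and 1 are read; the Leibniz rule then
  comes from multiplying polynomials.\<close>

lemma dat_conv_coeff:
  "dat z i p = coeff (msubst (\<lambda>c. [:c:]) (\<lambda>v. [:z v, of_bool (v = i):]) p) 1"
proof -
  let ?\<rho> = "\<lambda>v. [:z v, of_bool (v = i):]"
  have mon: "coeff (mon_eval ?\<rho> m) 1 =
      of_nat (Poly_Mapping.lookup m i) * mon_eval z (m - Poly_Mapping.single i 1)" for m
  proof -
    let ?V = "insert i (Poly_Mapping.keys m)"
    have fin: "finite ?V" by simp
    let ?m' = "m - Poly_Mapping.single i 1"
    have k': "Poly_Mapping.keys ?m' \<subseteq> ?V"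
      by (auto simp: in_keys_iff lookup_minus)
    have c: "(\<Prod>v\<in>A. [:z v, of_bool (v = i):] ^ k v) = [:\<Prod>v\<in>A. z v ^ k v:]" if "i \<notin> A" for A k
      using that by (induction A rule: infinite_finite_induct)
        (auto simp: one_pCons poly_const_pow mult.commute)
    have b: "coeff ([:z i, 1:] ^ k) 1 = of_nat k * z i ^ (k - 1)" for k
    proof (induction k)
      case (Suc k)
      have "coeff ([:z i, 1:] ^ k) 0 = z i ^ k" by (simp add: coeff_0_power)
      then show ?case using Suc by (cases k) (auto simp: coeff_pCons algebra_simps)
    qed (simp add: one_pCons)
    have "mon_eval ?\<rho> m = [:z i, 1:] ^ Poly_Mapping.lookup m i * [:\<Prod>v\<in>?V-{i}. z v ^ Poly_Mapping.lookup m v:]"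
      unfolding mon_eval_superset[OF fin subset_insertI]
      by (subst prod.remove[OF fin, of i], simp, subst c[symmetric]) simp_all
    then have "coeff (mon_eval ?\<rho> m) 1 =
       (of_nat (Poly_Mapping.lookup m i) * z i ^ (Poly_Mapping.lookup m i - 1)) * (\<Prod>v\<in>?V-{i}. z v ^ Poly_Mapping.lookup m v)"
      using b by (simp add: mult.commute)
    also have "(\<Prod>v\<in>?V-{i}. z v ^ Poly_Mapping.lookup m v) = (\<Prod>v\<in>?V-{i}. z v ^ Poly_Mapping.lookup ?m' v)"
      by (intro prod.cong) (auto simp: lookup_minus lookup_single)
    also have "of_nat (Poly_Mapping.lookup m i) * z i ^ (Poly_Mapping.lookup m i - 1) * \<dots> =
        of_nat (Poly_Mapping.lookup m i) * mon_eval z ?m'"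
      unfolding mon_eval_superset[OF fin k']
      by (subst prod.remove[OF fin, of i]) (auto simp: lookup_minus mult_ac)
    finally show ?thesis .
  qed
  show ?thesis
    unfolding dat_def mderiv_def
    by (subst meval_hom, unfold meval_conv_msubst msubst_single[OF coeff_hom_id])
       (simp add: msubst_def coeff_sum mon mult_ac flip: mon_eval_def One_nat_def)
qed

lemma msubst_dual_0: "coeff (msubst (\<lambda>c. [:c:]) (\<lambda>v. [:z v, of_bool (v = i):]) p) 0 = meval p z"
proof -
  have "mvars p \<subseteq> UNIV" by simp
  then show ?thesis by (induction p rule: mpoly_induct) (auto simp: msubst_hom meval_hom coeff_mult_0)
qed

lemma dat_add: "dat z i (p + q) = dat z i p + dat z i q"
  and dat_diff: "dat z i (p - q) = dat z i p - dat z i q"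
  and dat_mult: "dat z i (p * q) = dat z i p * meval q z + meval p z * dat z i q"
  and dat_mconst: "dat z i (mconst c) = 0"
  and dat_mvar: "dat z i (mvar v) = of_bool (v = i)"
  and dat_sum: "dat z i (sum g A) = (\<Sum>j\<in>A. dat z i (g j))"
  for z :: "'v \<Rightarrow> 'k::comm_ring_1"
proof -
  show "dat z i (p + q) = dat z i p + dat z i q" "dat z i (p - q) = dat z i p - dat z i q"
    "dat z i (mconst c) = 0" "dat z i (mvar v) = of_bool (v = i)"
    "dat z i (sum g A) = (\<Sum>j\<in>A. dat z i (g j))"
    by (simp_all add: dat_conv_coeff msubst_hom coeff_sum)
  have "coeff (a * b) 1 = coeff a 1 * coeff b 0 + coeff a 0 * coeff b 1" for a b :: "'k poly"
    by (simp add: coeff_mult)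
  then show "dat z i (p * q) = dat z i p * meval q z + meval p z * dat z i q"
    by (simp only: dat_conv_coeff msubst_hom msubst_dual_0 coeff_hom_const_poly)
qed

section \<open>Linear algebra\<close>

text \<open>Gaussian elimination: solving one equation for an unknown with nonzero coefficient costs
  one equation and one unknown.\<close>

lemma homogeneous_system_nontrivial:
  fixes a :: "'e \<Rightarrow> 'i \<Rightarrow> 'k::field"
  assumes "finite E" "finite I" "card E < card I"
  shows "\<exists>v. (\<exists>i\<in>I. v i \<noteq> 0) \<and> (\<forall>e\<in>E. (\<Sum>i\<in>I. a e i * v i) = 0)"
  using assms
proof (induction E arbitrary: I a rule: finite_induct)
  case empty
  then obtain i where "i \<in> I" by (metis card.empty card_gt_0_iff ex_in_conv)
  then show ?case by (intro exI[of _ "\<lambda>_. 1"]) auto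
next
  case (insert e E)
  show ?case
  proof (cases "\<forall>i\<in>I. a e i = 0")
    case True
    have "card E < card I" using insert by simp
    then obtain v where "\<exists>i\<in>I. v i \<noteq> 0" "\<forall>e\<in>E. (\<Sum>i\<in>I. a e i * v i) = 0"
      using insert.IH[OF insert.prems(1)] by blast
    then show ?thesis using True by (intro exI[of _ v]) auto
  next
    case False
    then obtain j where j: "j \<in> I" "a e j \<noteq> 0" by blast
    \<comment> \<open>The remaining equations after the solution of equation \<open>e\<close> for
      the unknown \<open>j\<close> has been substituted.\<close>
    define a' where "a' = (\<lambda>x i. a x i - a x j * a e i / a e j)"
    have "card E < card (I - {j})" using insert j by simp
    then obtain v where v: "\<exists>i\<in>I-{j}. v i \<noteq> 0" "\<forall>x\<in>E. (\<Sum>i\<in>I-{j}. a' x i * v i) = 0"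
      using insert.IH[of "I - {j}" a'] insert.prems by auto
    define w where "w = v(j := - (\<Sum>i\<in>I-{j}. a e i * v i) / a e j)"
    have sw: "(\<Sum>i\<in>I. a x i * w i) = a x j * w j + (\<Sum>i\<in>I-{j}. a x i * v i)" for x
      unfolding sum.remove[OF insert.prems(1) j(1)] by (auto simp: w_def intro!: sum.cong)
    have "(\<Sum>i\<in>I. a e i * w i) = 0" unfolding sw using j(2) by (simp add: w_def)
    moreover have "(\<Sum>i\<in>I. a x i * w i) = 0" if "x \<in> E" for x
    proof -
      have "(\<Sum>i\<in>I-{j}. a x i * v i - a x j / a e j * (a e i * v i)) = (\<Sum>i\<in>I-{j}. a' x i * v i)"
        by (intro sum.cong) (auto simp: a'_def left_diff_distrib)
      also have "\<dots> = 0" using v(2) that by blast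
      finally have "(\<Sum>i\<in>I-{j}. a x i * v i - a x j / a e j * (a e i * v i)) = 0" .
      then have "(\<Sum>i\<in>I-{j}. a x i * v i) - a x j / a e j * (\<Sum>i\<in>I-{j}. a e i * v i) = 0"
        by (simp only: sum_subtractf sum_distrib_left)
      then show ?thesis unfolding sw by (simp add: w_def)
    qed
    moreover have "\<exists>i\<in>I. w i \<noteq> 0" using v(1) by (auto simp: w_def)
    ultimately show ?thesis by blast
  qed
qed

text \<open>Linear independence of the vectors \<open>G j\<close> in the form of a witness, the dual
  vectors \<gamma>. The Newton iteration and the right inverse of the Jacobian matrix need such
  vectors explicitly.\<close>

definition dual_family :: "'i set \<Rightarrow> ('j \<Rightarrow> 'i \<Rightarrow> 'k::field) \<Rightarrow> 'j set \<Rightarrow> ('j \<Rightarrow> 'i \<Rightarrow> 'k) \<Rightarrow> bool" where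
  "dual_family I G A \<gamma> \<longleftrightarrow>
     (\<forall>j\<in>A. \<forall>j'\<in>A. (\<Sum>i\<in>I. G j i * \<gamma> j' i) = of_bool (j = j'))"

text \<open>Take \<open>A\<close> of maximal size among the sets with a dual family. If it has fewer
  than \<open>c\<close> elements, its equations imply all others, since an index with a violated
  equation could be adjoined.\<close>

lemma dual_family_dichotomy:
  fixes G :: "'j \<Rightarrow> 'i \<Rightarrow> 'k::field"
  assumes "finite R"
  shows "(\<exists>A\<subseteq>R. card A = c \<and> (\<exists>\<gamma>. dual_family I G A \<gamma>)) \<or>
    (\<exists>A\<subseteq>R. card A < c \<and> (\<forall>v. (\<forall>j\<in>A. (\<Sum>i\<in>I. G j i * v i) = 0) \<longrightarrow> (\<forall>j\<in>R. (\<Sum>i\<in>I. G j i * v i) = 0)))"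
proof -
  let ?D = "{A. A \<subseteq> R \<and> (\<exists>\<gamma>. dual_family I G A \<gamma>)}"
  have fin: "finite ?D" by (rule finite_subset[OF _ finite_Pow_iff[THEN iffD2, OF assms]]) blast
  have "{} \<in> ?D" by (auto simp: dual_family_def)
  then have "Max (card ` ?D) \<in> card ` ?D" using fin by (intro Max_in finite_imageI) blast+
  then obtain A where A: "A \<in> ?D" and cA: "Max (card ` ?D) = card A" by (rule imageE)
  have max: "card B \<le> card A" if "B \<in> ?D" for B
    unfolding cA[symmetric] using fin that by (intro Max_ge finite_imageI imageI)
  from A obtain \<gamma> where \<gamma>: "dual_family I G A \<gamma>" and AR: "A \<subseteq> R" by auto
  show ?thesis
  proof (cases "c \<le> card A")
    case True
    then obtain B where "B \<subseteq> A" "card B = c" by (meson obtain_subset_with_card_n)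
    moreover from this have "dual_family I G B \<gamma>" using \<gamma> unfolding dual_family_def by blast
    ultimately show ?thesis using AR by blast
  next
    case False
    have "(\<Sum>i\<in>I. G j0 i * v i) = 0" if v: "\<forall>j\<in>A. (\<Sum>i\<in>I. G j i * v i) = 0" and j0: "j0 \<in> R" for v j0
    proof (rule ccontr)
      define t where "t = (\<Sum>i\<in>I. G j0 i * v i)"
      assume "(\<Sum>i\<in>I. G j0 i * v i) \<noteq> 0"
      then have t: "t \<noteq> 0" by (simp add: t_def)
      then have j0A: "j0 \<notin> A" using v by (auto simp: t_def)
      define s where "s j = (\<Sum>i\<in>I. G j0 i * \<gamma> j i)" for j
      \<comment> \<open>\<open>v\<close> is scaled to pair to 1 with \<open>G j0\<close>; the old
        dual vectors are corrected by multiples of \<open>v\<close>, which \<open>A\<close> does not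
        see, to become orthogonal to \<open>G j0\<close>.\<close>
      define \<gamma>' where "\<gamma>' j i = (if j = j0 then v i / t else \<gamma> j i - s j / t * v i)" for j i
      have "(\<Sum>i\<in>I. G j i * \<gamma>' j' i) = of_bool (j = j')" if "j \<in> insert j0 A" "j' \<in> insert j0 A" for j j'
      proof (cases "j' = j0")
        case True
        have "(\<Sum>i\<in>I. G j i * \<gamma>' j' i) = (\<Sum>i\<in>I. G j i * v i) / t"
          by (simp add: True \<gamma>'_def sum_divide_distrib)
        then show ?thesis using that True v t by (auto simp: t_def)
      next
        case False
        have "(\<Sum>i\<in>I. G j i * \<gamma>' j' i) = (\<Sum>i\<in>I. G j i * \<gamma> j' i) - s j' / t * (\<Sum>i\<in>I. G j i * v i)"
          using False by (simp add: \<gamma>'_def algebra_simps sum_subtractf sum_distrib_left)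
        then show ?thesis using that False v t \<gamma> j0A
          by (auto simp: t_def[symmetric] s_def[symmetric] dual_family_def)
      qed
      then have "dual_family I G (insert j0 A) \<gamma>'" by (simp only: dual_family_def) blast
      then have "insert j0 A \<in> ?D" using AR j0 by blast
      from max[OF this] show False using j0A assms AR by (simp add: finite_subset)
    qed
    then show ?thesis using False AR by (intro disjI2 exI[of _ A]) auto
  qed
qed

section \<open>Growth of graded quotients\<close>

definition form :: "nat \<Rightarrow> nat \<Rightarrow> (nat, 'k::comm_ring_1) mpoly \<Rightarrow> bool" where
  "form n e p \<longleftrightarrow> p \<in> carrier (coord_ring n) \<and> homogeneous e p"

lemma carrier_coord_ring: "p \<in> carrier (coord_ring n) \<longleftrightarrow> mvars p \<subseteq> {0..n}"
  by (simp add: coord_ring_def)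

lemma form_mult: "form n a p \<Longrightarrow> form n b q \<Longrightarrow> form n (a + b) (p * q)"
  by (auto simp: form_def carrier_coord_ring homogeneous_mult mvars_mult)

lemma form_sum: "(\<And>i. i \<in> A \<Longrightarrow> form n e (g i)) \<Longrightarrow> form n e (sum g A)"
  by (auto simp: form_def carrier_coord_ring homogeneous_sum intro!: mvars_sum)

lemma form_mconst [simp]: "form n 0 (mconst c)"
  by (simp add: form_def carrier_coord_ring)

lemma form_cmult: "form n e p \<Longrightarrow> form n e (mconst c * p)"
  using form_mult[of n 0 "mconst c" e p] by simp

lemma form_mvar: "i \<le> n \<Longrightarrow> form n 1 (mvar i)"
  using mvars_mvar[of i] homogeneous_mvar[of i] unfolding form_def carrier_coord_ring by auto

lemma form_power: "form n e p \<Longrightarrow> form n (e * k) (p ^ k)"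
  by (auto simp: form_def carrier_coord_ring homogeneous_power mvars_power)

text \<open>\<open>Q\<close> need not be an ideal; only the forms it contains matter.\<close>

definition indep_mod :: "nat \<Rightarrow> (nat, 'k::field) mpoly set \<Rightarrow> nat \<Rightarrow> nat \<Rightarrow> bool" where
  "indep_mod n Q N m \<longleftrightarrow> (\<exists>B. (\<forall>i<m. form n N (B i)) \<and>
     (\<forall>c. (\<Sum>i<m. mconst (c i) * B i) \<in> Q \<longrightarrow> (\<forall>i<m. c i = 0)))"

text \<open>Modulo \<open>Q\<close> there are at least roughly (N / A)^l independent forms of degree
  N. The auxiliary \<open>K\<close> avoids division, and bounded shifts of the degree are absorbed
  by \<open>A\<close>.\<close>

definition growth :: "nat \<Rightarrow> (nat, 'k::field) mpoly set \<Rightarrow> nat \<Rightarrow> bool" where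
  "growth n Q l \<longleftrightarrow> (\<exists>A. \<forall>K N. A * K \<le> N \<longrightarrow> indep_mod n Q N (K ^ l))"

lemma growth_antimono:
  assumes "growth n Q l" "\<And>e p. form n e p \<Longrightarrow> p \<in> Q' \<Longrightarrow> p \<in> Q"
  shows "growth n Q' l"
proof -
  have "indep_mod n Q' N m" if "indep_mod n Q N m" for N m
  proof -
    from that obtain B where B: "\<And>i. i < m \<Longrightarrow> form n N (B i)"
      and ind: "\<And>c. (\<Sum>i<m. mconst (c i) * B i) \<in> Q \<Longrightarrow> (\<forall>i<m. c i = 0)"
      unfolding indep_mod_def by blast
    have "form n N (\<Sum>i<m. mconst (c i) * B i)" for c
      by (intro form_sum form_cmult B) auto
    then show ?thesis unfolding indep_mod_def using B ind assms(2) by blast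
  qed
  then show ?thesis using assms(1) unfolding growth_def by blast
qed

text \<open>Numerical shadow of multiplication by \<open>g\<close> on the quotient by
  \<open>Q0\<close>, an injective map whose cokernel surjects onto the quotient by
  \<open>Q1\<close>: independent forms modulo \<open>Q1\<close> and \<open>g\<close> times
  independent forms modulo \<open>Q0\<close> are jointly independent.\<close>

lemma indep_mod_add:
  assumes Q1: "indep_mod n Q1 N m1" and Q0: "indep_mod n Q0 M m0" and N: "N = M + e"
    and sub: "\<And>a p. form n a p \<Longrightarrow> p \<in> Q0 \<Longrightarrow> p \<in> Q1"
    and add1: "\<And>a p q. form n a p \<Longrightarrow> form n a q \<Longrightarrow> p \<in> Q1 \<Longrightarrow> q \<in> Q1 \<Longrightarrow> p + q \<in> Q1"
    and mult1: "\<And>a b p q. form n a p \<Longrightarrow> form n b q \<Longrightarrow> p \<in> Q1 \<Longrightarrow> q * p \<in> Q1"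
    and g: "form n e g" "g \<in> Q1"
    and nzd: "\<And>a p. form n a p \<Longrightarrow> g * p \<in> Q0 \<Longrightarrow> p \<in> Q0"
  shows "indep_mod n Q0 N (m1 + m0)"
proof -
  from Q1 obtain B1 where B1: "\<And>i. i < m1 \<Longrightarrow> form n N (B1 i)"
    and i1: "\<And>c i. (\<Sum>i<m1. mconst (c i) * B1 i) \<in> Q1 \<Longrightarrow> i < m1 \<Longrightarrow> c i = 0"
    unfolding indep_mod_def by blast
  from Q0 obtain B0 where B0: "\<And>i. i < m0 \<Longrightarrow> form n M (B0 i)"
    and i0: "\<And>c i. (\<Sum>i<m0. mconst (c i) * B0 i) \<in> Q0 \<Longrightarrow> i < m0 \<Longrightarrow> c i = 0"
    unfolding indep_mod_def by blast
  define B where "B i = (if i < m1 then B1 i else g * B0 (i - m1))" for i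
  have B: "form n N (B i)" if "i < m1 + m0" for i
    using that B1 form_mult[OF g(1) B0, of "i - m1"] by (auto simp: B_def N add.commute)
  have split: "(\<Sum>i<m1+m0. mconst (c i) * B i) =
      (\<Sum>i<m1. mconst (c i) * B1 i) + g * (\<Sum>i<m0. mconst (c (m1 + i)) * B0 i)" for c
  proof -
    have "(\<Sum>i<m1+m0. mconst (c i) * B i) =
      (\<Sum>i<m1. mconst (c i) * B i) + (\<Sum>i<m0. mconst (c (m1 + i)) * B (m1 + i))"
      by (induction m0) (auto simp: add_ac)
    then show ?thesis by (simp add: B_def sum_distrib_left mult_ac)
  qed
  have "c i = 0" if c: "(\<Sum>i<m1+m0. mconst (c i) * B i) \<in> Q0" and i: "i < m1 + m0" for c i
  proof -
    let ?s1 = "\<Sum>i<m1. mconst (c i) * B1 i" and ?s0 = "\<Sum>i<m0. mconst (c (m1 + i)) * B0 i"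
    have f1: "form n N ?s1" by (intro form_sum form_cmult B1) auto
    have f0: "form n M ?s0" by (intro form_sum form_cmult B0) auto
    have fg: "form n N (g * ?s0)" using form_mult[OF g(1) f0] by (simp add: N add.commute)
    have fB: "form n N (\<Sum>i<m1+m0. mconst (c i) * B i)" by (intro form_sum form_cmult B) auto
    have "g * ?s0 \<in> Q1" using mult1[OF g(1) f0 g(2)] by (simp add: mult.commute)
    then have "mconst (-1) * (g * ?s0) \<in> Q1" by (rule mult1[OF fg form_mconst])
    moreover have "?s1 + g * ?s0 \<in> Q1" "form n N (?s1 + g * ?s0)"
      using c sub[OF fB] fB unfolding split by auto
    ultimately have "(?s1 + g * ?s0) + mconst (-1) * (g * ?s0) \<in> Q1"
      by (intro add1[OF _ form_cmult[OF fg]])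
    then have "?s1 \<in> Q1" by (simp add: mconst_uminus)
    then have z: "c i = 0" if "i < m1" for i using i1 that by blast
    then have "?s1 = 0" by simp
    then have "g * ?s0 \<in> Q0" using c unfolding split by simp
    then have "?s0 \<in> Q0" by (rule nzd[OF f0])
    then have "c (m1 + i) = 0" if "i < m0" for i using i0[of "\<lambda>i. c (m1 + i)"] that by blast
    then show ?thesis using z i by (metis add_diff_inverse_nat nat_add_left_cancel_less)
  qed
  then show ?thesis unfolding indep_mod_def using B by blast
qed

lemma indep_mod_0: "indep_mod n Q N 0"
  by (simp add: indep_mod_def)

lemma growth_Suc:
  assumes Q1: "growth n Q1 l"
    and sub: "\<And>a p. form n a p \<Longrightarrow> p \<in> Q0 \<Longrightarrow> p \<in> Q1"
    and add1: "\<And>a p q. form n a p \<Longrightarrow> form n a q \<Longrightarrow> p \<in> Q1 \<Longrightarrow> q \<in> Q1 \<Longrightarrow> p + q \<in> Q1"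
    and mult1: "\<And>a b p q. form n a p \<Longrightarrow> form n b q \<Longrightarrow> p \<in> Q1 \<Longrightarrow> q * p \<in> Q1"
    and g: "form n e g" "g \<in> Q1"
    and nzd: "\<And>a p. form n a p \<Longrightarrow> g * p \<in> Q0 \<Longrightarrow> p \<in> Q0"
  shows "growth n Q0 (Suc l)"
proof -
  from Q1 obtain A where A: "\<And>K N. A * K \<le> N \<Longrightarrow> indep_mod n Q1 N (K ^ l)"
    unfolding growth_def by blast
  \<comment> \<open>Each of \<open>j\<close> divisions by \<open>g\<close> adds \<open>K ^ l\<close>
    forms and costs \<open>e\<close> degrees, and \<open>A * K\<close> degrees must remain for
    \<open>Q1\<close>. Taking \<open>j = K\<close> gives the exponent \<open>Suc l\<close> and the
    constant \<open>A + e\<close>.\<close>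
  have "indep_mod n Q0 N (j * K ^ l)" if "A * K + e * j \<le> N" for j K N
    using that
  proof (induction j arbitrary: N)
    case 0
    then show ?case by (simp add: indep_mod_0)
  next
    case (Suc j)
    have "indep_mod n Q0 (N - e) (j * K ^ l)"
      using Suc.prems by (intro Suc.IH) simp
    moreover have "indep_mod n Q1 N (K ^ l)" using Suc.prems by (intro A) simp
    ultimately have "indep_mod n Q0 N (K ^ l + j * K ^ l)"
      using Suc.prems by (intro indep_mod_add[OF _ _ _ sub add1 mult1 g nzd, of N _ "N - e"]) auto
    then show ?case by simp
  qed
  from this[where j = K and K = K for K] show ?thesis
    unfolding growth_def by (intro exI[of _ "A + e"]) (auto simp: distrib_right)
qed

lemma growth_0:
  assumes "\<And>N. \<exists>p. form n N p \<and> p \<notin> Q"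
    and "\<And>a b p q. form n a p \<Longrightarrow> form n b q \<Longrightarrow> p \<in> Q \<Longrightarrow> q * p \<in> Q"
  shows "growth n Q 0"
proof -
  have "indep_mod n Q N 1" for N
  proof -
    obtain p where p: "form n N p" "p \<notin> Q" using assms(1) by blast
    have "c = 0" if "mconst c * p \<in> Q" for c
    proof (rule ccontr)
      assume "c \<noteq> 0"
      have "mconst (inverse c) * (mconst c * p) \<in> Q"
        by (rule assms(2)[OF form_cmult[OF p(1)] form_mconst that])
      then show False using \<open>c \<noteq> 0\<close> p(2) by (simp add: mult.assoc[symmetric] flip: mconst_mult)
    qed
    then show ?thesis using p unfolding indep_mod_def by (intro exI[of _ "\<lambda>_. p"]) auto
  qed
  then show ?thesis by (simp add: growth_def)
qed

text \<open>The exponent of x_0 is determined by the degree and the other exponents. This gives the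
  power \<open>n\<close> instead of \<open>n + 1\<close>, the dimension of projective space.\<close>

lemma card_monomials:
  fixes n N :: nat
  defines "M \<equiv> {m :: nat \<Rightarrow>\<^sub>0 nat. Poly_Mapping.keys m \<subseteq> {0..n} \<and> mdegree m = N}"
  shows "finite M \<and> card M \<le> (N + 1) ^ n"
proof -
  let ?r = "\<lambda>m. restrict (Poly_Mapping.lookup m) {1..n}"
  have deg: "mdegree m = (\<Sum>v\<in>{0..n}. Poly_Mapping.lookup m v)" if "Poly_Mapping.keys m \<subseteq> {0..n}" for m
    unfolding mdegree_def using that by (intro sum.mono_neutral_left) (auto simp: in_keys_iff)
  have inj: "inj_on ?r M"
  proof (rule inj_onI)
    fix m m' assume m: "m \<in> M" "m' \<in> M" and eq: "?r m = ?r m'"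
    have e1: "Poly_Mapping.lookup m i = Poly_Mapping.lookup m' i" if "i \<in> {1..n}" for i
      using fun_cong[OF eq, of i] that by simp
    have "(\<Sum>v\<in>{0..n}. Poly_Mapping.lookup m v) = (\<Sum>v\<in>{0..n}. Poly_Mapping.lookup m' v)"
      using m by (simp add: M_def flip: deg)
    moreover have "{0..n} = insert 0 {1..n}" by auto
    moreover have "(\<Sum>v\<in>{1..n}. Poly_Mapping.lookup m v) = (\<Sum>v\<in>{1..n}. Poly_Mapping.lookup m' v)"
      by (intro sum.cong refl e1)
    ultimately have e0: "Poly_Mapping.lookup m 0 = Poly_Mapping.lookup m' 0"
      by simp
    have "Poly_Mapping.lookup m i = Poly_Mapping.lookup m' i" for i
    proof -
      consider "i = 0" | "i \<in> {1..n}" | "i \<notin> {0..n}" by (cases i) auto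
      then show ?thesis
      proof cases
        case 3
        then have "i \<notin> Poly_Mapping.keys m" "i \<notin> Poly_Mapping.keys m'" using m by (auto simp: M_def)
        then show ?thesis by (simp add: in_keys_iff)
      qed (use e0 e1 in auto)
    qed
    then show "m = m'" by (intro poly_mapping_eqI)
  qed
  have sub: "?r ` M \<subseteq> {1..n} \<rightarrow>\<^sub>E {0..N}"
  proof
    fix x assume "x \<in> ?r ` M"
    then obtain m where m: "m \<in> M" "x = ?r m" by blast
    have "Poly_Mapping.lookup m i \<le> N" if "i \<in> {1..n}" for i
      using m that deg[of m] member_le_sum[of i "{0..n}" "Poly_Mapping.lookup m"] by (auto simp: M_def)
    then show "x \<in> {1..n} \<rightarrow>\<^sub>E {0..N}" by (auto simp: m)
  qed
  have fin: "finite ({1..n} \<rightarrow>\<^sub>E {0..N})" by (intro finite_PiE) auto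
  have "finite M" using inj sub fin by (meson finite_imageD finite_subset)
  moreover have "card M \<le> card ({1..n} \<rightarrow>\<^sub>E {0..N})"
    using card_mono[OF fin sub] card_image[OF inj] by simp
  ultimately show ?thesis by (simp add: card_PiE)
qed

text \<open>More forms than monomials of degree \<open>N\<close> satisfy a nontrivial linear
  relation.\<close>

lemma indep_mod_le_card:
  assumes "indep_mod n Q N m" "0 \<in> Q"
  shows "m \<le> (N + 1) ^ n"
proof (rule ccontr)
  assume m: "\<not> ?thesis"
  define M where "M = {m :: nat \<Rightarrow>\<^sub>0 nat. Poly_Mapping.keys m \<subseteq> {0..n} \<and> mdegree m = N}"
  from assms obtain B where B: "\<And>i. i < m \<Longrightarrow> form n N (B i)"
    and ind: "\<And>c i. (\<Sum>i<m. mconst (c i) * B i) \<in> Q \<Longrightarrow> i < m \<Longrightarrow> c i = 0"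
    unfolding indep_mod_def by blast
  have "finite M" "card M < card {..<m}" using card_monomials[of n N] m by (auto simp: M_def)
  from homogeneous_system_nontrivial[OF this(1) finite_lessThan this(2), of "\<lambda>x i. Poly_Mapping.lookup (B i) x"]
  obtain c where c: "\<exists>i<m. c i \<noteq> 0" "\<forall>x\<in>M. (\<Sum>i<m. Poly_Mapping.lookup (B i) x * c i) = 0" by auto
  have keys: "Poly_Mapping.keys (B i) \<subseteq> M" if "i < m" for i
    using B[OF that] by (auto simp: form_def carrier_coord_ring mvars_def homogeneous_def M_def)
  have lk: "Poly_Mapping.lookup (mconst a * p) x = a * Poly_Mapping.lookup p x" for a x and p :: "(nat, 'a) mpoly"
    unfolding mconst_def mult_map_scale_conv_mult[symmetric] by (simp add: Poly_Mapping.map.rep_eq when_def)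
  have "(\<Sum>i<m. mconst (c i) * B i) = 0"
  proof (rule poly_mapping_eqI)
    fix x
    show "Poly_Mapping.lookup (\<Sum>i<m. mconst (c i) * B i) x = Poly_Mapping.lookup 0 x"
    proof (cases "x \<in> M")
      case True
      then have "(\<Sum>i<m. c i * Poly_Mapping.lookup (B i) x) = 0" using c(2) by (simp add: mult.commute)
      then show ?thesis by (simp add: lookup_sum lk)
    next
      case False
      then have "Poly_Mapping.lookup (B i) x = 0" if "i < m" for i
        using keys[OF that] by (auto simp: in_keys_iff)
      then show ?thesis by (simp add: lookup_sum lk)
    qed
  qed
  then show False using ind assms(2) c(1) by auto
qed

lemma growth_le:
  assumes "growth n Q l" "0 \<in> Q"
  shows "l \<le> n"
proof (rule ccontr)
  assume l: "\<not> l \<le> n"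
  from assms(1) obtain A where A: "\<And>K N. A * K \<le> N \<Longrightarrow> indep_mod n Q N (K ^ l)"
    unfolding growth_def by blast
  \<comment> \<open>Chosen so that \<open>K ^ (n + 1)\<close> exceeds
    \<open>((A + 1) * K) ^ n\<close>, a bound for the number of monomials of degree
    \<open>A * K\<close>.\<close>
  define K where "K = (A + 1) ^ n + 1"
  have K1: "K \<ge> 1" by (simp add: K_def)
  have "K ^ (n + 1) \<le> K ^ l" using l K1 by (intro power_increasing) auto
  also have "\<dots> \<le> (A * K + 1) ^ n"
    using indep_mod_le_card[OF A assms(2)] by blast
  also have "\<dots> \<le> ((A + 1) * K) ^ n"
    using K1 by (intro power_mono) (auto simp: distrib_right)
  also have "\<dots> = (A + 1) ^ n * K ^ n" by (rule power_mult_distrib)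
  finally have "K * K ^ n \<le> (A + 1) ^ n * K ^ n" by simp
  moreover have "K ^ n > 0" using K1 by simp
  ultimately have "K \<le> (A + 1) ^ n" by (metis mult_le_cancel2)
  then show False by (simp add: K_def)
qed

section \<open>Noetherian rings and the Krull intersection theorem\<close>

definition is_subring :: "'a::comm_ring_1 set \<Rightarrow> bool" where
  "is_subring R \<longleftrightarrow> 0 \<in> R \<and> 1 \<in> R \<and> (\<forall>a\<in>R. \<forall>b\<in>R. a + b \<in> R \<and> a * b \<in> R) \<and> (\<forall>a\<in>R. - a \<in> R)"

definition combos :: "'a::comm_ring_1 set \<Rightarrow> (nat \<Rightarrow> 'a) \<Rightarrow> nat \<Rightarrow> 'a set" where
  "combos R F k = {\<Sum>i<k. c i * F i | c. \<forall>i<k. c i \<in> R}"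

text \<open>Chains of ideals are replaced by sequences in which some term is a combination of its
  predecessors. This passes to images by lifting sequences and yields directly the relation wanted
  in the Rees ring.\<close>

definition noetherian_subring :: "'a::comm_ring_1 set \<Rightarrow> bool" where
  "noetherian_subring R \<longleftrightarrow> is_subring R \<and> (\<forall>F. range F \<subseteq> R \<longrightarrow> (\<exists>k. F k \<in> combos R F k))"

lemma is_subringD:
  assumes "is_subring R"
  shows "0 \<in> R" "1 \<in> R" "a \<in> R \<Longrightarrow> b \<in> R \<Longrightarrow> a + b \<in> R" "a \<in> R \<Longrightarrow> b \<in> R \<Longrightarrow> a * b \<in> R"
    "a \<in> R \<Longrightarrow> - a \<in> R" "a \<in> R \<Longrightarrow> b \<in> R \<Longrightarrow> a - b \<in> R"
  using assms unfolding is_subring_def by (simp_all, metis add_uminus_conv_diff)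

lemma is_subring_sum: "is_subring R \<Longrightarrow> (\<And>i. i \<in> A \<Longrightarrow> g i \<in> R) \<Longrightarrow> sum g A \<in> R"
  by (induction A rule: infinite_finite_induct) (auto intro: is_subringD)

lemma is_subring_power: "is_subring R \<Longrightarrow> a \<in> R \<Longrightarrow> a ^ k \<in> R"
  by (induction k) (auto intro: is_subringD)

lemma combos_0: "is_subring R \<Longrightarrow> 0 \<in> combos R F k"
  unfolding combos_def by (rule CollectI, rule exI[of _ "\<lambda>_. 0"]) (auto intro: is_subringD)

lemma combos_add: "is_subring R \<Longrightarrow> a \<in> combos R F k \<Longrightarrow> b \<in> combos R F k \<Longrightarrow> a + b \<in> combos R F k"
  unfolding combos_def
proof safe
  fix c d assume "is_subring R" "\<forall>i<k. c i \<in> R" "\<forall>i<k. d i \<in> R"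
  then show "\<exists>e. (\<Sum>i<k. c i * F i) + (\<Sum>i<k. d i * F i) = (\<Sum>i<k. e i * F i) \<and> (\<forall>i<k. e i \<in> R)"
    by (intro exI[of _ "\<lambda>i. c i + d i"]) (auto simp: sum.distrib distrib_right intro: is_subringD)
qed

lemma combos_mult: "is_subring R \<Longrightarrow> a \<in> combos R F k \<Longrightarrow> r \<in> R \<Longrightarrow> r * a \<in> combos R F k"
  unfolding combos_def
proof safe
  fix c assume "is_subring R" "r \<in> R" "\<forall>i<k. c i \<in> R"
  then show "\<exists>e. r * (\<Sum>i<k. c i * F i) = (\<Sum>i<k. e i * F i) \<and> (\<forall>i<k. e i \<in> R)"
    by (intro exI[of _ "\<lambda>i. r * c i"]) (auto simp: sum_distrib_left mult_ac intro: is_subringD)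
qed

lemma combos_sum: "is_subring R \<Longrightarrow> (\<And>i. i \<in> A \<Longrightarrow> g i \<in> combos R F k) \<Longrightarrow> sum g A \<in> combos R F k"
  by (induction A rule: infinite_finite_induct) (auto intro: combos_0 combos_add)

lemma combos_mem:
  assumes "is_subring R" "i < k"
  shows "F i \<in> combos R F k"
proof -
  have "F i = (\<Sum>j<k. (if j = i then 1 else 0) * F j)"
    using assms(2) by (simp add: if_distrib[of "\<lambda>x. x * _"] sum.delta cong: if_cong)
  moreover have "\<forall>j<k. (if j = i then 1 else 0) \<in> R" using is_subringD(1,2)[OF assms(1)] by simp
  ultimately show ?thesis unfolding combos_def
    by (intro CollectI exI[of _ "\<lambda>j. if j = i then 1 else 0"] conjI)
qed

lemma combos_subset:
  assumes R: "is_subring R" and "\<And>i. i < k \<Longrightarrow> G i \<in> combos R F l"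
  shows "combos R G k \<subseteq> combos R F l"
  using assms(2) unfolding combos_def[of R G] by (auto intro!: combos_sum[OF R] combos_mult[OF R])

lemma combos_mono: "is_subring R \<Longrightarrow> k \<le> l \<Longrightarrow> combos R F k \<subseteq> combos R F l"
  by (intro combos_subset combos_mem) auto

lemma combos_cong: "(\<And>i. i < k \<Longrightarrow> F i = G i) \<Longrightarrow> combos R F k = combos R G k"
  unfolding combos_def by (intro Collect_cong ex_cong1 conj_cong refl arg_cong2[where f = "(=)"] sum.cong) auto

definition coeffs_in :: "'a::comm_ring_1 set \<Rightarrow> 'a poly set" where
  "coeffs_in R = {p. \<forall>k. coeff p k \<in> R}"

lemma is_subring_coeffs_in: "is_subring R \<Longrightarrow> is_subring (coeffs_in R)"
  unfolding coeffs_in_def is_subring_def[of "{p. \<forall>k. coeff p k \<in> R}"]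
  by (auto simp: coeff_mult coeff_1 is_subringD intro!: is_subring_sum)

lemma monom_in_coeffs_in: "is_subring R \<Longrightarrow> c \<in> R \<Longrightarrow> monom c k \<in> coeffs_in R"
  by (auto simp: coeffs_in_def intro: is_subringD)

theorem hilbert_basis:
  assumes "noetherian_subring R"
  shows "noetherian_subring (coeffs_in R)"
proof -
  have R: "is_subring R" and noeth: "\<And>F. range F \<subseteq> R \<Longrightarrow> \<exists>k. F k \<in> combos R F k"
    using assms unfolding noetherian_subring_def by auto
  let ?P = "coeffs_in R"
  note P = is_subring_coeffs_in[OF R]
  have "\<exists>k. F k \<in> combos ?P F k" if F: "range F \<subseteq> ?P" for F
  proof (rule ccontr)
    assume neg: "\<not> ?thesis"
    define I where "I = (\<Union>k. combos ?P F k)"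
    have I_bound: "\<exists>l. \<forall>i<k. H i \<in> combos ?P F l" if "\<And>i. i < k \<Longrightarrow> H i \<in> I"
      for H :: "nat \<Rightarrow> 'a poly" and k :: nat
      using that
    proof (induction k)
      case (Suc k)
      then obtain l where l: "\<forall>i<k. H i \<in> combos ?P F l" by auto
      from Suc.prems[of k] obtain l' where l': "H k \<in> combos ?P F l'" by (auto simp: I_def)
      show ?case
        using l l' combos_mono[OF P, of l "max l l'" F] combos_mono[OF P, of l' "max l l'" F]
        by (intro exI[of _ "max l l'"]) (auto simp: less_Suc_eq)
    qed auto
    \<comment> \<open>\<open>I\<close> is the ideal generated by a sequence \<open>F\<close> that
      violates the claim, so no finite choice exhausts it. \<open>H k\<close> is to have least
      degree in \<open>I\<close> outside the ideal of the earlier choices.\<close>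
    define Q where "Q H k r \<longleftrightarrow> r \<in> I - combos ?P H k \<and> (\<forall>h \<in> I - combos ?P H k. degree r \<le> degree h)"
      for H :: "nat \<Rightarrow> 'a poly" and k :: nat and r :: "'a poly"
    have "\<exists>H. \<forall>k. Q H k (H k)"
    proof (rule dependent_wellorder_choice)
      fix k :: nat and H :: "nat \<Rightarrow> 'a poly"
      assume "\<And>j. j < k \<Longrightarrow> Q H j (H j)"
      then have "H i \<in> I" if "i < k" for i using that by (auto simp: Q_def)
      then obtain l where "\<forall>i<k. H i \<in> combos ?P F l" using I_bound by blast
      then have "combos ?P H k \<subseteq> combos ?P F l" by (intro combos_subset P) auto
      moreover have "F l \<notin> combos ?P F l" using neg by blast
      moreover have "F l \<in> I" using combos_mem[OF P, of l "Suc l" F] by (auto simp: I_def)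
      ultimately have "F l \<in> I - combos ?P H k" by blast
      then show "\<exists>r. Q H k r"
        using ex_has_least_nat[of "\<lambda>r. r \<in> I - combos ?P H k" "F l" degree] unfolding Q_def by blast
    next
      fix r and H G :: "nat \<Rightarrow> 'a poly" and k :: nat assume "\<And>j. j < k \<Longrightarrow> H j = G j"
      then have "combos ?P H k = combos ?P G k" by (rule combos_cong)
      then show "Q H k r = Q G k r" by (simp add: Q_def)
    qed
    then obtain H where H: "\<And>k. Q H k (H k)" by blast
    have IP: "I \<subseteq> ?P"
      using F unfolding I_def combos_def by (auto intro!: is_subring_sum[OF P] is_subringD(4)[OF P])
    have HI: "H k \<in> I" "H k \<notin> combos ?P H k" for k using H[of k] by (auto simp: Q_def)
    have "range (\<lambda>k. lead_coeff (H k)) \<subseteq> R" using HI(1) IP by (auto simp: coeffs_in_def)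
    from noeth[OF this] obtain k c where c: "\<And>i. i < k \<Longrightarrow> c i \<in> R"
      and lc: "lead_coeff (H k) = (\<Sum>i<k. c i * lead_coeff (H i))"
      unfolding combos_def by auto
    \<comment> \<open>\<open>H k\<close> was already a candidate at stage \<open>i\<close>, so
      minimality makes the degrees nondecreasing.\<close>
    have deg: "degree (H i) \<le> degree (H k)" if "i < k" for i
    proof -
      have "H k \<notin> combos ?P H i" using combos_mono[OF P, of i k H] HI(2)[of k] that by auto
      then show ?thesis using H[of i] HI(1)[of k] by (auto simp: Q_def)
    qed
    \<comment> \<open>An element of the ideal of the earlier choices with the leading term of
      \<open>H k\<close>; the difference is a candidate of smaller degree.\<close>
    define t where "t = (\<Sum>i<k. monom (c i) (degree (H k) - degree (H i)) * H i)"
    have tI: "t \<in> combos ?P H k"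
      unfolding t_def by (intro combos_sum[OF P] combos_mult[OF P] combos_mem[OF P] monom_in_coeffs_in[OF R] c) auto
    define g where "g = H k - t"
    have "coeff t (degree (H k)) = lead_coeff (H k)"
      unfolding t_def coeff_sum lc using deg by (intro sum.cong) (auto simp: coeff_monom_mult)
    then have g0: "coeff g (degree (H k)) = 0" by (simp add: g_def)
    have "degree t \<le> degree (H k)"
      unfolding t_def
    proof (intro degree_sum_le finite_lessThan)
      fix i assume "i \<in> {..<k}"
      then show "degree (monom (c i) (degree (H k) - degree (H i)) * H i) \<le> degree (H k)"
        using deg[of i] degree_mult_le[of "monom (c i) (degree (H k) - degree (H i))" "H i"]
          degree_monom_le[of "c i" "degree (H k) - degree (H i)"] by simp
    qed
    then have dg: "degree g \<le> degree (H k)" unfolding g_def by (intro degree_diff_le) auto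
    have gn: "g \<notin> combos ?P H k"
      using HI(2)[of k] combos_add[OF P _ tI, of g] by (auto simp: g_def)
    then have "g \<noteq> 0" using combos_0[OF P] by metis
    then have "degree g < degree (H k)"
      using dg g0 by (metis leading_coeff_0_iff le_neq_implies_less)
    moreover have "g \<in> I"
    proof -
      obtain l where l: "\<forall>i<Suc k. H i \<in> combos ?P F l" using I_bound[of "Suc k" H] HI(1) by blast
      then have "t \<in> combos ?P F l" using tI combos_subset[OF P, of k H F l] by auto
      then have "(-1) * t \<in> combos ?P F l" by (rule combos_mult[OF P]) (auto intro: is_subringD[OF P])
      then have "H k + (-1) * t \<in> combos ?P F l" using l by (intro combos_add[OF P]) auto
      then show ?thesis by (auto simp: I_def g_def)
    qed
    ultimately show False using H[of k] gn unfolding Q_def by (meson DiffI leD)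
  qed
  then show ?thesis using P by (simp add: noetherian_subring_def)
qed

section \<open>Finitely generated algebras over a field are noetherian\<close>

definition adjoin :: "'a::comm_ring_1 \<Rightarrow> 'a set \<Rightarrow> 'a set" where
  "adjoin a R = (\<lambda>p. poly p a) ` coeffs_in R"

text \<open>Evaluation at \<open>a\<close> maps \<open>coeffs_in R\<close> onto
  \<open>adjoin a R\<close>: a sequence is lifted there, and the relation found is
  evaluated.\<close>

lemma noetherian_adjoin:
  assumes "noetherian_subring R"
  shows "noetherian_subring (adjoin a R)"
proof -
  let ?P = "coeffs_in R"
  have P: "noetherian_subring ?P" by (rule hilbert_basis[OF assms])
  have sub: "is_subring ?P" using P by (simp add: noetherian_subring_def)
  have "is_subring (adjoin a R)"
    unfolding is_subring_def
  proof (intro conjI ballI)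
    show "0 \<in> adjoin a R" "1 \<in> adjoin a R"
      unfolding adjoin_def using is_subringD[OF sub] by (auto intro: image_eqI[of _ _ 0] image_eqI[of _ _ 1])
    fix x assume x: "x \<in> adjoin a R"
    then obtain p where p: "p \<in> ?P" "x = poly p a" unfolding adjoin_def by blast
    then show "- x \<in> adjoin a R" unfolding adjoin_def using is_subringD[OF sub]
      by (intro image_eqI[of _ _ "- p"]) auto
    fix y assume "y \<in> adjoin a R"
    then obtain q where q: "q \<in> ?P" "y = poly q a" unfolding adjoin_def by blast
    show "x + y \<in> adjoin a R" unfolding adjoin_def using p q is_subringD[OF sub]
      by (intro image_eqI[of _ _ "p + q"]) auto
    show "x * y \<in> adjoin a R" unfolding adjoin_def using p q is_subringD[OF sub]
      by (intro image_eqI[of _ _ "p * q"]) auto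
  qed
  moreover have "\<exists>k. F k \<in> combos (adjoin a R) F k" if F: "range F \<subseteq> adjoin a R" for F
  proof -
    have "\<forall>i. \<exists>p. p \<in> ?P \<and> F i = poly p a" using F unfolding adjoin_def by blast
    then obtain p where p: "\<And>i. p i \<in> ?P" "\<And>i. F i = poly (p i) a" by metis
    then obtain k c where c: "\<And>i. i < k \<Longrightarrow> c i \<in> ?P" "p k = (\<Sum>i<k. c i * p i)"
      using P unfolding noetherian_subring_def combos_def by blast
    have "F k = (\<Sum>i<k. poly (c i) a * F i)" by (simp add: p(2) c(2) poly_sum)
    then show ?thesis unfolding combos_def adjoin_def using c(1)
      by (intro exI[of _ k] CollectI exI[of _ "\<lambda>i. poly (c i) a"]) auto
  qed
  ultimately show ?thesis by (simp add: noetherian_subring_def)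
qed

lemma adjoin_superset:
  assumes "is_subring R"
  shows "R \<subseteq> adjoin a R" "a \<in> adjoin a R"
proof -
  have "poly (monom c 0) a \<in> adjoin a R" if "c \<in> R" for c
    unfolding adjoin_def by (intro imageI monom_in_coeffs_in assms that)
  then show "R \<subseteq> adjoin a R" by (auto simp: poly_monom)
  have "poly (monom 1 1) a \<in> adjoin a R"
    unfolding adjoin_def by (intro imageI monom_in_coeffs_in assms is_subringD)
  then show "a \<in> adjoin a R" by (simp add: poly_monom)
qed

lemma adjoin_subset:
  assumes "is_subring B" "R \<subseteq> B" "a \<in> B"
  shows "adjoin a R \<subseteq> B"
  unfolding adjoin_def coeffs_in_def poly_altdef
  using assms by (auto intro!: is_subring_sum is_subringD(4)[OF assms(1)] is_subring_power)

lemma noetherian_adjoin_list: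
  assumes "noetherian_subring R"
  shows "noetherian_subring (foldr adjoin xs R) \<and> R \<subseteq> foldr adjoin xs R \<and> set xs \<subseteq> foldr adjoin xs R"
proof (induction xs)
  case (Cons x xs)
  then have "noetherian_subring (foldr adjoin xs R)" by blast
  then show ?case
    using Cons noetherian_adjoin[of "foldr adjoin xs R" x] adjoin_superset[of "foldr adjoin xs R" x]
    by (auto simp: noetherian_subring_def)
qed (use assms in auto)

lemma adjoin_list_subset:
  assumes "is_subring B" "R \<subseteq> B" "set xs \<subseteq> B"
  shows "foldr adjoin xs R \<subseteq> B"
  using assms(3) by (induction xs) (use assms adjoin_subset[OF assms(1)] in auto)

text \<open>The base field sits inside polynomials in T over the coordinate ring, where the Rees
  ring is then built by adjunction. Two terms of a sequence decide: the second is a multiple of the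
  first unless the first is 0, the empty combination.\<close>

lemma noetherian_field:
  "noetherian_subring (range (\<lambda>c::'k::field. [:mconst c:] :: ('v, 'k) mpoly poly))"
proof -
  let ?h = "\<lambda>c::'k. [:mconst c:] :: ('v, 'k) mpoly poly"
  have "is_subring (range ?h)"
    unfolding is_subring_def
  proof (intro conjI ballI)
    show "0 \<in> range ?h" by (rule range_eqI[of _ _ 0]) simp
    show "1 \<in> range ?h" by (rule range_eqI[of _ _ 1]) (simp add: one_pCons)
    fix x assume "x \<in> range ?h" then obtain c where x: "x = ?h c" by blast
    show "- x \<in> range ?h" by (rule range_eqI[of _ _ "- c"]) (simp add: x mconst_uminus)
    fix y assume "y \<in> range ?h" then obtain d where y: "y = ?h d" by blast
    show "x + y \<in> range ?h" by (rule range_eqI[of _ _ "c + d"]) (simp add: x y mconst_add)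
    show "x * y \<in> range ?h" by (rule range_eqI[of _ _ "c * d"]) (simp add: x y mconst_mult)
  qed
  moreover have "\<exists>k. F k \<in> combos (range ?h) F k" if F: "range F \<subseteq> range ?h" for F
  proof -
    obtain c0 c1 where c: "F 0 = ?h c0" "F 1 = ?h c1" using F by (meson range_subsetD rangeE)
    show ?thesis
    proof (cases "c0 = 0")
      case True
      then show ?thesis by (intro exI[of _ 0]) (simp add: c combos_def)
    next
      case False
      have "F 1 = (\<Sum>i<1. ?h (c1 / c0) * F i)" unfolding c(2) using False by (simp add: c(1) flip: mconst_mult)
      then show ?thesis unfolding combos_def by (intro exI[of _ 1] CollectI exI[of _ "\<lambda>_. ?h (c1 / c0)"]) auto
    qed
  qed
  ultimately show ?thesis by (simp add: noetherian_subring_def)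
qed

lemma is_subring_coord_ring: "is_subring (carrier (coord_ring n))"
  unfolding is_subring_def by (simp add: carrier_coord_ring mvars_uminus mvars_add mvars_mult)

text \<open>Powers of the maximal ideal of the point \<open>z\<close> of affine space.\<close>

primrec mpow :: "nat \<Rightarrow> (nat \<Rightarrow> 'k::comm_ring_1) \<Rightarrow> nat \<Rightarrow> (nat, 'k) mpoly set" where
  "mpow n z 0 = carrier (coord_ring n)"
| "mpow n z (Suc s) = {\<Sum>i\<le>n. (mvar i - mconst (z i)) * a i | a. \<forall>i\<le>n. a i \<in> mpow n z s}"

lemma local_coord_in_coord_ring: "i \<le> n \<Longrightarrow> mvar i - mconst c \<in> carrier (coord_ring n)"
  by (intro is_subringD(6)[OF is_subring_coord_ring])
     (use mvars_mvar[of i] in \<open>auto simp: carrier_coord_ring\<close>)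

lemma mpow_0: "0 \<in> mpow n z s"
proof (induction s)
  case (Suc s)
  then show ?case by (auto intro!: exI[of _ "\<lambda>_. 0"])
qed (simp add: carrier_coord_ring)

lemma mpow_add: "a \<in> mpow n z s \<Longrightarrow> b \<in> mpow n z s \<Longrightarrow> a + b \<in> mpow n z s"
proof (induction s arbitrary: a b)
  case (Suc s)
  from Suc.prems obtain f g where f: "\<forall>i\<le>n. f i \<in> mpow n z s" "a = (\<Sum>i\<le>n. (mvar i - mconst (z i)) * f i)"
    and g: "\<forall>i\<le>n. g i \<in> mpow n z s" "b = (\<Sum>i\<le>n. (mvar i - mconst (z i)) * g i)" by auto
  have "a + b = (\<Sum>i\<le>n. (mvar i - mconst (z i)) * (f i + g i))"
    by (simp add: f g distrib_left sum.distrib)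
  then show ?case using f g Suc.IH by auto
qed (simp add: carrier_coord_ring mvars_add)

lemma mpow_mult:
  "a \<in> mpow n z s \<Longrightarrow> r \<in> carrier (coord_ring n) \<Longrightarrow> r * a \<in> mpow n z s"
proof (induction s arbitrary: a)
  case 0
  then show ?case by (auto intro: is_subringD(4)[OF is_subring_coord_ring])
next
  case (Suc s)
  from Suc.prems obtain f where f: "\<forall>i\<le>n. f i \<in> mpow n z s" "a = (\<Sum>i\<le>n. (mvar i - mconst (z i)) * f i)" by auto
  have "r * a = (\<Sum>i\<le>n. (mvar i - mconst (z i)) * (r * f i))"
    by (simp add: f sum_distrib_left mult_ac)
  then show ?case using f Suc by auto
qed

lemma mpow_sum: "(\<And>i. i \<in> A \<Longrightarrow> g i \<in> mpow n z s) \<Longrightarrow> sum g A \<in> mpow n z s"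
  by (induction A rule: infinite_finite_induct) (auto intro: mpow_0 mpow_add)

lemma mpow_Suc_subset: "mpow n z (Suc s) \<subseteq> mpow n z s"
proof (induction s)
  case 0
  show ?case by (auto intro!: is_subring_sum[OF is_subring_coord_ring]
        is_subringD(4)[OF is_subring_coord_ring] local_coord_in_coord_ring)
next
  case (Suc s)
  then show ?case unfolding mpow.simps(2)[of _ _ "Suc s"] mpow.simps(2)[of n z s] by blast
qed

lemma mpow_antimono: "s \<le> t \<Longrightarrow> mpow n z t \<subseteq> mpow n z s"
  by (rule lift_Suc_antimono_le[of "mpow n z"]) (rule mpow_Suc_subset)

lemma mpow_carrier: "mpow n z s \<subseteq> carrier (coord_ring n)"
  using mpow_antimono[of 0 s n z] by simp

lemma mpow_mpow: "a \<in> mpow n z s \<Longrightarrow> b \<in> mpow n z t \<Longrightarrow> a * b \<in> mpow n z (s + t)"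
proof (induction s arbitrary: a)
  case 0
  then show ?case using mpow_mult by auto
next
  case (Suc s)
  from Suc.prems obtain f where f: "\<forall>i\<le>n. f i \<in> mpow n z s" "a = (\<Sum>i\<le>n. (mvar i - mconst (z i)) * f i)" by auto
  have "a * b = (\<Sum>i\<le>n. (mvar i - mconst (z i)) * (f i * b))"
    by (simp add: f sum_distrib_left sum_distrib_right mult_ac)
  then show ?case using f Suc by auto
qed

lemma local_coord_mult_mpow:
  assumes "i \<le> n" "a \<in> mpow n z s"
  shows "(mvar i - mconst (z i)) * a \<in> mpow n z (Suc s)"
proof -
  have "(mvar i - mconst (z i)) * a = (\<Sum>j\<le>n. (mvar j - mconst (z j)) * (if j = i then a else 0))"
    using assms(1) by (simp add: if_distrib sum.delta cong: if_cong)
  then show ?thesis unfolding mpow.simps using assms(2)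
    by (intro CollectI exI[of _ "\<lambda>j. if j = i then a else 0"]) (auto simp: mpow_0)
qed

lemma local_coord_in_mpow: "i \<le> n \<Longrightarrow> mvar i - mconst (z i) \<in> mpow n z 1"
  using local_coord_mult_mpow[of i n 1 z 0] by (simp add: carrier_coord_ring)

lemma meval_mpow_Suc: "a \<in> mpow n z (Suc s) \<Longrightarrow> meval a z = 0"
  by (auto simp: meval_hom)

text \<open>Noetherianity is applied to the Rees ring \<open>\<Oplus>\<^sub>s m\<^sup>s T\<^sup>s\<close>: writing \<open>p\<close> modulo \<open>J\<close> as \<open>q\<^sub>s \<in> m\<^sup>s\<close> for
  every \<open>s\<close>, some \<open>q\<^sub>k T\<^sup>k\<close> is a combination of the previous ones.\<close>

theorem krull_intersection:
  fixes J :: "(nat, 'k::field) mpoly set"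
  assumes J0: "0 \<in> J" and Jadd: "\<And>a b. a \<in> J \<Longrightarrow> b \<in> J \<Longrightarrow> a + b \<in> J"
    and Jmult: "\<And>a r. a \<in> J \<Longrightarrow> r \<in> carrier (coord_ring n) \<Longrightarrow> r * a \<in> J"
    and approx: "\<And>s. \<exists>q \<in> mpow n z s. p - q \<in> J"
  shows "\<exists>u \<in> mpow n z 1. (1 - u) * p \<in> J"
proof -
  let ?K = "range (\<lambda>c::'k. [:mconst c:] :: (nat, 'k) mpoly poly)"
  \<comment> \<open>Generators of the Rees ring over the constants: the variables in degree 0, and
    the local coordinates times T in degree 1.\<close>
  define xs where "xs = map (\<lambda>i. [:mvar i:]) [0..<Suc n] @ map (\<lambda>i. [:0, mvar i - mconst (z i):]) [0..<Suc n]"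
  define R where "R = foldr adjoin xs ?K"
  have noeth: "noetherian_subring R" and KR: "?K \<subseteq> R" and xR: "set xs \<subseteq> R"
    using noetherian_adjoin_list[OF noetherian_field, of xs] unfolding R_def by blast+
  have gens: "[:mvar i:] \<in> R" "[:0, mvar i - mconst (z i):] \<in> R" if "i \<le> n" for i
  proof -
    have "i \<in> set [0..<Suc n]" using that by (simp only: set_upt) simp
    then show "[:mvar i:] \<in> R" "[:0, mvar i - mconst (z i):] \<in> R"
      using xR unfolding xs_def set_append set_map by blast+
  qed
  have Rsub: "is_subring R" using noeth by (simp add: noetherian_subring_def)
  \<comment> \<open>Polynomials whose coefficient at T^s lies in m^s. They contain \<open>R\<close>,
    so coefficients of a relation over \<open>R\<close> have controlled order at
    \<open>z\<close>.\<close>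
  define B where "B = {p :: (nat, 'k) mpoly poly. \<forall>s. coeff p s \<in> mpow n z s}"
  have B: "is_subring B"
    unfolding is_subring_def B_def
  proof (intro conjI ballI CollectI allI)
    fix s show "coeff 0 s \<in> mpow n z s" by (simp add: mpow_0)
    show "coeff 1 s \<in> mpow n z s"
      by (cases s) (auto simp: coeff_1 carrier_coord_ring mpow_0 simp del: mpow.simps(2))
  next
    fix a s assume "a \<in> {p. \<forall>s. coeff p s \<in> mpow n z s}"
    then have a: "coeff a s \<in> mpow n z s" for s by auto
    show "coeff (- a) s \<in> mpow n z s"
      using mpow_mult[OF a[of s], of "mconst (-1)"] unfolding carrier_coord_ring by (simp add: mconst_uminus mvars_uminus)
    fix b assume "b \<in> {p. \<forall>s. coeff p s \<in> mpow n z s}"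
    then have b: "coeff b s \<in> mpow n z s" for s by auto
    show "coeff (a + b) s \<in> mpow n z s" using a b by (simp add: mpow_add)
    have "coeff a i * coeff b (s - i) \<in> mpow n z s" if "i \<le> s" for i
      using mpow_mpow[OF a[of i] b[of "s - i"]] that by simp
    then show "coeff (a * b) s \<in> mpow n z s" unfolding coeff_mult by (intro mpow_sum) auto
  qed
  have "R \<subseteq> B"
    unfolding R_def
  proof (intro adjoin_list_subset[OF B])
    have c: "[:c:] \<in> B" if "c \<in> carrier (coord_ring n)" for c
      using that by (auto simp: B_def coeff_pCons mpow_0 split: nat.split simp del: mpow.simps(2))
    then show "?K \<subseteq> B" by (auto simp: carrier_coord_ring)
    have "[:0, mvar i - mconst (z i):] \<in> B" if "i \<le> n" for i
      using local_coord_in_mpow[OF that, of z]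
      by (auto simp: B_def coeff_pCons mpow_0 carrier_coord_ring split: nat.split simp del: mpow.simps(2))
    moreover have "mvar i \<in> carrier (coord_ring n)" if "i \<le> n" for i
      using mvars_mvar[of i] that by (auto simp: carrier_coord_ring)
    ultimately show "set xs \<subseteq> B" using c by (auto simp: xs_def)
  qed
  have const: "[:q:] \<in> R" if "q \<in> carrier (coord_ring n)" for q
  proof -
    from that have "mvars q \<subseteq> {0..n}" by (simp add: carrier_coord_ring)
    then show ?thesis
    proof (induction q rule: mpoly_induct)
      case (const c)
      then show ?case using KR by blast
    next
      case (var v)
      then show ?case using gens by simp
    next
      case (add p q)
      then show ?case using is_subringD(3)[OF Rsub, of "[:p:]" "[:q:]"] by simp
    next
      case (mult p q)
      then show ?case using is_subringD(4)[OF Rsub, of "[:p:]" "[:q:]"] by (simp add: mult.commute[of p q])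
    qed
  qed
  have monom: "monom q s \<in> R" if "q \<in> mpow n z s" for q s
    using that
  proof (induction s arbitrary: q)
    case 0
    then show ?case using const by (simp add: monom_0)
  next
    case (Suc s)
    then obtain a where a: "\<And>i. i \<le> n \<Longrightarrow> a i \<in> mpow n z s" "q = (\<Sum>i\<le>n. (mvar i - mconst (z i)) * a i)" by auto
    have "monom q (Suc s) = (\<Sum>i\<le>n. [:0, mvar i - mconst (z i):] * monom (a i) s)"
    proof -
      have "[:0, y:] * monom c s = monom (y * c) (Suc s)" for y c :: "(nat, 'k) mpoly"
        by (simp add: smult_monom monom_Suc)
      then show ?thesis by (simp only: a(2) monom_sum)
    qed
    moreover have "(\<Sum>i\<le>n. [:0, mvar i - mconst (z i):] * monom (a i) s) \<in> R"
      by (intro is_subring_sum[OF Rsub] is_subringD(4)[OF Rsub] gens(2) Suc.IH a(1)) auto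
    ultimately show ?case by (simp only:)
  qed
  obtain q where q: "\<And>s. q s \<in> mpow n z s" "\<And>s. p - q s \<in> J" using approx by metis
  have "range (\<lambda>s. monom (q s) s) \<subseteq> R" using monom q(1) by blast
  then obtain k c where c: "\<And>i. i < k \<Longrightarrow> c i \<in> R" and eq: "monom (q k) k = (\<Sum>i<k. c i * monom (q i) i)"
    using noeth unfolding noetherian_subring_def combos_def by blast
  \<comment> \<open>Comparing coefficients of T^k picks the coefficient of \<open>c i\<close> at
    \<open>k - i\<close>, which lies in m because \<open>i < k\<close>.\<close>
  define g where "g i = coeff (c i) (k - i)" for i
  have "q k = coeff (\<Sum>i<k. c i * monom (q i) i) k" by (simp flip: eq)
  also have "\<dots> = (\<Sum>i<k. g i * q i)"
    unfolding coeff_sum g_def by (intro sum.cong) (auto simp: mult.commute[of _ "monom _ _"] coeff_monom_mult)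
  finally have qk: "q k = (\<Sum>i<k. g i * q i)" .
  have g: "g i \<in> mpow n z 1" if "i < k" for i
  proof -
    have "g i \<in> mpow n z (k - i)" using c[OF that] \<open>R \<subseteq> B\<close> unfolding B_def g_def by blast
    moreover have "1 \<le> k - i" using that by simp
    ultimately show ?thesis using mpow_antimono by blast
  qed
  define u where "u = (\<Sum>i<k. g i)"
  have "u \<in> mpow n z 1" unfolding u_def by (intro mpow_sum g) auto
  moreover have "(1 - u) * p \<in> J"
  proof -
    have m1: "mconst (-1) \<in> carrier (coord_ring n)" by (simp add: carrier_coord_ring)
    have Jsum: "(\<And>i. i \<in> A \<Longrightarrow> h i \<in> J) \<Longrightarrow> sum h A \<in> J" for A :: "nat set" and h
      by (induction A rule: infinite_finite_induct) (auto intro: J0 Jadd)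
    \<comment> \<open>As \<open>q k\<close> is the sum of the \<open>g i * q i\<close>, only
      multiples of the differences \<open>p - q i\<close> and \<open>p - q k\<close> remain, all in
      \<open>J\<close>.\<close>
    have "(1 - u) * p = (p - q k) + mconst (-1) * (\<Sum>i<k. g i * (p - q i))"
      by (simp add: qk u_def mconst_uminus algebra_simps sum_subtractf sum_negf sum_distrib_left)
    also have "\<dots> \<in> J"
      using g mpow_carrier[of n z 1] by (intro Jadd Jmult Jsum q m1) (auto simp del: mpow.simps)
    finally show ?thesis .
  qed
  ultimately show ?thesis by blast
qed

declare mpow.simps(2) [simp del]

section \<open>The generic formal arc\<close>

lemma fps_X_power_dvd_iff: "fps_X ^ N dvd (a :: 'a::comm_ring_1 fps) \<longleftrightarrow> (\<forall>k<N. fps_nth a k = 0)"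
proof
  assume "fps_X ^ N dvd a"
  then show "\<forall>k<N. fps_nth a k = 0" by (auto simp: dvd_def fps_X_power_mult_nth)
next
  assume "\<forall>k<N. fps_nth a k = 0"
  then have "a = fps_X ^ N * fps_shift N a"
    by (intro fps_ext) (auto simp: fps_X_power_mult_nth)
  then show "fps_X ^ N dvd a" by (rule dvdI)
qed

lemma fps_X_dvd_iff: "fps_X dvd (a :: 'a::comm_ring_1 fps) \<longleftrightarrow> fps_nth a 0 = 0"
  using fps_X_power_dvd_iff[of 1 a] by simp

abbreviation fconst :: "'k::comm_ring_1 \<Rightarrow> (nat, 'k) mpoly fps" where
  "fconst c \<equiv> fps_const (mconst c)"

definition arc :: "('v \<Rightarrow> (nat, 'k::comm_ring_1) mpoly fps) \<Rightarrow> ('v, 'k) mpoly \<Rightarrow> (nat, 'k) mpoly fps" where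
  "arc \<rho> p = msubst fconst \<rho> p"

lemma coeff_hom_fconst [simp]: "coeff_hom fconst"
  by (simp add: coeff_hom_def mconst_add mconst_mult)

lemmas arc_hom = msubst_hom[of fconst, folded arc_def, simplified]

lemma arc_simps [simp]: "arc \<rho> (mconst c) = fconst c" "arc \<rho> (mvar v) = \<rho> v" "arc \<rho> 0 = 0" "arc \<rho> 1 = 1"
  by (simp_all add: arc_def)

lemma fconst_sum: "fconst (sum g A) = (\<Sum>i\<in>A. fconst (g i))"
  by (induction A rule: infinite_finite_induct) (simp_all add: mconst_add flip: fps_const_add)

lemma arc_0:
  fixes n :: nat
  assumes "mvars p \<subseteq> {0..n}" "\<And>i. i \<le> n \<Longrightarrow> fps_nth (\<rho> i) 0 = mconst (z i)"
  shows "fps_nth (arc \<rho> p) 0 = mconst (meval p z)"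
  using assms(1)
  by (induction p rule: mpoly_induct) (auto simp: arc_hom meval_hom assms(2) mconst_add mconst_mult fps_mult_nth_0)

text \<open>The error is quadratic: a difference divisible by T^N meets a factor vanishing at T = 0,
  which gains one order. This makes the Newton map a contraction.\<close>

lemma arc_taylor:
  fixes n :: nat and p :: "(nat, 'k::comm_ring_1) mpoly"
  assumes p: "mvars p \<subseteq> {0..n}"
    and \<rho>: "\<And>i. i \<le> n \<Longrightarrow> fps_nth (\<rho> i) 0 = mconst (z i)" "\<And>i. i \<le> n \<Longrightarrow> fps_nth (\<rho>' i) 0 = mconst (z i)"
    and N: "\<And>i. i \<le> n \<Longrightarrow> fps_X ^ N dvd \<rho> i - \<rho>' i"
  shows "fps_X ^ Suc N dvd arc \<rho> p - arc \<rho>' p - (\<Sum>i\<le>n. fconst (dat z i p) * (\<rho> i - \<rho>' i))"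
  using p
proof (induction p rule: mpoly_induct)
  case (const c)
  then show ?case by (simp add: dat_mconst)
next
  case (var v)
  have "(\<Sum>i\<le>n. fconst (dat z i (mvar v)) * (\<rho> i - \<rho>' i)) = (\<Sum>i\<le>n. if i = v then \<rho> i - \<rho>' i else 0)"
    by (intro sum.cong) (auto simp: dat_mvar)
  also have "\<dots> = \<rho> v - \<rho>' v" using var by (subst sum.delta) auto
  finally show ?case by simp
next
  case (add p q)
  have "arc \<rho> (p + q) - arc \<rho>' (p + q) - (\<Sum>i\<le>n. fconst (dat z i (p + q)) * (\<rho> i - \<rho>' i)) =
    (arc \<rho> p - arc \<rho>' p - (\<Sum>i\<le>n. fconst (dat z i p) * (\<rho> i - \<rho>' i))) +
    (arc \<rho> q - arc \<rho>' q - (\<Sum>i\<le>n. fconst (dat z i q) * (\<rho> i - \<rho>' i)))"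
    by (simp add: arc_hom dat_add mconst_add distrib_right sum.distrib flip: fps_const_add)
  then show ?case using add by (simp only: dvd_add)
next
  case (mult p q)
  let ?L = "\<lambda>p. \<Sum>i\<le>n. fconst (dat z i p) * (\<rho> i - \<rho>' i)"
  have L: "fps_X ^ N dvd ?L p" for p by (intro dvd_sum dvd_mult N) auto
  have d: "fps_X ^ N dvd arc \<rho> p - arc \<rho>' p"
  proof -
    have "fps_X ^ N dvd arc \<rho> p - arc \<rho>' p - ?L p"
      using mult.IH(1) by (rule dvd_trans[rotated]) (simp add: le_imp_power_dvd)
    from dvd_add[OF this L[of p]] show ?thesis by simp
  qed
  have c0: "fps_X dvd arc \<rho> p - fconst (meval p z)" "fps_X dvd arc \<rho>' q - fconst (meval q z)"
    using arc_0[where \<rho> = \<rho> and z = z, OF mult.hyps(1) \<rho>(1)]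
      arc_0[where \<rho> = \<rho>' and z = z, OF mult.hyps(2) \<rho>(2)]
    by (simp_all add: fps_X_dvd_iff)
  have Lm: "?L (p * q) = fconst (meval p z) * ?L q + fconst (meval q z) * ?L p"
  proof -
    have "fconst (a * b + c * d) * x = fconst c * (fconst d * x) + fconst b * (fconst a * x)" for a b c d :: 'k and x
      by (simp add: mconst_add mconst_mult distrib_right distrib_left add_ac mult_ac flip: fps_const_add fps_const_mult)
    then show ?thesis by (simp only: dat_mult sum_distrib_left sum.distrib)
  qed
  have "arc \<rho> (p * q) - arc \<rho>' (p * q) - ?L (p * q) =
      arc \<rho> p * (arc \<rho> q - arc \<rho>' q - ?L q) + (arc \<rho> p - fconst (meval p z)) * ?L q
    + (arc \<rho> p - arc \<rho>' p) * (arc \<rho>' q - fconst (meval q z)) + (arc \<rho> p - arc \<rho>' p - ?L p) * fconst (meval q z)"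
    unfolding Lm arc_hom by (simp add: algebra_simps)
  moreover have "fps_X ^ Suc N dvd (arc \<rho> p - fconst (meval p z)) * ?L q"
    using mult_dvd_mono[OF c0(1) L[of q]] by simp
  moreover have "fps_X ^ Suc N dvd (arc \<rho> p - arc \<rho>' p) * (arc \<rho>' q - fconst (meval q z))"
    using mult_dvd_mono[OF d c0(2)] by (simp add: mult.commute)
  ultimately show ?case using mult.IH by (simp only: dvd_add dvd_mult dvd_mult2)
qed

text \<open>Newton iteration. The tangent directions \<open>\<tau>\<^sub>i\<close> of the arc are indeterminates (encoded by
  \<open>mvar i\<close> in the coefficients of the power series), which makes the arc generic.\<close>

theorem generic_arc_exists:
  fixes g :: "'j \<Rightarrow> (nat, 'k::comm_ring_1) mpoly"
  assumes C: "finite C"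
    and g: "\<And>j. j \<in> C \<Longrightarrow> mvars (g j) \<subseteq> {0..n}" "\<And>j. j \<in> C \<Longrightarrow> meval (g j) z = 0"
    and dual: "\<And>j j'. j \<in> C \<Longrightarrow> j' \<in> C \<Longrightarrow> (\<Sum>i\<le>n. dat z i (g j) * \<gamma> j' i) = of_bool (j = j')"
  shows "\<exists>\<rho>. (\<forall>j\<in>C. arc \<rho> (g j) = 0) \<and> (\<forall>i\<le>n. fps_nth (\<rho> i) 0 = mconst (z i) \<and>
    fps_nth (\<rho> i) 1 = mvar i - (\<Sum>j\<in>C. mconst (\<gamma> j i) * (\<Sum>k\<le>n. mconst (dat z k (g j)) * mvar k)))"
proof -
  \<comment> \<open>The straight line through \<open>z\<close> with indeterminate velocity,
    corrected along the dual vectors by unknown series \<open>w j\<close>.\<close>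
  define R where "R w i = fconst (z i) + fps_const (mvar i) * fps_X + (\<Sum>j\<in>C. fconst (\<gamma> j i) * w j)"
    for w :: "'j \<Rightarrow> (nat, 'k) mpoly fps" and i
  \<comment> \<open>Fixed points solve all equations. By duality the linear part of
    \<open>g j\<close> along the correction is \<open>w j\<close> itself, so it cancels in \<Psi>
    and only higher-order dependence on \<open>w\<close> is left.\<close>
  define \<Psi> where "\<Psi> w j = w j - arc (R w) (g j)" for w :: "'j \<Rightarrow> (nat, 'k) mpoly fps" and j
  define good where "good w \<longleftrightarrow> (\<forall>j\<in>C. fps_nth (w j) 0 = 0)" for w :: "'j \<Rightarrow> (nat, 'k) mpoly fps"
  have R0: "fps_nth (R w i) 0 = mconst (z i)" if "good w" for w i
    using that by (simp add: R_def good_def fps_sum_nth fps_mult_nth_0)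
  have lin: "(\<Sum>i\<le>n. fconst (dat z i (g j)) * (\<Sum>j'\<in>C. fconst (\<gamma> j' i) * v j')) = v j" if j: "j \<in> C" for v j
  proof -
    have "(\<Sum>i\<le>n. fconst (dat z i (g j)) * (\<Sum>j'\<in>C. fconst (\<gamma> j' i) * v j')) =
        (\<Sum>i\<le>n. \<Sum>j'\<in>C. fconst (dat z i (g j) * \<gamma> j' i) * v j')"
      by (simp add: sum_distrib_left mconst_mult mult.assoc flip: fps_const_mult)
    also have "\<dots> = (\<Sum>j'\<in>C. fconst (\<Sum>i\<le>n. dat z i (g j) * \<gamma> j' i) * v j')"
      by (subst sum.swap) (simp add: fconst_sum sum_distrib_right)
    also have "\<dots> = (\<Sum>j'\<in>C. if j' = j then v j' else 0)"
      using dual[OF j] by (intro sum.cong) auto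
    finally show ?thesis using j C by simp
  qed
  have contr: "fps_X ^ Suc N dvd \<Psi> w j - \<Psi> w' j"
    if w: "good w" "good w'" and N: "\<And>j. j \<in> C \<Longrightarrow> fps_X ^ N dvd w j - w' j" and j: "j \<in> C" for w w' N j
  proof -
    have Rd: "R w i - R w' i = (\<Sum>j'\<in>C. fconst (\<gamma> j' i) * (w j' - w' j'))" for i
      by (simp add: R_def algebra_simps sum_subtractf)
    have "fps_X ^ N dvd R w i - R w' i" for i unfolding Rd by (intro dvd_sum dvd_mult N)
    then have "fps_X ^ Suc N dvd arc (R w) (g j) - arc (R w') (g j) - (\<Sum>i\<le>n. fconst (dat z i (g j)) * (R w i - R w' i))"
      by (intro arc_taylor g(1) j R0 w)
    then have "fps_X ^ Suc N dvd arc (R w) (g j) - arc (R w') (g j) - (w j - w' j)"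
      unfolding Rd lin[OF j] .
    moreover have "\<Psi> w j - \<Psi> w' j = - (arc (R w) (g j) - arc (R w') (g j) - (w j - w' j))"
      by (simp add: \<Psi>_def)
    ultimately show ?thesis by (simp only: dvd_minus_iff)
  qed
  define W where "W k = (\<Psi> ^^ k) (\<lambda>_. 0)" for k
  have W_Suc: "W (Suc k) = \<Psi> (W k)" for k by (simp add: W_def)
  have good\<Psi>: "good (\<Psi> w)" if "good w" for w
    using that arc_0[where \<rho> = "R w" and z = z, OF g(1) R0[OF that]] g(2) by (auto simp: good_def \<Psi>_def)
  have goodW: "good (W k)" for k
    by (induction k) (auto simp: W_Suc good\<Psi>, simp add: good_def W_def)
  have step: "fps_X ^ Suc k dvd W (Suc k) j - W k j" if "j \<in> C" for k j
    using that
  proof (induction k arbitrary: j)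
    case 0
    then show ?case using goodW[of 0] goodW[of 1] unfolding fps_X_power_dvd_iff by (simp add: good_def)
  next
    case (Suc k)
    show ?case
      unfolding W_Suc[of "Suc k"] W_Suc[of k]
      by (subst W_Suc[of k, symmetric], rule contr) (use Suc goodW in auto)
  qed
  have stable: "fps_nth (W (k + m) j) i = fps_nth (W k j) i" if "j \<in> C" "i \<le> k" for k m i j
  proof (induction m)
    case (Suc m)
    have "fps_nth (W (Suc (k + m)) j - W (k + m) j) i = 0"
      using step[OF that(1), of "k + m"] that(2) unfolding fps_X_power_dvd_iff by simp
    then show ?case using Suc by simp
  qed simp
  \<comment> \<open>Coefficient k is constant from the iterate \<open>W k\<close> on, so the
    diagonal is the limit.\<close>
  define w where "w j = Abs_fps (\<lambda>k. fps_nth (W k j) k)" for j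
  have wW: "fps_X ^ Suc k dvd w j - W k j" if "j \<in> C" for k j
    unfolding fps_X_power_dvd_iff
  proof (intro allI impI)
    fix i assume "i < Suc k"
    then show "fps_nth (w j - W k j) i = 0" using stable[OF that, of i i "k - i"] by (simp add: w_def)
  qed
  have good: "good w" using goodW[of 0] by (simp add: good_def w_def)
  have zero: "arc (R w) (g j) = 0" if j: "j \<in> C" for j
  proof -
    have "fps_X ^ Suc (Suc k) dvd \<Psi> w j - w j" for k
    proof -
      have "fps_X ^ Suc (Suc k) dvd \<Psi> w j - \<Psi> (W k) j" by (rule contr[OF good goodW wW j])
      moreover have "fps_X ^ Suc (Suc k) dvd w j - W (Suc k) j" by (rule wW[OF j])
      ultimately have "fps_X ^ Suc (Suc k) dvd (\<Psi> w j - \<Psi> (W k) j) - (w j - W (Suc k) j)" by (rule dvd_diff)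
      then show ?thesis by (simp add: W_Suc)
    qed
    then have "fps_nth (\<Psi> w j - w j) k = 0" for k
      using fps_X_power_dvd_iff[of "Suc (Suc k)"] by (meson less_Suc_eq)
    then show ?thesis by (intro fps_ext) (simp add: \<Psi>_def)
  qed
  have w1: "fps_nth (w j) 1 = - (\<Sum>k\<le>n. mconst (dat z k (g j)) * mvar k)" if j: "j \<in> C" for j
  proof -
    \<comment> \<open>Comparison with the constant arc at \<open>z\<close> isolates the first-order
      coefficient.\<close>
    define \<rho>0 where "\<rho>0 = (\<lambda>i. fconst (z i))"
    have z0: "arc \<rho>0 p = fconst (meval p z)" if "mvars p \<subseteq> {0..n}" for p
      using that by (induction p rule: mpoly_induct)
        (auto simp: arc_hom meval_hom \<rho>0_def mconst_add mconst_mult)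
    have "fps_X ^ 1 dvd R w i - \<rho>0 i" for i
      unfolding fps_X_power_dvd_iff using R0[OF good] by (simp add: \<rho>0_def)
    then have "fps_X ^ Suc 1 dvd arc (R w) (g j) - arc \<rho>0 (g j) - (\<Sum>i\<le>n. fconst (dat z i (g j)) * (R w i - \<rho>0 i))"
      by (intro arc_taylor g(1) j R0 good) (auto simp: \<rho>0_def)
    then have "fps_nth (\<Sum>i\<le>n. fconst (dat z i (g j)) * (R w i - \<rho>0 i)) 1 = 0"
      using zero[OF j] z0[OF g(1)[OF j]] g(2)[OF j] unfolding fps_X_power_dvd_iff by auto
    moreover have "(\<Sum>i\<le>n. fconst (dat z i (g j)) * (R w i - \<rho>0 i)) =
        (\<Sum>i\<le>n. fconst (dat z i (g j)) * (fps_const (mvar i) * fps_X)) + w j"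
      unfolding lin[OF j, of w, symmetric]
      by (simp add: R_def \<rho>0_def distrib_left sum.distrib)
    ultimately show ?thesis
      by (simp add: fps_sum_nth eq_neg_iff_add_eq_0 add.commute)
  qed
  have "fps_nth (R w i) 1 = mvar i - (\<Sum>j\<in>C. mconst (\<gamma> j i) * (\<Sum>k\<le>n. mconst (dat z k (g j)) * mvar k))" for i
    using w1 by (simp add: R_def fps_sum_nth sum_negf)
  then show ?thesis using zero R0[OF good] by (intro exI[of _ "R w"]) auto
qed

lemma taylor_mpow:
  assumes "mvars p \<subseteq> {0..n}"
  shows "p - mconst (meval p z) - (\<Sum>i\<le>n. mconst (dat z i p) * (mvar i - mconst (z i))) \<in> mpow n z 2"
  using assms
proof (induction p rule: mpoly_induct)
  case (const c)
  then show ?case by (simp add: dat_mconst meval_hom mpow_0)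
next
  case (var v)
  have "(\<Sum>i\<le>n. mconst (dat z i (mvar v)) * (mvar i - mconst (z i))) =
      (\<Sum>i\<le>n. if i = v then mvar i - mconst (z i) else 0)"
    by (intro sum.cong) (auto simp: dat_mvar)
  then have "(\<Sum>i\<le>n. mconst (dat z i (mvar v)) * (mvar i - mconst (z i))) = mvar v - mconst (z v)"
    using var by (simp add: sum.delta)
  then show ?case by (simp add: meval_hom mpow_0)
next
  case (add p q)
  have "(p + q) - mconst (meval (p + q) z) - (\<Sum>i\<le>n. mconst (dat z i (p + q)) * (mvar i - mconst (z i))) =
    (p - mconst (meval p z) - (\<Sum>i\<le>n. mconst (dat z i p) * (mvar i - mconst (z i)))) +
    (q - mconst (meval q z) - (\<Sum>i\<le>n. mconst (dat z i q) * (mvar i - mconst (z i))))"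
    by (simp add: meval_hom dat_add mconst_add distrib_right sum.distrib)
  then show ?case using add by (simp only: mpow_add)
next
  case (mult p q)
  let ?L = "\<lambda>p. \<Sum>i\<le>n. mconst (dat z i p) * (mvar i - mconst (z i))"
  have c: "mconst a \<in> carrier (coord_ring n)" for a :: 'a by (simp add: carrier_coord_ring)
  have L1: "?L p \<in> mpow n z 1" for p by (intro mpow_sum mpow_mult local_coord_in_mpow c) auto
  have d: "p - mconst (meval p z) \<in> mpow n z 1" if "p - mconst (meval p z) - ?L p \<in> mpow n z 2" for p
  proof -
    have "p - mconst (meval p z) - ?L p \<in> mpow n z 1" using that mpow_antimono[of 1 2 n z] by auto
    from mpow_add[OF this L1[of p]] show ?thesis by simp
  qed
  have Lm: "?L (p * q) = mconst (meval p z) * ?L q + mconst (meval q z) * ?L p"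
  proof -
    have "mconst (a * b + c * d) * x = mconst c * (mconst d * x) + mconst b * (mconst a * x)"
      for a b c d :: 'a and x :: "(nat, 'a) mpoly"
      by (simp add: mconst_add mconst_mult distrib_right distrib_left mult_ac add_ac)
    then show ?thesis by (simp only: dat_mult sum_distrib_left sum.distrib)
  qed
  have "p * q - mconst (meval (p * q) z) - ?L (p * q) =
      (p - mconst (meval p z)) * (q - mconst (meval q z)) + (mconst (meval p z) * (q - mconst (meval q z) - ?L q)
      + mconst (meval q z) * (p - mconst (meval p z) - ?L p))"
    unfolding Lm by (simp add: meval_hom mconst_mult algebra_simps)
  moreover have "(p - mconst (meval p z)) * (q - mconst (meval q z)) \<in> mpow n z 2"
    using mpow_mpow[OF d[OF mult.IH(1)] d[OF mult.IH(2)]] by (simp only: one_add_one)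
  ultimately show ?case using mult.IH by (simp only: mpow_add mpow_mult c)
qed

lemma fps_mult_nth_orders:
  fixes a b :: "'a::comm_ring_1 fps"
  assumes "fps_nth a 0 = 0" "fps_X ^ s dvd b"
  shows "fps_nth (a * b) (Suc s) = fps_nth a 1 * fps_nth b s"
proof -
  have "fps_nth a i * fps_nth b (Suc s - i) = 0" if "i \<in> {0..Suc s} - {1}" for i
    using that assms unfolding fps_X_power_dvd_iff by (cases "i = 0") auto
  then have "(\<Sum>i\<in>{0..Suc s} - {1}. fps_nth a i * fps_nth b (Suc s - i)) = 0" by (intro sum.neutral) blast
  then show ?thesis unfolding fps_mult_nth by (subst sum.remove[of _ 1]) auto
qed

text \<open>A polynomial vanishing on the generic arc lies in \<open>J + m\<^sup>s\<close> for all \<open>s\<close>: the leading form of its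
  restriction to the arc is its own leading form restricted to the tangent space, and linear forms
  vanishing on the tangent space are congruent modulo \<open>J\<close> to elements of \<open>m\<^sup>2\<close>.\<close>

theorem generic_arc_kernel:
  fixes g :: "'j \<Rightarrow> (nat, 'k::field) mpoly"
  assumes C: "finite C"
    and g: "\<And>j. j \<in> C \<Longrightarrow> g j \<in> J" "\<And>j. j \<in> C \<Longrightarrow> meval (g j) z = 0"
    and J: "J \<subseteq> carrier (coord_ring n)" and J0: "0 \<in> J"
    and Jadd: "\<And>a b. a \<in> J \<Longrightarrow> b \<in> J \<Longrightarrow> a + b \<in> J"
    and Jmult: "\<And>a r. a \<in> J \<Longrightarrow> r \<in> carrier (coord_ring n) \<Longrightarrow> r * a \<in> J"
    and \<rho>J: "\<And>a. a \<in> J \<Longrightarrow> arc \<rho> a = 0"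
    and \<rho>0: "\<And>i. i \<le> n \<Longrightarrow> fps_nth (\<rho> i) 0 = mconst (z i)"
    and \<rho>1: "\<And>i. i \<le> n \<Longrightarrow> fps_nth (\<rho> i) 1 =
      mvar i - (\<Sum>j\<in>C. mconst (\<gamma> j i) * (\<Sum>k\<le>n. mconst (dat z k (g j)) * mvar k))"
    and p: "p \<in> carrier (coord_ring n)" "arc \<rho> p = 0"
  shows "\<exists>s \<in> carrier (coord_ring n). meval s z \<noteq> 0 \<and> s * p \<in> J"
proof -
  note S = is_subringD[OF is_subring_coord_ring]
  have cS: "mconst a \<in> carrier (coord_ring n)" for a :: 'k by (simp add: carrier_coord_ring)
  define y where "y i = mvar i - mconst (z i)" for i
  have yS: "y i \<in> carrier (coord_ring n)" if "i \<le> n" for i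
    unfolding y_def by (rule local_coord_in_coord_ring[OF that])
  \<comment> \<open>J + m^s. Membership of \<open>p\<close> for every \<open>s\<close> is the
    hypothesis of Krull's theorem.\<close>
  define JM where "JM s = {j + q | j q. j \<in> J \<and> q \<in> mpow n z s}" for s
  have JM_J: "j \<in> JM s" if "j \<in> J" for j s using that mpow_0[of n z s] by (force simp: JM_def)
  have JM_M: "q \<in> JM s" if "q \<in> mpow n z s" for q s using that J0 by (force simp: JM_def)
  have JM_add: "a + b \<in> JM s" if "a \<in> JM s" "b \<in> JM s" for a b s
  proof -
    from that obtain j q j' q' where *: "j \<in> J" "j' \<in> J" "q \<in> mpow n z s" "q' \<in> mpow n z s" "a = j + q" "b = j' + q'"
      unfolding JM_def by blast
    have "a + b = (j + j') + (q + q')" using * by simp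
    then show ?thesis unfolding JM_def using * Jadd mpow_add by blast
  qed
  have JM_mult: "r * a \<in> JM s" if "a \<in> JM s" "r \<in> carrier (coord_ring n)" for a r s
  proof -
    from that obtain j q where *: "j \<in> J" "q \<in> mpow n z s" "a = j + q" unfolding JM_def by blast
    have "r * a = r * j + r * q" using * by (simp add: distrib_left)
    then show ?thesis unfolding JM_def using * that Jmult mpow_mult by blast
  qed
  have JM_diff: "a - b \<in> JM s" if "a \<in> JM s" "b \<in> JM s" for a b s
    using JM_add[OF that(1) JM_mult[OF that(2) cS[of "-1"]]] by (simp add: mconst_uminus)
  have JM_sum: "(\<And>i. i \<in> A \<Longrightarrow> h i \<in> JM s) \<Longrightarrow> sum h A \<in> JM s" for h s and A :: "'j set"
    by (induction A rule: infinite_finite_induct) (auto intro: JM_add JM_J J0)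
  have JM_sum_nat: "(\<And>i. i \<in> A \<Longrightarrow> h i \<in> JM s) \<Longrightarrow> sum h A \<in> JM s" for h s and A :: "nat set"
    by (induction A rule: infinite_finite_induct) (auto intro: JM_add JM_J J0)
  have JM_JM: "a * b \<in> JM (s + t)" if ab: "a \<in> JM s" "b \<in> JM t" for a b s t
  proof -
    from ab obtain j q where *: "j \<in> J" "q \<in> mpow n z s" "a = j + q" unfolding JM_def by blast
    from ab obtain j' q' where **: "j' \<in> J" "q' \<in> mpow n z t" "b = j' + q'" unfolding JM_def by blast
    have qS: "q \<in> carrier (coord_ring n)" "q' \<in> carrier (coord_ring n)" using * ** mpow_carrier by blast+
    have "a * b = ((j' + q') * j + q * j') + q * q'" using * ** by (simp add: algebra_simps)
    moreover have "(j' + q') * j + q * j' \<in> J"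
      using * ** qS J by (intro Jadd Jmult S) auto
    ultimately show ?thesis unfolding JM_def using mpow_mpow[OF *(2) **(2)] by blast
  qed
  have y1: "y i \<in> JM 1" if "i \<le> n" for i
    unfolding y_def by (rule JM_M[OF local_coord_in_mpow[OF that]])
  \<comment> \<open>The linear part of \<open>g j\<close> at \<open>z\<close>. It agrees with an
    element of \<open>J\<close> modulo m^2, so directions normal to the tangent space count as
    second order.\<close>
  define L where "L j = (\<Sum>k\<le>n. mconst (dat z k (g j)) * y k)" for j
  have L: "L j \<in> JM 2" if "j \<in> C" for j
  proof -
    have "g j - L j \<in> JM 2"
      using JM_M[OF taylor_mpow[of "g j" n z]] g[OF that] J by (auto simp: L_def y_def carrier_coord_ring)
    from JM_diff[OF JM_J[OF g(1)[OF that]] this] show ?thesis by simp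
  qed
  \<comment> \<open>Reads each indeterminate velocity as the corresponding local coordinate, turning
    a coefficient along the arc back into a polynomial near \<open>z\<close>.\<close>
  define \<theta> where "\<theta> = msubst mconst (\<lambda>i. if i \<le> n then y i else 0)"
  note \<theta>_hom = msubst_hom[of mconst "\<lambda>i. if i \<le> n then y i else 0", folded \<theta>_def, simplified]
  have \<theta>S: "\<theta> q \<in> carrier (coord_ring n)" for q
  proof -
    have "mvars q \<subseteq> UNIV" by simp
    then show ?thesis
      by (induction q rule: mpoly_induct) (auto simp: \<theta>_hom S cS yS, auto simp: \<theta>_def S cS yS)
  qed
  have ord: "fps_X ^ s dvd arc \<rho> q" if "q \<in> mpow n z s" for q s
    using that
  proof (induction s arbitrary: q)
    case (Suc s)
    then obtain a where a: "\<And>i. i \<le> n \<Longrightarrow> a i \<in> mpow n z s" "q = (\<Sum>i\<le>n. (mvar i - mconst (z i)) * a i)"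
      by (auto simp: mpow.simps(2))
    have "fps_X ^ Suc s dvd (\<rho> i - fconst (z i)) * arc \<rho> (a i)" if "i \<le> n" for i
    proof -
      have "fps_X ^ 1 dvd \<rho> i - fconst (z i)" unfolding fps_X_power_dvd_iff using \<rho>0[OF that] by simp
      from mult_dvd_mono[OF this Suc.IH[OF a(1)[OF that]]] show ?thesis by simp
    qed
    then show ?case unfolding a(2) by (auto simp: arc_hom intro!: dvd_sum)
  qed simp
  \<comment> \<open>Key claim: modulo J + m^(s+1), an element of m^s is recovered from its
    coefficient at T^s along the arc.\<close>
  have lead: "q - \<theta> (fps_nth (arc \<rho> q) s) \<in> JM (Suc s)" if "q \<in> mpow n z s" for q s
    using that
  proof (induction s arbitrary: q)
    case 0
    then have q: "mvars q \<subseteq> {0..n}" by (simp add: carrier_coord_ring)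
    let ?T = "\<Sum>i\<le>n. mconst (dat z i q) * (mvar i - mconst (z i))"
    have "q - mconst (meval q z) - ?T \<in> mpow n z 1"
      using taylor_mpow[OF q, of z] mpow_antimono[of 1 2 n z] by auto
    moreover have "?T \<in> mpow n z 1" by (intro mpow_sum mpow_mult local_coord_in_mpow cS) auto
    ultimately have "q - mconst (meval q z) - ?T + ?T \<in> mpow n z 1" by (rule mpow_add)
    moreover have "\<theta> (fps_nth (arc \<rho> q) 0) = mconst (meval q z)"
      using arc_0[where \<rho> = \<rho> and z = z, OF q \<rho>0] by (simp add: \<theta>_def)
    ultimately show ?case by (auto intro!: JM_M)
  next
    case (Suc s)
    then obtain a where a: "\<And>i. i \<le> n \<Longrightarrow> a i \<in> mpow n z s" "q = (\<Sum>i\<le>n. y i * a i)"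
      by (auto simp: y_def mpow.simps(2))
    define b where "b i = \<theta> (fps_nth (arc \<rho> (a i)) s)" for i
    \<comment> \<open>Image under \<theta> of the correction in the velocity of the arc; it lies in
      J + m^2 because each \<open>L j\<close> does.\<close>
    define e where "e i = (\<Sum>j\<in>C. mconst (\<gamma> j i) * L j)" for i
    have ab: "a i - b i \<in> JM (Suc s)" if "i \<le> n" for i
      unfolding b_def by (rule Suc.IH[OF a(1)[OF that]])
    have JM_anti: "JM (Suc s) \<subseteq> JM s" unfolding JM_def using mpow_Suc_subset[of n z s] by blast
    have b: "b i \<in> JM s" if "i \<le> n" for i
      using JM_diff[OF JM_M[OF a(1)[OF that]], of "a i - b i"] ab[OF that] JM_anti by auto
    have e: "e i \<in> JM 2" for i unfolding e_def by (intro JM_sum JM_mult L cS)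
    have "fps_nth (arc \<rho> (y i * a i)) (Suc s) =
        (mvar i - (\<Sum>j\<in>C. mconst (\<gamma> j i) * (\<Sum>k\<le>n. mconst (dat z k (g j)) * mvar k))) * fps_nth (arc \<rho> (a i)) s"
      if i: "i \<le> n" for i
    proof -
      have "fps_nth (\<rho> i - fconst (z i)) 0 = 0" using \<rho>0[OF i] by simp
      from fps_mult_nth_orders[OF this ord[OF a(1)[OF i]]] show ?thesis
        using \<rho>1[OF i] by (simp add: y_def arc_hom)
    qed
    then have "fps_nth (arc \<rho> q) (Suc s) = (\<Sum>i\<le>n.
        (mvar i - (\<Sum>j\<in>C. mconst (\<gamma> j i) * (\<Sum>k\<le>n. mconst (dat z k (g j)) * mvar k))) * fps_nth (arc \<rho> (a i)) s)"
      unfolding a(2) by (subst arc_hom) (simp add: fps_sum_nth)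
    moreover have "\<theta> (mvar i - (\<Sum>j\<in>C. mconst (\<gamma> j i) * (\<Sum>k\<le>n. mconst (dat z k (g j)) * mvar k))) = y i - e i"
      if "i \<le> n" for i
      using that by (simp add: \<theta>_hom e_def L_def) (simp add: \<theta>_def)
    ultimately have "\<theta> (fps_nth (arc \<rho> q) (Suc s)) = (\<Sum>i\<le>n. (y i - e i) * b i)"
      by (simp add: \<theta>_hom(6)) (simp add: \<theta>_hom(2) b_def)
    then have "q - \<theta> (fps_nth (arc \<rho> q) (Suc s)) = (\<Sum>i\<le>n. y i * (a i - b i) + e i * b i)"
      unfolding a(2) by (simp add: sum_subtractf sum.distrib algebra_simps)
    also have "\<dots> \<in> JM (Suc (Suc s))"
    proof (intro JM_sum_nat JM_add)
      fix i assume "i \<in> {..n}"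
      then have i: "i \<le> n" by simp
      show "y i * (a i - b i) \<in> JM (Suc (Suc s))" using JM_JM[OF y1[OF i] ab[OF i]] by simp
      show "e i * b i \<in> JM (Suc (Suc s))" using JM_JM[OF e b[OF i]] by (simp add: numeral_2_eq_2)
    qed
    finally show ?case .
  qed
  have approx: "p \<in> JM s" for s
  proof (induction s)
    case 0
    then show ?case using p(1) JM_M[of p 0] by simp
  next
    case (Suc s)
    then obtain j q where jq: "j \<in> J" "q \<in> mpow n z s" "p = j + q" unfolding JM_def by blast
    \<comment> \<open>Both \<open>p\<close> and its part in \<open>J\<close> vanish on the arc, so
      the coefficient in the key claim is 0 and \<open>q\<close> moves up one power of m modulo
      \<open>J\<close>.\<close>
    have "arc \<rho> q = 0" using p(2) \<rho>J[OF jq(1)] by (simp add: jq arc_hom)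
    then have "q \<in> JM (Suc s)" using lead[OF jq(2)] by (simp add: \<theta>_def)
    then show ?case using JM_add[OF JM_J[OF jq(1)]] jq by simp
  qed
  have "\<exists>q\<in>mpow n z s. p - q \<in> J" for s
  proof -
    obtain j q where "j \<in> J" "q \<in> mpow n z s" "p = j + q" using approx[of s] unfolding JM_def by blast
    then show ?thesis by (intro bexI[of _ q]) simp_all
  qed
  from krull_intersection[OF J0 Jadd Jmult this]
  obtain u where u: "u \<in> mpow n z 1" "(1 - u) * p \<in> J" by blast
  have "meval (1 - u) z \<noteq> 0" using meval_mpow_Suc[of u n z 0] u(1) by (simp add: meval_hom)
  moreover have "1 - u \<in> carrier (coord_ring n)" using u(1) mpow_carrier S(2) by (intro S) blast+
  ultimately show ?thesis using u(2) by blast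
qed

section \<open>Subrings as record-based rings\<close>

text \<open>Links subsets of a type-class ring, where arithmetic is automatic, to the record-based
  ideals of the statement. It serves the coordinate ring and the stalks alike.\<close>

definition sub_ring :: "'a::comm_ring_1 set \<Rightarrow> 'a ring" where
  "sub_ring C = \<lparr>carrier = C, monoid.mult = (*), one = 1, zero = 0, add = (+)\<rparr>"

lemma sub_ring_simps [simp]:
  "carrier (sub_ring C) = C" "monoid.mult (sub_ring C) = (*)" "one (sub_ring C) = 1"
  "zero (sub_ring C) = 0" "add (sub_ring C) = (+)"
  by (simp_all add: sub_ring_def)

lemma coord_ring_conv_sub_ring: "coord_ring n = sub_ring (carrier (coord_ring n))"
  by (simp add: coord_ring_def sub_ring_def)

lemma cring_sub_ring:
  assumes "is_subring C"
  shows "cring (sub_ring C)"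
proof (rule cringI)
  show "abelian_group (sub_ring C)"
  proof (rule abelian_groupI)
    fix x assume "x \<in> carrier (sub_ring C)"
    then show "\<exists>y\<in>carrier (sub_ring C). y \<oplus>\<^bsub>sub_ring C\<^esub> x = \<zero>\<^bsub>sub_ring C\<^esub>"
      using is_subringD(5)[OF assms, of x] by (intro bexI[of _ "- x"]) simp_all
  qed (simp_all add: is_subringD[OF assms] algebra_simps)
  show "Group.comm_monoid (sub_ring C)"
    by (rule comm_monoidI) (simp_all add: is_subringD[OF assms] algebra_simps)
qed (simp add: algebra_simps)

lemma ideal_sub_ring_iff:
  assumes C: "is_subring C"
  shows "ideal J (sub_ring C) \<longleftrightarrow> J \<subseteq> C \<and> 0 \<in> J \<and> (\<forall>a\<in>J. \<forall>b\<in>J. a + b \<in> J) \<and> (\<forall>a\<in>J. \<forall>r\<in>C. r * a \<in> J)"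
proof
  assume "ideal J (sub_ring C)"
  then interpret ideal J "sub_ring C" .
  show "J \<subseteq> C \<and> 0 \<in> J \<and> (\<forall>a\<in>J. \<forall>b\<in>J. a + b \<in> J) \<and> (\<forall>a\<in>J. \<forall>r\<in>C. r * a \<in> J)"
    using a_subset additive_subgroup.zero_closed[OF additive_subgroup_axioms]
      additive_subgroup.a_closed[OF additive_subgroup_axioms] I_l_closed by auto
next
  assume J: "J \<subseteq> C \<and> 0 \<in> J \<and> (\<forall>a\<in>J. \<forall>b\<in>J. a + b \<in> J) \<and> (\<forall>a\<in>J. \<forall>r\<in>C. r * a \<in> J)"
  interpret cring "sub_ring C" by (rule cring_sub_ring[OF C])
  have inv: "- a \<in> J" if "a \<in> J" for a
  proof -
    have "(-1) * a \<in> J" using J that is_subringD(2,5)[OF C] by blast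
    then show ?thesis by simp
  qed
  have "subgroup J (add_monoid (sub_ring C))"
  proof (rule add.subgroupI)
    fix a assume a: "a \<in> J"
    have "\<ominus>\<^bsub>sub_ring C\<^esub> a = - a"
      by (rule minus_equality) (use a inv[OF a] J in \<open>simp_all add: subset_iff\<close>)
    then show "\<ominus>\<^bsub>sub_ring C\<^esub> a \<in> J" using inv[OF a] by simp
  next
    show "J \<subseteq> carrier (sub_ring C)" "J \<noteq> {}" using J by auto
    show "a \<oplus>\<^bsub>sub_ring C\<^esub> b \<in> J" if "a \<in> J" "b \<in> J" for a b using J that by simp
  qed
  then show "ideal J (sub_ring C)"
  proof (rule idealI[OF ring_axioms])
    fix a x assume "a \<in> J" "x \<in> carrier (sub_ring C)"
    then have "x * a \<in> J" using J by simp
    then show "x \<otimes>\<^bsub>sub_ring C\<^esub> a \<in> J" "a \<otimes>\<^bsub>sub_ring C\<^esub> x \<in> J"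
      by (simp_all add: mult.commute)
  qed
qed

lemma primeideal_sub_ringD:
  assumes C: "is_subring C" and P: "primeideal P (sub_ring C)"
  shows "P \<subseteq> C" "0 \<in> P" "a \<in> P \<Longrightarrow> b \<in> P \<Longrightarrow> a + b \<in> P" "a \<in> P \<Longrightarrow> r \<in> C \<Longrightarrow> r * a \<in> P" "1 \<notin> P"
    "a \<in> C \<Longrightarrow> b \<in> C \<Longrightarrow> a * b \<in> P \<Longrightarrow> a \<in> P \<or> b \<in> P"
proof -
  interpret primeideal P "sub_ring C" by (rule P)
  show "P \<subseteq> C" "0 \<in> P" "a \<in> P \<Longrightarrow> b \<in> P \<Longrightarrow> a + b \<in> P" "a \<in> P \<Longrightarrow> r \<in> C \<Longrightarrow> r * a \<in> P"
    using ideal_axioms[unfolded ideal_sub_ring_iff[OF C]] by blast+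
  show "1 \<notin> P" using one_imp_carrier I_notcarr unfolding sub_ring_simps by blast
  show "a \<in> C \<Longrightarrow> b \<in> C \<Longrightarrow> a * b \<in> P \<Longrightarrow> a \<in> P \<or> b \<in> P" using I_prime[of a b] unfolding sub_ring_simps by blast
qed

lemma ideal_coord_ring_iff:
  "ideal J (coord_ring n) \<longleftrightarrow> J \<subseteq> carrier (coord_ring n) \<and> 0 \<in> J \<and> (\<forall>a\<in>J. \<forall>b\<in>J. a + b \<in> J) \<and>
     (\<forall>a\<in>J. \<forall>r\<in>carrier (coord_ring n). r * a \<in> J)"
  by (subst coord_ring_conv_sub_ring, rule ideal_sub_ring_iff[OF is_subring_coord_ring])

lemmas primeideal_coord_ringD =
  primeideal_sub_ringD[OF is_subring_coord_ring, folded coord_ring_conv_sub_ring]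

lemma cring_coord_ring: "cring (coord_ring n)"
  by (subst coord_ring_conv_sub_ring) (rule cring_sub_ring[OF is_subring_coord_ring])

lemma ideal_genideal_coord_ring:
  assumes "A \<subseteq> carrier (coord_ring n)"
  shows "ideal (Idl\<^bsub>coord_ring n\<^esub> A) (coord_ring n)" "A \<subseteq> Idl\<^bsub>coord_ring n\<^esub> A"
proof -
  interpret cring "coord_ring n" by (rule cring_coord_ring)
  show "ideal (Idl\<^bsub>coord_ring n\<^esub> A) (coord_ring n)" "A \<subseteq> Idl\<^bsub>coord_ring n\<^esub> A"
    using genideal_ideal genideal_self assms by blast+
qed

lemma genideal_coord_ring_minimal:
  assumes "ideal J (coord_ring n)" "A \<subseteq> J"
  shows "Idl\<^bsub>coord_ring n\<^esub> A \<subseteq> J"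
proof -
  interpret cring "coord_ring n" by (rule cring_coord_ring)
  show ?thesis using genideal_minimal assms by blast
qed

section \<open>Regular sequences and chains of primes\<close>

text \<open>The elements are removed from the end of the sequence; each removal raises the growth
  order by one, as the removed element is a nonzerodivisor modulo its predecessors. At the zero
  ideal the order is \<open>l + length gs\<close>, and \<open>growth_le\<close> applies.\<close>

lemma regular_sequence_growth:
  assumes reg: "regular_sequence (coord_ring n) gs"
    and forms: "\<And>g. g \<in> set gs \<Longrightarrow> \<exists>e. form n e g"
    and growth: "growth n (Idl\<^bsub>coord_ring n\<^esub> (set gs)) l"
  shows "l + length gs \<le> n"
proof -
  let ?J = "\<lambda>i. Idl\<^bsub>coord_ring n\<^esub> (set (take i gs))"
  have gsS: "set gs \<subseteq> carrier (coord_ring n)" using reg by (simp add: regular_sequence_def)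
  have sub: "set (take i gs) \<subseteq> carrier (coord_ring n)" for i using gsS set_take_subset[of i gs] by blast
  have "growth n (?J (length gs - i)) (l + i)" if "i \<le> length gs" for i
    using that
  proof (induction i)
    case 0
    then show ?case using growth by simp
  next
    case (Suc i)
    define k where "k = length gs - Suc i"
    have k: "k < length gs" "length gs - i = Suc k" using Suc.prems by (auto simp: k_def)
    have tk: "set (take (Suc k) gs) = insert (gs ! k) (set (take k gs))"
      using k(1) by (simp add: take_Suc_conv_app_nth)
    obtain e where e: "form n e (gs ! k)" using forms k(1) nth_mem by blast
    have id: "ideal (?J k) (coord_ring n)" "ideal (?J (Suc k)) (coord_ring n)"
      by (intro ideal_genideal_coord_ring sub)+
    have mono: "?J k \<subseteq> ?J (Suc k)"
      using ideal_genideal_coord_ring(2)[OF sub, of "Suc k"] tk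
      by (intro genideal_coord_ring_minimal[OF id(2)]) auto
    have "growth n (?J k) (Suc (l + i))"
    proof (rule growth_Suc[where e = e and g = "gs ! k"])
      show "growth n (?J (Suc k)) (l + i)" using Suc k by simp
      show "gs ! k \<in> ?J (Suc k)" using ideal_genideal_coord_ring(2)[OF sub, of "Suc k"] tk by auto
      fix a and p :: "(nat, 'a) mpoly"
      assume "form n a p" "gs ! k * p \<in> ?J k"
      then show "p \<in> ?J k" using reg k(1) unfolding regular_sequence_def
        by (auto simp: form_def coord_ring_def)
    qed (use id mono e in \<open>auto simp: ideal_coord_ring_iff form_def\<close>)
    then show ?case by (simp add: k_def)
  qed
  from this[of "length gs"] have "growth n (?J 0) (l + length gs)" by simp
  moreover have "0 \<in> ?J 0" using ideal_genideal_coord_ring(1)[OF sub, of 0] by (simp add: ideal_coord_ring_iff)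
  ultimately show ?thesis by (rule growth_le)
qed

text \<open>The sets \<open>Q i\<close> need not be ideals: they will also come from primes of local rings and from the kernel
  of a formal arc.\<close>

lemma prime_chain_growth:
  fixes Q :: "nat \<Rightarrow> (nat, 'k::field) mpoly set"
  assumes add: "\<And>i a p q. i \<le> m \<Longrightarrow> form n a p \<Longrightarrow> form n a q \<Longrightarrow> p \<in> Q i \<Longrightarrow> q \<in> Q i \<Longrightarrow> p + q \<in> Q i"
    and mult: "\<And>i a b p q. i \<le> m \<Longrightarrow> form n a p \<Longrightarrow> form n b q \<Longrightarrow> p \<in> Q i \<Longrightarrow> q * p \<in> Q i"
    and prime: "\<And>i a b p q. i \<le> m \<Longrightarrow> form n a p \<Longrightarrow> form n b q \<Longrightarrow> p * q \<in> Q i \<Longrightarrow> p \<in> Q i \<or> q \<in> Q i"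
    and proper: "\<And>N. \<exists>p. form n N p \<and> p \<notin> Q m"
    and sub: "\<And>i a p. i < m \<Longrightarrow> form n a p \<Longrightarrow> p \<in> Q i \<Longrightarrow> p \<in> Q (Suc i)"
    and strict: "\<And>i. i < m \<Longrightarrow> \<exists>e g. form n e g \<and> g \<in> Q (Suc i) \<and> g \<notin> Q i"
  shows "growth n (Q 0) m"
proof -
  \<comment> \<open>From the top of the chain downwards: by primality, a form in the larger set but
    not in the smaller is a nonzerodivisor modulo the smaller.\<close>
  have "growth n (Q (m - i)) i" if "i \<le> m" for i
    using that
  proof (induction i)
    case 0
    show ?case using growth_0[of n "Q (m - 0)", OF _ mult[of "m - 0"]] proper by simp
  next
    case (Suc i)
    define k where "k = m - Suc i"
    have k: "k < m" "m - i = Suc k" using Suc.prems by (auto simp: k_def)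
    obtain e g where g: "form n e g" "g \<in> Q (Suc k)" "g \<notin> Q k" using strict[OF k(1)] by blast
    have "growth n (Q k) (Suc i)"
    proof (rule growth_Suc[where e = e and g = g])
      show "growth n (Q (Suc k)) i" using Suc k by simp
      show "p \<in> Q k" if "form n a p" "g * p \<in> Q k" for a p
        using prime[of k e g a p] g that k(1) by simp
    qed (use g k(1) add[of "Suc k"] mult[of "Suc k"] sub[of k] in auto)
    then show ?case by (simp add: k_def)
  qed
  from this[of m] show ?thesis by simp
qed

section \<open>Local rings of projective schemes\<close>

lemma closed_pointD:
  assumes "p \<in> closed_point n z"
  shows "p \<in> carrier (coord_ring n)" "meval p z = 0"
proof -
  let ?V = "{p \<in> carrier (coord_ring n). meval p z = 0}"
  have "ideal ?V (coord_ring n)"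
    by (auto simp: ideal_coord_ring_iff meval_hom is_subringD[OF is_subring_coord_ring])
  then have "closed_point n z \<subseteq> ?V"
    unfolding closed_point_def by (rule genideal_coord_ring_minimal) auto
  then show "p \<in> carrier (coord_ring n)" "meval p z = 0" using assms by auto
qed

lemma form_in_closed_point_iff:
  assumes "form n e p"
  shows "p \<in> closed_point n z \<longleftrightarrow> meval p z = 0"
proof
  assume "meval p z = 0"
  then show "p \<in> closed_point n z" using assms unfolding closed_point_def
    by (intro ideal_genideal_coord_ring(2)[THEN subsetD]) (auto simp: form_def)
qed (rule closed_pointD)

lemma proj_stalk_conv_sub_ring: "proj_stalk n P = sub_ring (carrier (proj_stalk n P))"
  by (simp add: proj_stalk_def sub_ring_def)

lemma mem_proj_stalk_iff:
  "x \<in> carrier (proj_stalk n P) \<longleftrightarrow> (\<exists>a s e. x = Fract a s \<and> form n e a \<and> form n e s \<and> s \<notin> P)"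
  by (auto simp: proj_stalk_def form_def)

lemma mem_ideal_stalk_iff:
  "I \<subseteq> carrier (coord_ring n) \<Longrightarrow>
    x \<in> ideal_stalk n I P \<longleftrightarrow> (\<exists>a s e. x = Fract a s \<and> a \<in> I \<and> form n e a \<and> form n e s \<and> s \<notin> P)"
  by (auto simp: ideal_stalk_def form_def)

lemma form_0 [simp]: "form n e 0"
  by (simp add: form_def carrier_coord_ring)

lemma form_1 [simp]: "form n 0 1"
  by (simp add: form_def carrier_coord_ring)

lemma form_add: "form n e p \<Longrightarrow> form n e q \<Longrightarrow> form n e (p + q)"
  by (simp add: form_def carrier_coord_ring mvars_add homogeneous_add)

lemma form_uminus: "form n e p \<Longrightarrow> form n e (- p)"
  by (simp add: form_def carrier_coord_ring mvars_uminus homogeneous_uminus)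

context
  fixes n :: nat and P :: "(nat, 'k::field) mpoly set"
  assumes P: "primeideal P (coord_ring n)"
begin

lemma prime_mult_notin:
  assumes "form n a s" "form n b t" "s \<notin> P" "t \<notin> P"
  shows "s * t \<notin> P" "s \<noteq> 0"
  using primeideal_coord_ringD(6)[OF P, of s t] primeideal_coord_ringD(2)[OF P] assms by (auto simp: form_def)

lemma is_subring_proj_stalk: "is_subring (carrier (proj_stalk n P))"
  unfolding is_subring_def
proof (intro conjI ballI)
  have one: "1 \<notin> P" by (rule primeideal_coord_ringD(5)[OF P])
  show "0 \<in> carrier (proj_stalk n P)" unfolding mem_proj_stalk_iff
    by (intro exI[of _ 0] exI[of _ 1]) (auto simp: one fract_collapse)
  show "1 \<in> carrier (proj_stalk n P)" unfolding mem_proj_stalk_iff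
    by (intro exI[of _ 1] exI[of _ 0]) (auto simp: one fract_collapse intro: exI[of _ 1])
  fix x assume "x \<in> carrier (proj_stalk n P)"
  then obtain a s d where x: "x = Fract a s" "form n d a" "form n d s" "s \<notin> P" unfolding mem_proj_stalk_iff by blast
  show "- x \<in> carrier (proj_stalk n P)" unfolding mem_proj_stalk_iff
    using x form_uminus by (intro exI[of _ "- a"] exI[of _ s] exI[of _ d]) simp
  fix y assume "y \<in> carrier (proj_stalk n P)"
  then obtain b t e where y: "y = Fract b t" "form n e b" "form n e t" "t \<notin> P" unfolding mem_proj_stalk_iff by blast
  note nz = prime_mult_notin(2)[OF x(3) x(3) x(4) x(4)] prime_mult_notin(2)[OF y(3) y(3) y(4) y(4)]
  show "x * y \<in> carrier (proj_stalk n P)" unfolding mem_proj_stalk_iff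
    using x y prime_mult_notin(1)[OF x(3) y(3) x(4) y(4)]
    by (intro exI[of _ "a * b"] exI[of _ "s * t"] exI[of _ "d + e"]) (auto intro: form_mult)
  show "x + y \<in> carrier (proj_stalk n P)" unfolding mem_proj_stalk_iff
    using x y nz prime_mult_notin(1)[OF x(3) y(3) x(4) y(4)] form_mult[OF x(2) y(3)] form_mult[OF y(2) x(3)]
    by (intro exI[of _ "a * t + b * s"] exI[of _ "s * t"] exI[of _ "d + e"])
      (auto intro: form_mult form_add simp: add.commute)
qed

lemma ideal_ideal_stalk:
  assumes I: "ideal I (coord_ring n)"
  shows "ideal (ideal_stalk n I P) (sub_ring (carrier (proj_stalk n P)))"
  unfolding ideal_sub_ring_iff[OF is_subring_proj_stalk]
proof (intro conjI ballI subsetI)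
  have IS: "I \<subseteq> carrier (coord_ring n)" and I0: "0 \<in> I"
    and Iadd: "\<And>a b. a \<in> I \<Longrightarrow> b \<in> I \<Longrightarrow> a + b \<in> I"
    and Imult: "\<And>a r e. a \<in> I \<Longrightarrow> form n e r \<Longrightarrow> r * a \<in> I"
    using I by (auto simp: ideal_coord_ring_iff form_def)
  note mem = mem_ideal_stalk_iff[OF IS]
  have one: "1 \<notin> P" by (rule primeideal_coord_ringD(5)[OF P])
  show "0 \<in> ideal_stalk n I P" unfolding mem
    by (intro exI[of _ 0] exI[of _ 1]) (auto simp: one fract_collapse I0)
  fix x assume "x \<in> ideal_stalk n I P"
  then obtain a s d where x: "x = Fract a s" "a \<in> I" "form n d a" "form n d s" "s \<notin> P" unfolding mem by blast
  then show "x \<in> carrier (proj_stalk n P)" unfolding mem_proj_stalk_iff by blast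
  note nzx = prime_mult_notin(2)[OF x(4) x(4) x(5) x(5)]
  fix y
  {
    assume "y \<in> ideal_stalk n I P"
    then obtain b t e where y: "y = Fract b t" "b \<in> I" "form n e b" "form n e t" "t \<notin> P" unfolding mem by blast
    have "a * t + b * s \<in> I"
      using Iadd[OF Imult[OF x(2) y(4)] Imult[OF y(2) x(4)]] by (simp add: mult.commute)
    then show "x + y \<in> ideal_stalk n I P" unfolding mem
      using x y nzx prime_mult_notin(2)[OF y(4) y(4) y(5) y(5)] prime_mult_notin(1)[OF x(4) y(4) x(5) y(5)]
        form_mult[OF x(3) y(4)] form_mult[OF y(3) x(4)]
      by (intro exI[of _ "a * t + b * s"] exI[of _ "s * t"] exI[of _ "d + e"])
        (auto intro: form_mult form_add simp: add.commute)
  }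
  assume "y \<in> carrier (proj_stalk n P)"
  then obtain b t e where y: "y = Fract b t" "form n e b" "form n e t" "t \<notin> P" unfolding mem_proj_stalk_iff by blast
  show "y * x \<in> ideal_stalk n I P" unfolding mem
    using x y Imult[OF x(2) y(2)] prime_mult_notin(1)[OF y(3) x(4) y(4) x(5)]
    by (intro exI[of _ "b * a"] exI[of _ "t * s"] exI[of _ "e + d"]) (auto intro: form_mult)
qed

end

text \<open>Primes of the local ring at a closed point \<open>z\<close> are traced back to sets of forms by dehomogenising
  with a coordinate that does not vanish at \<open>z\<close>.\<close>

lemma local_ring_krull_dim_le:
  fixes z :: "nat \<Rightarrow> 'k::field"
  assumes P: "primeideal (closed_point n z) (coord_ring n)" and i0: "i0 \<le> n" "z i0 \<noteq> 0"
    and I: "ideal I (coord_ring n)"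
    and bound: "\<And>l. growth n I l \<Longrightarrow> l \<le> d"
  shows "krull_dim (local_ring n I (closed_point n z)) \<le> enat d"
proof -
  let ?P = "closed_point n z"
  let ?C = "carrier (proj_stalk n ?P)"
  let ?O = "sub_ring ?C"
  let ?I = "ideal_stalk n I ?P"
  define h where "h = (+>\<^bsub>?O\<^esub>) ?I"
  note C = is_subring_proj_stalk[OF P]
  interpret cring ?O by (rule cring_sub_ring[OF C])
  interpret id: ideal ?I ?O by (rule ideal_ideal_stalk[OF P I])
  have loc: "local_ring n I ?P = ?O Quot ?I"
    by (simp add: local_ring_def proj_stalk_conv_sub_ring[symmetric])
  interpret h: ring_hom_ring ?O "?O Quot ?I" h
    unfolding h_def by (rule id.rcos_ring_hom_ring)
  define x0 :: "(nat, 'k) mpoly" where "x0 = mvar i0"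
  have x0: "form n e (x0 ^ e)" "x0 ^ e \<notin> ?P" "x0 \<noteq> 0" for e
  proof -
    show 1: "form n e (x0 ^ e)" using form_power[OF form_mvar[OF i0(1)], of e] by (simp add: x0_def)
    have "meval (x0 ^ e) z \<noteq> 0" using i0(2) by (simp add: x0_def meval_hom)
    then show "x0 ^ e \<notin> ?P" using form_in_closed_point_iff[OF 1] by blast
    have "meval x0 z \<noteq> 0" using i0(2) by (simp add: x0_def meval_hom)
    then show "x0 \<noteq> 0" by (auto simp: meval_hom)
  qed
  have C_form: "Fract p (x0 ^ e) \<in> ?C" "s \<notin> ?P \<Longrightarrow> Fract p s \<in> ?C" if "form n e p" "form n e s" for e p s
    unfolding mem_proj_stalk_iff using that x0(1,2) by blast+
  have "m \<le> d" if Q: "\<forall>i\<le>m. primeideal (Q i) (?O Quot ?I)" "\<forall>i<m. Q i \<subset> Q (Suc i)"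
    for m and Q :: "nat \<Rightarrow> (nat, 'k) mpoly fract set set"
  proof -
    define q where "q i = {x \<in> ?C. h x \<in> Q i}" for i
    have prime: "primeideal (q i) ?O" if "i \<le> m" for i
      using h.primeideal_vimage[OF is_cring, of "Q i"] Q(1) that by (simp add: q_def)
    have qC: "q i \<subseteq> ?C" for i by (auto simp: q_def)
    note qD = primeideal_sub_ringD[OF C prime]
    have surj: "\<exists>x\<in>?C. X = h x" if "X \<in> carrier (?O Quot ?I)" for X
      using that by (auto simp: FactRing_def A_RCOSETS_def' h_def)
    have strict: "q i \<subseteq> q (Suc i) \<and> q i \<noteq> q (Suc i)" if i: "i < m" for i
    proof
      show "q i \<subseteq> q (Suc i)" using Q(2) i by (auto simp: q_def)
      obtain X where X: "X \<in> Q (Suc i)" "X \<notin> Q i" using Q(2) i by blast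
      have "ideal (Q (Suc i)) (?O Quot ?I)" by (rule primeideal.axioms(1)) (use Q(1) i in simp)
      then have "X \<in> carrier (?O Quot ?I)"
        using X(1) additive_subgroup.a_subset[OF ideal.axioms(1)] by blast
      from surj[OF this] obtain x where "x \<in> ?C" "X = h x" by blast
      then have "x \<in> q (Suc i)" "x \<notin> q i" using X by (auto simp: q_def)
      then show "q i \<noteq> q (Suc i)" by blast
    qed
    have Iq: "?I \<subseteq> q 0"
    proof
      fix x assume x: "x \<in> ?I"
      then have xC: "x \<in> ?C" using id.a_subset by auto
      have "h x = ?I" unfolding h_def by (rule id.a_rcos_const[OF x])
      also have "\<dots> = \<zero>\<^bsub>?O Quot ?I\<^esub>" by (simp add: FactRing_def)
      also have "\<dots> \<in> Q 0"
        using Q(1) additive_subgroup.zero_closed[OF ideal.axioms(1)] primeideal.axioms(1) by blast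
      finally show "x \<in> q 0" using xC by (simp add: q_def)
    qed
    \<comment> \<open>The degree \<open>e\<close> is determined by \<open>p\<close> unless
      \<open>p = 0\<close>, and zero belongs with any degree.\<close>
    define F where "F i = {p. \<exists>e. form n e p \<and> Fract p (x0 ^ e) \<in> q i}" for i
    have F: "p \<in> F i \<longleftrightarrow> Fract p (x0 ^ e) \<in> q i" if "form n e p" "i \<le> m" for p e i
    proof (cases "p = 0")
      case True
      then show ?thesis using qD(2)[OF that(2)] that x0(3) by (auto simp: F_def fract_collapse)
    next
      case False
      then show ?thesis using that homogeneous_unique[of _ p e] by (auto simp: F_def form_def)
    qed
    have "growth n (F 0) m"
    proof (rule prime_chain_growth)
      fix i a b and p g :: "(nat, 'k) mpoly" assume i: "i \<le> m" and p: "form n a p" and g: "form n b g"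
      have *: "Fract (p * g) (x0 ^ (a + b)) = Fract p (x0 ^ a) * Fract g (x0 ^ b)" by (simp add: power_add)
      show "g * p \<in> F i" if "p \<in> F i"
        using qD(4)[OF i _ C_form(1)[OF g g], of "Fract p (x0 ^ a)"] that F[OF p i] F[OF form_mult[OF p g] i] *
        by (simp add: mult.commute)
      show "p \<in> F i \<or> g \<in> F i" if "p * g \<in> F i"
        using qD(6)[OF i C_form(1)[OF p p] C_form(1)[OF g g]] that F[OF p i] F[OF g i] F[OF form_mult[OF p g] i] *
        by simp
    next
      fix i a and p g :: "(nat, 'k) mpoly" assume i: "i \<le> m" and p: "form n a p" and g: "form n a g"
        and F2: "p \<in> F i" "g \<in> F i"
      have "Fract p (x0 ^ a) + Fract g (x0 ^ a) = Fract (p + g) (x0 ^ a)"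
        using x0(3) by (simp add: eq_fract algebra_simps)
      then show "p + g \<in> F i"
        using qD(3)[OF i] F2 F[OF p i] F[OF g i] F[OF form_add[OF p g] i] by metis
    next
      fix N
      have "Fract (x0 ^ N) (x0 ^ N) = 1" using x0(3) by (simp add: One_fract_def eq_fract)
      then have "x0 ^ N \<notin> F m" using F[OF x0(1), of m N] qD(5)[of m] by simp
      then show "\<exists>p. form n N p \<and> p \<notin> F m" using x0(1) by blast
    next
      fix i a and p :: "(nat, 'k) mpoly" assume i: "i < m" and p: "form n a p" "p \<in> F i"
      then show "p \<in> F (Suc i)" using F[OF p(1), of i] F[OF p(1), of "Suc i"] strict[OF i] by auto
    next
      fix i assume i: "i < m"
      then have im: "i \<le> m" "Suc i \<le> m" by auto
      \<comment> \<open>Denominators are units of the stalk, so an element separating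
        \<open>q i\<close> from \<open>q (Suc i)\<close> may be replaced by its numerator over a
        power of \<open>x0\<close>.\<close>
      obtain y where y: "y \<in> q (Suc i)" "y \<notin> q i" using strict[OF i] by blast
      then have "y \<in> ?C" using qC by blast
      then obtain a s e where a: "y = Fract a s" "form n e a" "form n e s" "s \<notin> ?P"
        unfolding mem_proj_stalk_iff by blast
      have s0: "s \<noteq> 0" using prime_mult_notin(2)[OF P a(3) a(3) a(4) a(4)] .
      have "Fract a (x0 ^ e) = Fract s (x0 ^ e) * y" using s0 x0(3) by (simp add: a eq_fract)
      moreover have "y = Fract (x0 ^ e) s * Fract a (x0 ^ e)" using s0 x0(3) by (simp add: a eq_fract)
      ultimately have "Fract a (x0 ^ e) \<in> q (Suc i)" "Fract a (x0 ^ e) \<notin> q i"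
        using qD(4)[OF im(2) y(1) C_form(1)[OF a(3) a(3)]] qD(4)[OF im(1) _ C_form(2)[OF x0(1) a(3) a(4)]] y(2)
        by metis+
      then show "\<exists>e g. form n e g \<and> g \<in> F (Suc i) \<and> g \<notin> F i"
        using F[OF a(2) im(1)] F[OF a(2) im(2)] a(2) by blast
    qed
    \<comment> \<open>The forms of \<open>I\<close> lie in the bottom set, hence \<open>I\<close>
      inherits its growth.\<close>
    moreover have "p \<in> F 0" if "form n e p" "p \<in> I" for e p
    proof -
      have IS: "I \<subseteq> carrier (coord_ring n)" using I by (simp add: ideal_coord_ring_iff)
      have "Fract p (x0 ^ e) \<in> ?I"
        unfolding mem_ideal_stalk_iff[OF IS] using that x0(1,2) by blast
      then show ?thesis using Iq F[OF that(1), of 0] by auto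
    qed
    ultimately show "m \<le> d" by (intro bound growth_antimono[of n "F 0" m I])
  qed
  then show ?thesis unfolding krull_dim_def loc
    by (intro Sup_least) auto
qed

section \<open>Tangent vectors and the maximal ideal at a closed point\<close>

definition ddir :: "nat \<Rightarrow> (nat \<Rightarrow> 'k::field) \<Rightarrow> (nat \<Rightarrow> 'k) \<Rightarrow> (nat, 'k) mpoly \<Rightarrow> 'k" where
  "ddir n z v p = (\<Sum>i\<le>n. dat z i p * v i)"

lemma ddir_simps:
  "ddir n z v (p + q) = ddir n z v p + ddir n z v q"
  "ddir n z v (p - q) = ddir n z v p - ddir n z v q"
  "ddir n z v (p * q) = ddir n z v p * meval q z + meval p z * ddir n z v q"
  "ddir n z v (mconst c) = 0" "i \<le> n \<Longrightarrow> ddir n z v (mvar i) = v i"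
proof -
  show "ddir n z v (mvar i) = v i" if "i \<le> n"
  proof -
    have "ddir n z v (mvar i) = (\<Sum>j\<le>n. if j = i then v j else 0)"
      unfolding ddir_def by (intro sum.cong) (auto simp: dat_mvar)
    then show ?thesis using that by (simp add: sum.delta)
  qed
qed (simp_all add: ddir_def dat_add dat_diff dat_mult dat_mconst sum.distrib sum_subtractf
  sum_distrib_left sum_distrib_right algebra_simps)

text \<open>Differentiation at \<open>z\<close> in direction \<open>v\<close>, up to the factor \<open>s(z)\<close>, on fractions \<open>a/s\<close> vanishing at \<open>z\<close>.\<close>

definition tangent_ideal :: "nat \<Rightarrow> (nat \<Rightarrow> 'k::field) \<Rightarrow> (nat \<Rightarrow> 'k) \<Rightarrow> (nat, 'k) mpoly fract set" where
  "tangent_ideal n z v = {Fract a s | a s e. form n e a \<and> form n e s \<and> s \<notin> closed_point n z \<and>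
     meval a z = 0 \<and> ddir n z v a = 0}"

lemma ideal_tangent_ideal:
  assumes P: "primeideal (closed_point n z) (coord_ring n)"
  shows "ideal (tangent_ideal n z v) (sub_ring (carrier (proj_stalk n (closed_point n z))))"
  unfolding ideal_sub_ring_iff[OF is_subring_proj_stalk[OF P]]
proof (intro conjI ballI subsetI)
  have mem: "x \<in> tangent_ideal n z v \<longleftrightarrow> (\<exists>a s e. x = Fract a s \<and> form n e a \<and> form n e s \<and> s \<notin> closed_point n z \<and>
     meval a z = 0 \<and> ddir n z v a = 0)" for x
    by (auto simp: tangent_ideal_def)
  have one: "1 \<notin> closed_point n z" by (rule primeideal_coord_ringD(5)[OF P])
  have dd0: "ddir n z v 0 = 0" using ddir_simps(4)[of n z v 0] by simp
  show "0 \<in> tangent_ideal n z v" unfolding mem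
    by (intro exI[of _ 0] exI[of _ 1]) (auto simp: one fract_collapse meval_hom dd0)
  fix x assume "x \<in> tangent_ideal n z v"
  then obtain a s d where x: "x = Fract a s" "form n d a" "form n d s" "s \<notin> closed_point n z"
    "meval a z = 0" "ddir n z v a = 0" unfolding mem by blast
  then show "x \<in> carrier (proj_stalk n (closed_point n z))" unfolding mem_proj_stalk_iff by blast
  note nzx = prime_mult_notin(2)[OF P x(3) x(3) x(4) x(4)]
  fix y
  {
    assume "y \<in> tangent_ideal n z v"
    then obtain b t e where y: "y = Fract b t" "form n e b" "form n e t" "t \<notin> closed_point n z"
      "meval b z = 0" "ddir n z v b = 0" unfolding mem by blast
    show "x + y \<in> tangent_ideal n z v" unfolding mem
      using x y nzx prime_mult_notin(2)[OF P y(3) y(3) y(4) y(4)] prime_mult_notin(1)[OF P x(3) y(3) x(4) y(4)]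
        form_mult[OF x(2) y(3)] form_mult[OF y(2) x(3)]
      by (intro exI[of _ "a * t + b * s"] exI[of _ "s * t"] exI[of _ "d + e"])
        (auto intro: form_mult form_add simp: add.commute meval_hom ddir_simps)
  }
  assume "y \<in> carrier (proj_stalk n (closed_point n z))"
  then obtain b t e where y: "y = Fract b t" "form n e b" "form n e t" "t \<notin> closed_point n z"
    unfolding mem_proj_stalk_iff by blast
  show "y * x \<in> tangent_ideal n z v" unfolding mem
    using x y prime_mult_notin(1)[OF P y(3) x(3) y(4) x(4)]
    by (intro exI[of _ "b * a"] exI[of _ "t * s"] exI[of _ "e + d"])
      (auto intro: form_mult simp: meval_hom ddir_simps)
qed

lemma rcos_eq_imp_diff_mem:
  assumes C: "is_subring C" and I: "ideal I (sub_ring C)" and x: "x \<in> C" "y \<in> C"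
    and eq: "I +>\<^bsub>sub_ring C\<^esub> x = I +>\<^bsub>sub_ring C\<^esub> y"
  shows "\<exists>i\<in>I. x = i + y"
proof -
  interpret ideal I "sub_ring C" by (rule I)
  have "x \<in> I +>\<^bsub>sub_ring C\<^esub> x" using a_rcos_self x by simp
  then have "x \<in> (\<Union>i\<in>I. {i + y})" unfolding eq unfolding a_r_coset_def' sub_ring_simps .
  then show ?thesis by blast
qed

text \<open>If the gradients at the regular point \<open>z\<close> had rank less than \<open>n - d\<close>, then after imposing the
  vanishing on \<open>d\<close> generators of the maximal ideal there would remain a nonzero tangent direction at
  \<open>z\<close> killing the whole maximal ideal.\<close>

theorem gradient_rank_at_smooth_point:
  fixes z :: "nat \<Rightarrow> 'k::alg_closed_field" and f :: "nat \<Rightarrow> (nat, 'k) mpoly"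
  assumes smooth: "smooth_point n I z"
    and I: "I = Idl\<^bsub>coord_ring n\<^esub> (f ` R)" and f: "f ` R \<subseteq> carrier (coord_ring n)" and R: "finite R"
    and bound: "\<And>l. growth n I l \<Longrightarrow> l \<le> d" and cd: "c + d = n" "0 < c"
  shows "\<exists>A\<subseteq>R. card A = c \<and> (\<exists>\<gamma>. dual_family {..n} (\<lambda>j i. dat z i (f j)) A \<gamma>)"
proof (rule ccontr)
  assume neg: "\<not> ?thesis"
  let ?P = "closed_point n z"
  let ?C = "carrier (proj_stalk n ?P)"
  let ?O = "sub_ring ?C"
  let ?I = "ideal_stalk n I ?P"
  define h where "h = (+>\<^bsub>?O\<^esub>) ?I"
  have P: "primeideal ?P (coord_ring n)" and IP: "I \<subseteq> ?P" and reg: "regular_local (local_ring n I ?P)"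
    using smooth by (auto simp: smooth_point_def proj_points_def)
  obtain i0 where i0: "i0 \<le> n" "z i0 \<noteq> 0" using smooth by (auto simp: smooth_point_def hom_coords_def)
  have Iid: "ideal I (coord_ring n)" and fI: "f ` R \<subseteq> I"
    using ideal_genideal_coord_ring[OF f] by (simp_all add: I)
  then have IS: "I \<subseteq> carrier (coord_ring n)" by (simp add: ideal_coord_ring_iff)
  note C = is_subring_proj_stalk[OF P]
  interpret cring ?O by (rule cring_sub_ring[OF C])
  interpret id: ideal ?I ?O by (rule ideal_ideal_stalk[OF P Iid])
  have loc: "local_ring n I ?P = ?O Quot ?I"
    by (simp add: local_ring_def proj_stalk_conv_sub_ring[symmetric])
  interpret h: ring_hom_ring ?O "?O Quot ?I" h
    unfolding h_def by (rule id.rcos_ring_hom_ring)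
  interpret Q: cring "?O Quot ?I" by (rule id.quotient_is_cring[OF is_cring])
  from reg obtain A where A: "A \<subseteq> carrier (?O Quot ?I)" "finite A"
      "enat (card A) = krull_dim (local_ring n I ?P)" "Idl\<^bsub>?O Quot ?I\<^esub> A = nonunits (?O Quot ?I)"
    unfolding regular_local_def loc by blast
  have cardA: "card A \<le> d"
    using local_ring_krull_dim_le[OF P i0 Iid bound] unfolding A(3)[symmetric] by simp
  \<comment> \<open>Fewer than \<open>c\<close> gradients then already impose all linear conditions
    coming from \<open>f\<close>.\<close>
  from neg dual_family_dichotomy[OF R, of c "{..n}" "\<lambda>j i. dat z i (f j)"]
  obtain B where B: "B \<subseteq> R" "card B < c"
    and Bspan: "\<And>v. (\<forall>j\<in>B. ddir n z v (f j) = 0) \<Longrightarrow> (\<forall>j\<in>R. ddir n z v (f j) = 0)"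
    unfolding ddir_def by blast
  \<comment> \<open>A generator of the maximal ideal is a fraction whose numerator vanishes at
    \<open>z\<close>; otherwise it would be a unit.\<close>
  have rep: "\<exists>a s e. form n e a \<and> form n e s \<and> s \<notin> ?P \<and> meval a z = 0 \<and> \<alpha> = h (Fract a s)" if \<alpha>: "\<alpha> \<in> A" for \<alpha>
  proof -
    have "\<alpha> \<in> carrier (?O Quot ?I)" using A(1) \<alpha> by blast
    then obtain x where x: "x \<in> ?C" "\<alpha> = h x" by (auto simp: FactRing_def A_RCOSETS_def' h_def)
    then obtain a s e where a: "x = Fract a s" "form n e a" "form n e s" "s \<notin> ?P"
      unfolding mem_proj_stalk_iff by blast
    have "meval a z = 0"
    proof (rule ccontr)
      assume "meval a z \<noteq> 0"
      then have aP: "a \<notin> ?P" using form_in_closed_point_iff[OF a(2)] by blast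
      then have y: "Fract s a \<in> ?C" unfolding mem_proj_stalk_iff using a by blast
      have nz: "a \<noteq> 0" "s \<noteq> 0"
        using prime_mult_notin(2)[OF P a(2) a(2) aP aP] prime_mult_notin(2)[OF P a(3) a(3) a(4) a(4)] by auto
      have "Fract a s * Fract s a = 1" using nz by (simp add: One_fract_def eq_fract)
      then have "h x \<otimes>\<^bsub>?O Quot ?I\<^esub> h (Fract s a) = \<one>\<^bsub>?O Quot ?I\<^esub>"
        using h.hom_mult[of x "Fract s a"] h.hom_one x(1) y by (simp add: a(1))
      then have "\<alpha> \<in> Units (?O Quot ?I)"
        using x y h.hom_closed[of x] h.hom_closed[of "Fract s a"] Q.m_comm[of "h x" "h (Fract s a)"]
        unfolding Units_def by auto
      moreover have "\<alpha> \<in> nonunits (?O Quot ?I)" using ring.genideal_self[OF id.quotient_is_ring A(1)] A(4) \<alpha> by auto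
      ultimately show False by (simp add: nonunits_def)
    qed
    then show ?thesis using a x by blast
  qed
  then obtain a s e where a: "\<And>\<alpha>. \<alpha> \<in> A \<Longrightarrow> form n (e \<alpha>) (a \<alpha>)" "\<And>\<alpha>. \<alpha> \<in> A \<Longrightarrow> form n (e \<alpha>) (s \<alpha>)"
    "\<And>\<alpha>. \<alpha> \<in> A \<Longrightarrow> s \<alpha> \<notin> ?P" "\<And>\<alpha>. \<alpha> \<in> A \<Longrightarrow> meval (a \<alpha>) z = 0" "\<And>\<alpha>. \<alpha> \<in> A \<Longrightarrow> \<alpha> = h (Fract (a \<alpha>) (s \<alpha>))"
    by metis
  \<comment> \<open>At most (c - 1) + d + 1 = n conditions on n + 1 unknowns. The last one, on
    coordinate \<open>i0\<close>, excludes the radial direction \<open>z\<close>, which moves no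
    point of projective space.\<close>
  define E where "E = (\<lambda>j i. dat z i (f j)) ` B \<union> (\<lambda>\<alpha> i. dat z i (a \<alpha>)) ` A \<union> {\<lambda>i. of_bool (i = i0)}"
  have finB: "finite B" using B(1) R finite_subset by blast
  have "card E \<le> card ((\<lambda>j i. dat z i (f j)) ` B) + card ((\<lambda>\<alpha> i. dat z i (a \<alpha>)) ` A) + card {\<lambda>i. of_bool (i = i0) :: 'k}"
    unfolding E_def by (intro order.trans[OF card_Un_le] add_mono card_Un_le order.refl)
  also have "\<dots> \<le> card B + card A + 1"
    by (intro add_mono card_image_le finB A(2)) auto
  also have "\<dots> < card {..n}" using B(2) cardA cd by simp
  finally have cE: "card E < card {..n}" .
  have "finite E" using finB A(2) by (simp add: E_def)
  from homogeneous_system_nontrivial[OF this finite_atMost cE, of "\<lambda>x. x"]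
  obtain v where v: "\<exists>i\<le>n. v i \<noteq> 0" "\<And>x. x \<in> E \<Longrightarrow> (\<Sum>i\<le>n. x i * v i) = 0" by auto
  have vf: "ddir n z v (f j) = 0" if "j \<in> R" for j
    using Bspan[of v] v(2) that by (auto simp: E_def ddir_def)
  have va: "ddir n z v (a \<alpha>) = 0" if "\<alpha> \<in> A" for \<alpha>
    using v(2)[of "\<lambda>i. dat z i (a \<alpha>)"] that by (auto simp: E_def ddir_def)
  have v0: "v i0 = 0"
  proof -
    have "(\<Sum>i\<le>n. of_bool (i = i0) * v i) = 0" by (rule v(2)) (simp add: E_def)
    moreover have "(\<Sum>i\<le>n. of_bool (i = i0) * v i) = (\<Sum>i\<le>n. if i = i0 then v i else 0)"
      by (intro sum.cong) auto
    ultimately show ?thesis using i0(1) by (simp add: sum.delta)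
  qed
  let ?K = "tangent_ideal n z"
  have IK: "?I \<subseteq> ?K w" if w: "\<And>j. j \<in> R \<Longrightarrow> ddir n z w (f j) = 0" for w
  proof -
    let ?V = "{p \<in> carrier (coord_ring n). meval p z = 0 \<and> ddir n z w p = 0}"
    have "ideal ?V (coord_ring n)"
      using ddir_simps(4)[of n z w 0]
      by (auto simp: ideal_coord_ring_iff meval_hom ddir_simps is_subringD[OF is_subring_coord_ring])
    then have "I \<subseteq> ?V" unfolding I
      by (rule genideal_coord_ring_minimal) (use fI IP closed_pointD w f in blast)
    then show ?thesis unfolding tangent_ideal_def using mem_ideal_stalk_iff[OF IS] by blast
  qed
  have Kid: "ideal (?K w) ?O" for w by (rule ideal_tangent_ideal[OF P])
  have Ksub: "?K w \<subseteq> ?C" "\<And>x y. x \<in> ?K w \<Longrightarrow> y \<in> ?K w \<Longrightarrow> x + y \<in> ?K w"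
    "\<And>x y. x \<in> ?K w \<Longrightarrow> y \<in> ?C \<Longrightarrow> y * x \<in> ?K w" for w
    using Kid[of w, unfolded ideal_sub_ring_iff[OF C]] by blast+
  have "Idl\<^bsub>?O Quot ?I\<^esub> A \<subseteq> h ` ?K v"
  proof (rule ring.genideal_minimal[OF id.quotient_is_ring])
    show "ideal (h ` ?K v) (?O Quot ?I)"
      unfolding h_def by (rule ring_ideal_imp_quot_ideal[OF id.ideal_axioms Kid])
    show "A \<subseteq> h ` ?K v"
    proof
      fix \<alpha> assume \<alpha>: "\<alpha> \<in> A"
      have "Fract (a \<alpha>) (s \<alpha>) \<in> ?K v" unfolding tangent_ideal_def using a[OF \<alpha>] va[OF \<alpha>] by blast
      then show "\<alpha> \<in> h ` ?K v" using a(5)[OF \<alpha>] by blast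
    qed
  qed
  have "v j = 0" if j: "j \<le> n" for j
  proof -
    \<comment> \<open>Divided by x_i0 this is, up to a constant factor, the affine coordinate
      \<open>j\<close> centred at \<open>z\<close>. It lies in the maximal ideal, so its derivative
      along \<open>v\<close> must vanish, which forces \<open>v j = 0\<close>.\<close>
    define p where "p = mconst (z i0) * mvar j - mconst (z j) * mvar i0"
    have pf: "form n 1 p" unfolding p_def diff_conv_add_uminus
      by (intro form_add form_uminus form_cmult form_mvar j i0)
    have x0: "mvar i0 \<notin> ?P" using form_in_closed_point_iff[OF form_mvar[OF i0(1)], of z] i0(2) by (simp add: meval_hom)
    define u where "u = Fract p (mvar i0)"
    have pz: "meval p z = 0" by (simp add: p_def meval_hom)
    have dp: "ddir n z w p = z i0 * w j - z j * w i0" for w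
      using j i0 by (simp add: p_def ddir_simps meval_hom)
    have uC: "u \<in> ?C" unfolding u_def mem_proj_stalk_iff using pf form_mvar[OF i0(1)] x0 by blast
    have "h u \<in> nonunits (?O Quot ?I)"
    proof (rule ccontr)
      assume "h u \<notin> nonunits (?O Quot ?I)"
      then have "h u \<in> Units (?O Quot ?I)" using h.hom_closed[of u] uC by (simp add: nonunits_def)
      then obtain Y where Y: "Y \<in> carrier (?O Quot ?I)" "h u \<otimes>\<^bsub>?O Quot ?I\<^esub> Y = \<one>\<^bsub>?O Quot ?I\<^esub>"
        unfolding Units_def by blast
      then obtain y where y: "y \<in> ?C" "Y = h y" by (auto simp: FactRing_def A_RCOSETS_def' h_def)
      have uy: "u * y \<in> ?C" using is_subringD(4)[OF C] uC y by blast
      have "h (u * y) = h 1" using h.hom_mult[of u y] h.hom_one uC y Y by simp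
      then obtain i where i: "i \<in> ?I" "1 = i + u * y"
        using rcos_eq_imp_diff_mem[OF C id.ideal_axioms is_subringD(2)[OF C] uy] unfolding h_def by auto
      \<comment> \<open>For direction 0 the tangent ideal is the whole maximal ideal of the stalk,
        which cannot contain 1.\<close>
      have "u \<in> ?K (\<lambda>_. 0)" unfolding tangent_ideal_def u_def
        using pf form_mvar[OF i0(1)] x0 pz by (auto simp: ddir_def)
      then have "u * y \<in> ?K (\<lambda>_. 0)" using Ksub(3)[OF _ y(1)] by (simp add: mult.commute)
      moreover have "i \<in> ?K (\<lambda>_. 0)" using IK[of "\<lambda>_. 0"] i(1) by (auto simp: ddir_def)
      ultimately have "1 \<in> ?K (\<lambda>_. 0)" using Ksub(2) i(2) by metis
      then obtain b t k where b: "1 = Fract b t" "form n k b" "form n k t" "t \<notin> ?P" "meval b z = 0"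
        unfolding tangent_ideal_def by blast
      have "t \<noteq> 0" using prime_mult_notin(2)[OF P b(3) b(3) b(4) b(4)] .
      then have "t = b" using b(1) by (simp add: One_fract_def eq_fract)
      then show False using b(3-5) form_in_closed_point_iff by blast
    qed
    then obtain k where k: "k \<in> ?K v" "h u = h k" using \<open>Idl\<^bsub>?O Quot ?I\<^esub> A \<subseteq> h ` ?K v\<close> A(4) by auto
    have "\<exists>i\<in>?I. u = i + k"
      using rcos_eq_imp_diff_mem[OF C id.ideal_axioms uC] k Ksub(1) unfolding h_def by blast
    then have "u \<in> ?K v" using Ksub(2)[OF _ k(1)] IK[OF vf] by blast
    then obtain b t m where b: "u = Fract b t" "form n m b" "form n m t" "t \<notin> ?P" "meval b z = 0" "ddir n z v b = 0"
      unfolding tangent_ideal_def by blast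
    have "t \<noteq> 0" using prime_mult_notin(2)[OF P b(3) b(3) b(4) b(4)] .
    moreover have "mvar i0 \<noteq> (0 :: (nat, 'k) mpoly)"
      using prime_mult_notin(2)[OF P form_mvar[OF i0(1)] form_mvar[OF i0(1)] x0 x0] .
    ultimately have "p * t = b * mvar i0" using b(1) by (simp add: u_def eq_fract)
    then have "ddir n z v (p * t) = ddir n z v (b * mvar i0)" by simp
    then have "ddir n z v p * meval t z = 0" using b(5,6) pz by (simp add: ddir_simps)
    moreover have "meval t z \<noteq> 0" using form_in_closed_point_iff[OF b(3)] b(4) by blast
    ultimately show ?thesis using v0 i0(2) by (simp add: dp)
  qed
  then show False using v(1) by blast
qed

section \<open>Generic reducedness\<close>

text \<open>A homogeneous ideal is generated by its forms, so a strict inclusion shows on a form, as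
  \<open>prime_chain_growth\<close> demands.\<close>

lemma homogeneous_ideal_strict_form:
  assumes Q: "homogeneous_ideal n Q'" "ideal Q (coord_ring n)" and sub: "Q \<subset> Q'"
  shows "\<exists>e g. form n e g \<and> g \<in> Q' \<and> g \<notin> Q"
proof (rule ccontr)
  assume neg: "\<not> ?thesis"
  have "Q' \<subseteq> carrier (coord_ring n)" using Q(1) by (auto simp: homogeneous_ideal_def ideal_coord_ring_iff)
  then have "{p \<in> Q'. \<exists>e. homogeneous e p} \<subseteq> Q" using neg by (auto simp: form_def)
  then have "Idl\<^bsub>coord_ring n\<^esub> {p \<in> Q'. \<exists>e. homogeneous e p} \<subseteq> Q"
    by (rule genideal_coord_ring_minimal[OF Q(2)])
  moreover have "Q' = Idl\<^bsub>coord_ring n\<^esub> {p \<in> Q'. \<exists>e. homogeneous e p}"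
    using Q(1) by (simp add: homogeneous_ideal_def)
  ultimately show False using sub by blast
qed

text \<open>The elements all of whose components lie in the ideal form an ideal again, and it
  contains the generators.\<close>

lemma coeff_grad_mem_homogeneous_genideal:
  assumes G: "G \<subseteq> carrier (coord_ring n)" "\<And>g. g \<in> G \<Longrightarrow> \<exists>e. homogeneous e g"
    and q: "q \<in> Idl\<^bsub>coord_ring n\<^esub> G"
  shows "coeff (grad q) e \<in> Idl\<^bsub>coord_ring n\<^esub> G"
proof -
  let ?J = "Idl\<^bsub>coord_ring n\<^esub> G"
  let ?H = "{q \<in> carrier (coord_ring n). \<forall>e. coeff (grad q) e \<in> ?J}"
  have J: "0 \<in> ?J" "\<And>a b. a \<in> ?J \<Longrightarrow> b \<in> ?J \<Longrightarrow> a + b \<in> ?J"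
    "\<And>a r. a \<in> ?J \<Longrightarrow> r \<in> carrier (coord_ring n) \<Longrightarrow> r * a \<in> ?J"
    using ideal_genideal_coord_ring(1)[OF G(1)] by (auto simp: ideal_coord_ring_iff)
  have Jsum: "(\<And>i. i \<in> A \<Longrightarrow> h i \<in> ?J) \<Longrightarrow> sum h A \<in> ?J" for A :: "nat set" and h
    by (induction A rule: infinite_finite_induct) (auto intro: J)
  have cS: "coeff (grad r) i \<in> carrier (coord_ring n)" if "r \<in> carrier (coord_ring n)" for r i
    using that mvars_coeff_grad[of r i] by (auto simp: carrier_coord_ring)
  have "ideal ?H (coord_ring n)"
    unfolding ideal_coord_ring_iff
  proof (intro conjI ballI)
    show "0 \<in> ?H" using J(1) by (auto simp: is_subringD[OF is_subring_coord_ring])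
    show "a + b \<in> ?H" if "a \<in> ?H" "b \<in> ?H" for a b
      using that J(2) by (auto simp: grad_hom is_subringD[OF is_subring_coord_ring])
    show "r * a \<in> ?H" if "a \<in> ?H" "r \<in> carrier (coord_ring n)" for a r
      using that cS[OF that(2)]
      by (auto simp: grad_hom coeff_mult is_subringD[OF is_subring_coord_ring] intro!: Jsum J(3))
  qed auto
  moreover have "G \<subseteq> ?H"
  proof
    fix g assume g: "g \<in> G"
    obtain d where "homogeneous d g" using G(2)[OF g] by blast
    then have "grad g = monom g d" by (simp add: homogeneous_iff_grad)
    then show "g \<in> ?H" using g G(1) J(1) ideal_genideal_coord_ring(2)[OF G(1)] by auto
  qed
  ultimately have "?J \<subseteq> ?H" by (rule genideal_coord_ring_minimal)
  then show ?thesis using q by blast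
qed

text \<open>If all chains were shorter than \<open>d\<close>, the supremum would be at most
  \<open>d - 1\<close>. The chain consisting of \<open>P\<close> alone settles \<open>d = 0\<close>,
  where truncated subtraction gives nothing.\<close>

lemma closure_dim_chain:
  assumes dim: "closure_dim n P = enat d" and P: "P \<in> proj_points n P"
  shows "\<exists>m\<ge>d. \<exists>Q. (\<forall>i\<le>m. Q i \<in> proj_points n P) \<and> (\<forall>i<m. Q i \<subset> Q (Suc i))"
proof (rule ccontr)
  assume neg: "\<not> ?thesis"
  have "d \<noteq> 0"
  proof
    assume "d = 0"
    then show False using neg P by (auto dest: spec[of _ 0] spec[of _ "\<lambda>_. P"])
  qed
  have "closure_dim n P \<le> enat (d - 1)"
    unfolding closure_dim_def
  proof (intro Sup_least)
    fix x assume "x \<in> {enat m | m. \<exists>Q :: nat \<Rightarrow> (nat, 'a) mpoly set.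
     (\<forall>i\<le>m. Q i \<in> proj_points n P) \<and> (\<forall>i<m. Q i \<subset> Q (Suc i))}"
    then obtain m Q where m: "x = enat m" "\<forall>i\<le>m. Q i \<in> proj_points n P" "\<forall>i<m. Q i \<subset> Q (Suc i)" by blast
    then have "\<not> d \<le> m" using neg by blast
    then show "x \<le> enat (d - 1)" by (simp add: m(1))
  qed
  then show False using dim \<open>d \<noteq> 0\<close> by simp
qed

text \<open>If some form of \<open>P\<close> did not vanish on the generic arc, the kernel of the arc could be inserted
  strictly below \<open>P\<close>, giving a chain that is too long for the Hilbert function of a complete intersection.\<close>

theorem complete_intersection_local_equality:
  fixes g :: "nat \<Rightarrow> (nat, 'k::field) mpoly"
  assumes reg: "regular_sequence (coord_ring n) (map g [1..<c+1])"
    and g: "\<And>j. j \<in> {1..c} \<Longrightarrow> \<exists>e. form n e (g j)"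
    and dual: "\<And>j j'. j \<in> {1..c} \<Longrightarrow> j' \<in> {1..c} \<Longrightarrow> (\<Sum>i\<le>n. dat z i (g j) * \<gamma> j' i) = of_bool (j = j')"
    and P: "P \<in> proj_points n P" "closure_dim n P = enat d" and gP: "g ` {1..c} \<subseteq> P"
    and Pz: "P \<subseteq> closed_point n z" and cd: "c + d = n"
    and p: "form n e p" "p \<in> P"
  shows "\<exists>k s. form n k s \<and> s \<notin> P \<and> s * p \<in> Idl\<^bsub>coord_ring n\<^esub> (g ` {1..c})"
proof -
  let ?G = "g ` {1..c}"
  let ?J = "Idl\<^bsub>coord_ring n\<^esub> ?G"
  have Pp: "primeideal P (coord_ring n)" using P(1) by (simp add: proj_points_def)
  note PD = primeideal_coord_ringD[OF Pp]
  have G: "?G \<subseteq> carrier (coord_ring n)" using g by (auto simp: form_def)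
  have Jid: "ideal ?J (coord_ring n)" and GJ: "?G \<subseteq> ?J" by (rule ideal_genideal_coord_ring[OF G])+
  have JS: "?J \<subseteq> carrier (coord_ring n)" and J0: "0 \<in> ?J"
    and Jadd: "\<And>a b. a \<in> ?J \<Longrightarrow> b \<in> ?J \<Longrightarrow> a + b \<in> ?J"
    and Jmult: "\<And>a r. a \<in> ?J \<Longrightarrow> r \<in> carrier (coord_ring n) \<Longrightarrow> r * a \<in> ?J"
    using Jid by (auto simp: ideal_coord_ring_iff)
  have Pid: "ideal P (coord_ring n)" by (rule primeideal.axioms(1)[OF Pp])
  have JP: "?J \<subseteq> P" by (rule genideal_coord_ring_minimal[OF Pid gP])
  have gz: "meval (g j) z = 0" if "j \<in> {1..c}" for j
    using gP Pz that closed_pointD(2) by blast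
  have gv: "mvars (g j) \<subseteq> {0..n}" if "j \<in> {1..c}" for j
    using G that carrier_coord_ring by blast
  obtain \<rho> where \<rho>: "\<And>j. j \<in> {1..c} \<Longrightarrow> arc \<rho> (g j) = 0"
    "\<And>i. i \<le> n \<Longrightarrow> fps_nth (\<rho> i) 0 = mconst (z i)"
    "\<And>i. i \<le> n \<Longrightarrow> fps_nth (\<rho> i) 1 =
      mvar i - (\<Sum>j\<in>{1..c}. mconst (\<gamma> j i) * (\<Sum>k\<le>n. mconst (dat z k (g j)) * mvar k))"
    using generic_arc_exists[where C = "{1..c}" and g = g and z = z and n = n and \<gamma> = \<gamma>,
        OF finite_atLeastAtMost gv gz dual] by blast
  define E where "E = {q \<in> carrier (coord_ring n). arc \<rho> q = 0}"
  have "ideal E (coord_ring n)"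
    by (auto simp: E_def ideal_coord_ring_iff arc_hom is_subringD[OF is_subring_coord_ring])
  then have JE: "?J \<subseteq> E"
    by (rule genideal_coord_ring_minimal) (use G \<rho>(1) in \<open>auto simp: E_def\<close>)
  have kernel: "\<exists>k s. form n k s \<and> s \<notin> P \<and> s * q \<in> ?J" if q: "form n a q" "arc \<rho> q = 0" for a q
  proof -
    have "g j \<in> ?J" if "j \<in> {1..c}" for j using GJ that by blast
    moreover have "arc \<rho> a = 0" if "a \<in> ?J" for a using JE that unfolding E_def by blast
    moreover have "q \<in> carrier (coord_ring n)" using q(1) by (simp add: form_def)
    ultimately have "\<exists>s \<in> carrier (coord_ring n). meval s z \<noteq> 0 \<and> s * q \<in> ?J"
      by (intro generic_arc_kernel[where g = g and C = "{1..c}" and \<rho> = \<rho> and \<gamma> = \<gamma>]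
          finite_atLeastAtMost gz JS J0 Jadd Jmult \<rho> q(2))
    then obtain s where s: "s \<in> carrier (coord_ring n)" "meval s z \<noteq> 0" "s * q \<in> ?J" by blast
    \<comment> \<open>The multiplier \<open>s\<close> need not be homogeneous. Some component of it
      is nonzero at \<open>z\<close>, and since \<open>q\<close> is a form and \<open>J\<close>
      homogeneous, this component also carries \<open>q\<close> into \<open>J\<close>.\<close>
    have "s = (\<Sum>i\<le>degree (grad s). coeff (grad s) i)"
      using poly_grad_1[of s] by (simp add: poly_altdef)
    then have "meval s z = meval (\<Sum>i\<le>degree (grad s). coeff (grad s) i) z" by (rule arg_cong)
    then have "(\<Sum>i\<le>degree (grad s). meval (coeff (grad s) i) z) \<noteq> 0"
      using s(2) by (simp add: meval_hom)
    then obtain k where k: "meval (coeff (grad s) k) z \<noteq> 0"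
      by (rule sum.not_neutral_contains_not_neutral)
    let ?s = "coeff (grad s) k"
    have fs: "form n k ?s"
      using homogeneous_coeff_grad[of k s] mvars_coeff_grad[of s k] s(1) by (auto simp: form_def carrier_coord_ring)
    have "coeff (grad (s * q)) (a + k) \<in> ?J"
      by (rule coeff_grad_mem_homogeneous_genideal[OF G _ s(3)]) (use g in \<open>auto simp: form_def\<close>)
    moreover have "coeff (grad (s * q)) (a + k) = ?s * q"
    proof -
      have "grad (s * q) = monom q a * grad s"
        using q(1) by (simp add: grad_hom form_def homogeneous_iff_grad)
      then show ?thesis by (simp add: coeff_monom_mult)
    qed
    moreover have "?s \<notin> P" using k Pz closed_pointD(2) by blast
    ultimately show ?thesis using fs by auto
  qed
  have "arc \<rho> p = 0"
  proof (rule ccontr)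
    assume ne: "arc \<rho> p \<noteq> 0"
    obtain m Q where m: "d \<le> m" and Q: "\<forall>i\<le>m. Q i \<in> proj_points n P" "\<forall>i<m. Q i \<subset> Q (Suc i)"
      using closure_dim_chain[OF P(2,1)] by blast
    have Qp: "primeideal (Q i) (coord_ring n)" "P \<subseteq> Q i" "homogeneous_ideal n (Q i)" if "i \<le> m" for i
      using Q(1) that by (auto simp: proj_points_def)
    note QD = primeideal_coord_ringD[OF Qp(1)]
    \<comment> \<open>The chain above \<open>P\<close> shifted by one, with the kernel of the arc in
      position 0.\<close>
    define Q' where "Q' i = (case i of 0 \<Rightarrow> E | Suc i \<Rightarrow> Q i)" for i
    have "growth n (Q' 0) (Suc m)"
    proof (rule prime_chain_growth)
      fix i a b and x y :: "(nat, 'k) mpoly" assume i: "i \<le> Suc m" and x: "form n a x" and y: "form n b y"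
      have S: "x \<in> carrier (coord_ring n)" "y \<in> carrier (coord_ring n)" using x y by (auto simp: form_def)
      show "y * x \<in> Q' i" if "x \<in> Q' i"
        using that i S QD(4) by (cases i) (auto simp: Q'_def E_def arc_hom is_subringD[OF is_subring_coord_ring])
      show "x \<in> Q' i \<or> y \<in> Q' i" if "x * y \<in> Q' i"
        using that i S QD(6) by (cases i) (auto simp: Q'_def E_def arc_hom is_subringD[OF is_subring_coord_ring])
    next
      fix i a and x y :: "(nat, 'k) mpoly" assume i: "i \<le> Suc m" and "x \<in> Q' i" "y \<in> Q' i"
      then show "x + y \<in> Q' i"
        using QD(3) by (cases i) (auto simp: Q'_def E_def arc_hom is_subringD[OF is_subring_coord_ring])
    next
      fix N
      obtain i where i: "i \<le> n" "mvar i \<notin> Q m" using Q(1) by (auto simp: proj_points_def)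
      have fx: "form n N (mvar i ^ N)" for N using form_power[OF form_mvar[OF i(1)], of N] by simp
      have "mvar i ^ N \<notin> Q m"
      proof (induction N)
        case 0
        then show ?case using QD(5)[of m] by simp
      next
        case (Suc N)
        then show ?case using QD(6)[of m "mvar i" "mvar i ^ N"] i(2) fx[of 1] fx[of N] by (auto simp: form_def)
      qed
      then show "\<exists>p. form n N p \<and> p \<notin> Q' (Suc m)" using fx by (auto simp: Q'_def)
    next
      fix i a and x :: "(nat, 'k) mpoly" assume i: "i < Suc m" and x: "form n a x" "x \<in> Q' i"
      show "x \<in> Q' (Suc i)"
      proof (cases i)
        case 0
        \<comment> \<open>Forms of the kernel lie in \<open>P\<close>: a multiple by a form outside
          the prime \<open>P\<close> lies in \<open>J\<close>, hence in \<open>P\<close>.\<close>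
        then have "arc \<rho> x = 0" using x by (simp add: Q'_def E_def)
        then obtain k s where s: "form n k s" "s \<notin> P" "s * x \<in> ?J" using kernel[OF x(1)] by blast
        then have "x \<in> P" using PD(6)[of s x] JP x(1) by (auto simp: form_def)
        then show ?thesis using Qp(2)[of 0] 0 by (auto simp: Q'_def)
      next
        case (Suc j)
        then show ?thesis using Q(2) i x(2) by (auto simp: Q'_def)
      qed
    next
      fix i assume i: "i < Suc m"
      show "\<exists>e g. form n e g \<and> g \<in> Q' (Suc i) \<and> g \<notin> Q' i"
      proof (cases i)
        case 0
        have "p \<in> Q 0" using p(2) Qp(2)[of 0] by blast
        moreover have "p \<notin> E" using ne by (simp add: E_def)
        ultimately show ?thesis using p(1) 0 by (auto simp: Q'_def)
      next
        case (Suc j)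
        then have "Q j \<subset> Q (Suc j)" "j \<le> m" "Suc j \<le> m" using Q(2) i by auto
        then show ?thesis
          using homogeneous_ideal_strict_form[OF Qp(3) primeideal.axioms(1)[OF Qp(1)], of "Suc j" j] Suc
          by (simp add: Q'_def)
      qed
    qed
    then have "growth n ?J (Suc m)"
      by (rule growth_antimono) (use JE in \<open>auto simp: Q'_def\<close>)
    moreover have "set (map g [1..<c+1]) = ?G" by auto
    ultimately have "Suc m + length (map g [1..<c+1]) \<le> n"
      using g by (intro regular_sequence_growth[OF reg]) auto
    then show False using m cd unfolding length_map length_upt by simp
  qed
  then show ?thesis by (rule kernel[OF p(1)])
qed

text \<open>Both local rings are quotients of the same stalk, so equality of the two ideals is
  enough: a / s equals ta / ts, with numerator in \<open>J\<close>.\<close>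

lemma local_ring_eqI:
  assumes P: "primeideal P (coord_ring n)"
    and J: "ideal J (coord_ring n)" and I: "ideal I (coord_ring n)" and JI: "J \<subseteq> I"
    and loc: "\<And>e p. form n e p \<Longrightarrow> p \<in> I \<Longrightarrow> \<exists>k s. form n k s \<and> s \<notin> P \<and> s * p \<in> J"
  shows "local_ring n J P = local_ring n I P"
proof -
  have IS: "I \<subseteq> carrier (coord_ring n)" and JS: "J \<subseteq> carrier (coord_ring n)"
    using I J by (auto simp: ideal_coord_ring_iff)
  have "ideal_stalk n I P \<subseteq> ideal_stalk n J P"
  proof
    fix x assume "x \<in> ideal_stalk n I P"
    then obtain a s e where a: "x = Fract a s" "a \<in> I" "form n e a" "form n e s" "s \<notin> P"
      unfolding mem_ideal_stalk_iff[OF IS] by blast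
    obtain k t where t: "form n k t" "t \<notin> P" "t * a \<in> J" using loc[OF a(3,2)] by blast
    have "t \<noteq> 0" "s \<noteq> 0" using prime_mult_notin(2)[OF P t(1) t(1) t(2) t(2)]
        prime_mult_notin(2)[OF P a(4) a(4) a(5) a(5)] by auto
    then have "x = Fract (t * a) (t * s)" by (simp add: a(1) eq_fract)
    then show "x \<in> ideal_stalk n J P" unfolding mem_ideal_stalk_iff[OF JS]
      using t a form_mult[OF t(1) a(3)] form_mult[OF t(1) a(4)] prime_mult_notin(1)[OF P t(1) a(4) t(2) a(5)]
      by blast
  qed
  moreover have "ideal_stalk n J P \<subseteq> ideal_stalk n I P" using JI by (auto simp: ideal_stalk_def)
  ultimately show ?thesis by (simp add: local_ring_def)
qed

section \<open>General coefficients\<close>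

text \<open>Every v lies in the column space, as v = A (B v).\<close>

lemma rank_eq_of_right_inverse:
  fixes A :: "'k::field mat"
  assumes A: "A \<in> carrier_mat c m" and B: "B \<in> carrier_mat m c" and AB: "A * B = 1\<^sub>m c"
  shows "vec_space.rank c A = c"
proof -
  interpret vec_space "TYPE('k)" c .
  have "v \<in> col_space A" if v: "v \<in> carrier_vec c" for v
  proof -
    have "A *\<^sub>v (B *\<^sub>v v) = v" using assoc_mult_mat_vec[OF A B v] AB v by simp
    then show ?thesis unfolding col_space_eq[OF A] using A B v by auto
  qed
  moreover have "col_space A \<subseteq> carrier_vec c" unfolding col_space_eq[OF A] using A by auto
  ultimately have "span (set (cols A)) = carrier_vec c" unfolding col_space_def by auto
  then have "span_vs (set (cols A)) = V" by (simp add: module_vec_def)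
  then show ?thesis unfolding rank_def using dim_is_n by (simp only:)
qed

text \<open>Over a finite field, 1 plus the product of all X - a has positive degree but no
  root.\<close>

lemma infinite_alg_closed_field: "infinite (UNIV :: 'k::alg_closed_field set)"
proof
  assume fin: "finite (UNIV :: 'k set)"
  define q where "q = (\<Prod>a\<in>(UNIV::'k set). [:- a, 1:])"
  have "degree q = card (UNIV :: 'k set)"
    unfolding q_def by (subst degree_prod_sum_eq) auto
  then have "degree q > 0" using fin by (simp add: finite_UNIV_card_ge_0)
  then have "degree (q + 1) > 0" by (simp add: degree_add_eq_left)
  then obtain x where "poly (q + 1) x = 0" using alg_closed_imp_poly_has_root by blast
  moreover have "poly q x = 0" unfolding q_def poly_prod using fin by (intro prod_zero) auto
  ultimately show False by simp
qed

section \<open>Nonempty Zariski open sets\<close>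

lemma meval_cong: "(\<And>v. v \<in> mvars p \<Longrightarrow> b v = b' v) \<Longrightarrow> meval p b = meval p b'"
  unfolding meval_def mvars_def
  by (intro sum.cong prod.cong refl arg_cong2[where f = "(*)"] arg_cong2[where f = "(^)"]) blast

text \<open>Restriction to the line through the two given points.\<close>

lemma common_nonvanishing_point:
  fixes p q :: "('v, 'k::alg_closed_field) mpoly"
  assumes "meval p b1 \<noteq> 0" "meval q b2 \<noteq> 0"
  shows "\<exists>b. meval (p * q) b \<noteq> 0"
proof -
  define L where "L p = msubst (\<lambda>c. [:c:]) (\<lambda>v. [:b1 v, b2 v - b1 v:]) p" for p :: "('v, 'k) mpoly"
  have L: "poly (L p) t = meval p (\<lambda>v. b1 v + t * (b2 v - b1 v))" for p t
  proof -
    have "mvars p \<subseteq> UNIV" by simp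
    then show ?thesis
    proof (induction p rule: mpoly_induct)
      case (add p q)
      then show ?case by (simp add: L_def msubst_add meval_hom)
    next
      case (mult p q)
      then show ?case by (simp add: L_def msubst_mult meval_hom)
    qed (simp_all add: L_def meval_hom)
  qed
  have "L p \<noteq> 0" using L[of p 0] assms(1) by auto
  moreover have "L q \<noteq> 0" using L[of q 1] assms(2) by auto
  ultimately have "finite {t. poly (L p * L q) t = 0}" by (intro poly_roots_finite) simp
  then obtain t where "poly (L p * L q) t \<noteq> 0"
    using infinite_alg_closed_field[where 'k = 'k] by (metis (mono_tags, lifting) UNIV_eq_I mem_Collect_eq)
  then show ?thesis by (auto simp: L meval_hom)
qed

lemma nonvanishing_point_prod:
  fixes p :: "'a \<Rightarrow> ('v, 'k::alg_closed_field) mpoly"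
  assumes "finite A" "\<And>a. a \<in> A \<Longrightarrow> \<exists>b. meval (p a) b \<noteq> 0"
  shows "\<exists>b. meval (\<Prod>a\<in>A. p a) b \<noteq> 0"
  using assms
proof (induction A rule: finite_induct)
  case (insert a A)
  obtain b where b: "meval (p a) b \<noteq> 0" using insert.prems by blast
  obtain b' where b': "meval (\<Prod>a\<in>A. p a) b' \<noteq> 0" using insert.IH insert.prems by blast
  from common_nonvanishing_point[OF b b'] show ?case using insert.hyps by simp
qed (simp add: meval_hom)

text \<open>Finitely many nonempty principal open sets meet in that of the product. The point found
  is restricted to \<open>T\<close>, as points of affine space are extensional functions.\<close>

lemma for_general_prodI:
  fixes p :: "'a \<Rightarrow> ('v, 'k::alg_closed_field) mpoly"
  assumes "finite A" "\<And>a. a \<in> A \<Longrightarrow> mvars (p a) \<subseteq> T" "\<And>a. a \<in> A \<Longrightarrow> \<exists>b. meval (p a) b \<noteq> 0"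
    and \<Phi>: "\<And>b. (\<And>a. a \<in> A \<Longrightarrow> meval (p a) b \<noteq> 0) \<Longrightarrow> \<Phi> b"
  shows "for_general T \<Phi>"
proof -
  let ?p = "\<Prod>a\<in>A. p a"
  let ?U = "{b \<in> T \<rightarrow>\<^sub>E UNIV. \<exists>p \<in> {?p}. meval p b \<noteq> 0}"
  have vars: "mvars ?p \<subseteq> T" by (rule mvars_prod) (rule assms(2))
  then have "zariski_open T ?U" unfolding zariski_open_def by blast
  moreover obtain b where b: "meval ?p b \<noteq> 0" using nonvanishing_point_prod[of A p] assms(1,3) by blast
  have "meval ?p (restrict b T) = meval ?p b" by (rule meval_cong) (use vars in auto)
  then have "restrict b T \<in> ?U" using b by auto
  then have "?U \<noteq> {}" by blast
  moreover have "\<Phi> b" if "b \<in> ?U" for b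
    using that assms(1) by (intro \<Phi>) (auto simp: meval_hom)
  ultimately show ?thesis unfolding for_general_def by blast
qed

lemma meval_det:
  assumes "M \<in> carrier_mat c c"
  shows "meval (det M) b = det (map_mat (\<lambda>p. meval p b) M)"
proof -
  interpret comm_ring_hom "\<lambda>p. meval p b"
    by unfold_locales (simp_all add: meval_hom)
  show ?thesis by simp
qed

lemma mvars_det:
  assumes M: "M \<in> carrier_mat c c" and vars: "\<And>i j. i < c \<Longrightarrow> j < c \<Longrightarrow> mvars (M $$ (i, j)) \<subseteq> T"
  shows "mvars (det M) \<subseteq> T"
proof -
  have sign: "mvars (signof p :: ('a, 'b) mpoly) \<subseteq> T" for p :: "nat \<Rightarrow> nat"
    by (simp add: sign_def mvars_uminus)
  have "mvars (M $$ (i, p i)) \<subseteq> T" if "p permutes {0..<c}" "i < c" for p i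
    using permutes_in_image[OF that(1), of i] that(2) by (intro vars) simp_all
  then have "mvars (\<Sum>p | p permutes {0..<c}. signof p * (\<Prod>i = 0..<c. M $$ (i, p i))) \<subseteq> T"
    by (intro mvars_sum mvars_mult sign mvars_prod) auto
  then show ?thesis using M by (simp add: det_def)
qed

text \<open>Ensures that the i-th smallest index of the dual family is a legal column for row i of
  the triangular coefficient array.\<close>

lemma sorted_list_of_set_nth_ge:
  assumes "finite A" "A \<subseteq> {1..}" "i < card A"
  shows "Suc i \<le> sorted_list_of_set A ! i"
  using assms(3)
proof (induction i)
  case 0
  then have "sorted_list_of_set A ! 0 \<in> set (sorted_list_of_set A)"
    by (intro nth_mem) simp
  then show ?case using assms(1,2) by auto
next
  case (Suc i)
  have "sorted_list_of_set A ! i < sorted_list_of_set A ! Suc i"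
    using sorted_wrt_nth_less[OF strict_sorted_list_of_set[of A], of i "Suc i"] Suc.prems by simp
  then show ?case using Suc by simp
qed

text \<open>The coefficient matrix is upper triangular; picking the \<open>i\<close>-th smallest index of the dual family for
  row \<open>i\<close> respects this shape and gives a nonzero determinant.\<close>

lemma general_coefficients_dual:
  fixes G :: "nat \<Rightarrow> nat \<Rightarrow> 'k::field" and w :: "nat \<Rightarrow> nat \<Rightarrow> 'k"
  assumes A: "A \<subseteq> {1..r}" "card A = c" "dual_family {..n} G A \<gamma>"
    and w: "\<And>i j. i \<in> {1..c} \<Longrightarrow> j \<in> {i..r} \<Longrightarrow> w i j \<noteq> 0"
    and c1: "c = 1 \<Longrightarrow> r = 1 \<and> w 1 1 = 1"
  shows "\<exists>p. mvars p \<subseteq> coeff_index c r \<and> (\<exists>b. meval p b \<noteq> 0) \<and>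
    (\<forall>b. meval p b \<noteq> 0 \<longrightarrow> (\<exists>\<gamma>'. \<forall>i\<in>{1..c}. \<forall>i'\<in>{1..c}.
       (\<Sum>k\<le>n. (\<Sum>j=i..r. (if c = 1 then 1 else b (i, j)) * w i j * G j k) * \<gamma>' i' k) = of_bool (i = i')))"
proof -
  have finA: "finite A" using A(1) finite_subset by blast
  define js where "js = sorted_list_of_set A"
  have js: "Suc i \<le> js ! i" "js ! i \<in> A" "js ! i \<le> r" if "i < c" for i
  proof -
    show "Suc i \<le> js ! i" unfolding js_def using A finA that by (intro sorted_list_of_set_nth_ge) auto
    have "js ! i \<in> set js" using that A(2) by (intro nth_mem) (simp add: js_def)
    then show "js ! i \<in> A" using finA by (simp add: js_def)
    then show "js ! i \<le> r" using A(1) by auto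
  qed
  have js_inj: "js ! i = js ! i' \<longleftrightarrow> i = i'" if "i < c" "i' < c" for i i'
    using nth_eq_iff_index_eq[of js i i'] that A(2) by (simp add: js_def)
  define s where "s j t = (\<Sum>k\<le>n. G j k * \<gamma> (js ! t) k)" for j t
  have s: "s (js ! i) t = of_bool (i = t)" if "i < c" "t < c" for i t
    using A(3) js(2) js_inj that unfolding dual_family_def s_def by simp
  \<comment> \<open>Pairings of the general combinations with the chosen dual vectors, as
    polynomials in the coefficients; for \<open>c = 1\<close> the only coefficient is fixed to
    1.\<close>
  define M :: "(nat \<times> nat, 'k) mpoly mat" where
    "M = mat c c (\<lambda>(i, t). \<Sum>j=Suc i..r. (if c = 1 then 1 else mvar (Suc i, j)) * mconst (w (Suc i) j * s j t))"
  have M: "M \<in> carrier_mat c c" by (simp add: M_def)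
  define N where "N b = map_mat (\<lambda>p. meval p b) M" for b
  have N: "N b \<in> carrier_mat c c" for b using M by (simp add: N_def)
  have N_nth: "N b $$ (i, t) = (\<Sum>j=Suc i..r. (if c = 1 then 1 else b (Suc i, j)) * w (Suc i) j * s j t)"
    if "i < c" "t < c" for b i t
    using that by (simp add: N_def M_def meval_hom mult_ac if_distrib[of "\<lambda>p. meval p b"] cong: if_cong)
  have "mvars (M $$ (i, t)) \<subseteq> coeff_index c r" if "i < c" "t < c" for i t
  proof -
    have "mvars (if c = 1 then 1 else mvar (Suc i, j) :: (nat \<times> nat, 'k) mpoly) \<subseteq> coeff_index c r"
      if "j \<in> {Suc i..r}" for j
      using that \<open>i < c\<close> mvars_mvar[of "(Suc i, j)"] by (auto simp: coeff_index_def)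
    then have "mvars (\<Sum>j=Suc i..r. (if c = 1 then 1 else mvar (Suc i, j)) * mconst (w (Suc i) j * s j t) :: (nat \<times> nat, 'k) mpoly)
        \<subseteq> coeff_index c r"
      by (intro mvars_sum mvars_mult) simp_all
    then show ?thesis using that by (simp add: M_def)
  qed
  then have vars: "mvars (det M) \<subseteq> coeff_index c r" by (rule mvars_det[OF M])
  have detN: "meval (det M) b = det (N b)" for b unfolding N_def by (rule meval_det[OF M])
  \<comment> \<open>Selects one index per row and cancels its weight, so that the pairing matrix
    becomes the identity.\<close>
  define b1 where "b1 = (\<lambda>(i, j). if j = js ! (i - 1) then inverse (w i j) else 0)"
  have "N b1 = 1\<^sub>m c"
  proof (rule eq_matI)
    fix i t assume "i < dim_row (1\<^sub>m c)" "t < dim_col (1\<^sub>m c)"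
    then have it: "i < c" "t < c" by auto
    have mem: "js ! i \<in> {Suc i..r}" using js[OF it(1)] by simp
    have "(if c = 1 then 1 else b1 (Suc i, j)) * w (Suc i) j * s j t = (if j = js ! i then s j t else 0)"
      if j: "j \<in> {Suc i..r}" for j
    proof (cases "c = 1")
      case True
      then show ?thesis using c1 it j mem by auto
    next
      case False
      then show ?thesis using w[of "Suc i" j] it j by (auto simp: b1_def)
    qed
    then have "N b1 $$ (i, t) = (\<Sum>j=Suc i..r. if j = js ! i then s j t else 0)"
      unfolding N_nth[OF it] by (rule sum.cong[OF refl])
    also have "\<dots> = s (js ! i) t" using mem by (subst sum.delta) auto
    finally show "N b1 $$ (i, t) = 1\<^sub>m c $$ (i, t)" using s[OF it] it by simp
  qed (use N[of b1] in auto)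
  then have nz: "meval (det M) b1 \<noteq> 0" by (simp add: detN)
  have "\<exists>\<gamma>'. \<forall>i\<in>{1..c}. \<forall>i'\<in>{1..c}.
       (\<Sum>k\<le>n. (\<Sum>j=i..r. (if c = 1 then 1 else b (i, j)) * w i j * G j k) * \<gamma>' i' k) = of_bool (i = i')"
    if b: "meval (det M) b \<noteq> 0" for b
  proof -
    have "N b \<in> Units (ring_mat TYPE('k) c ())"
      using det_non_zero_imp_unit[OF N] b by (simp add: detN)
    then obtain B where B: "B \<in> carrier_mat c c" "N b * B = 1\<^sub>m c"
      unfolding Units_def by (auto simp: ring_mat_simps)
    \<comment> \<open>The dual vectors of \<open>A\<close>, recombined by the inverse of the pairing
      matrix.\<close>
    define \<gamma>' where "\<gamma>' i' k = (\<Sum>t<c. \<gamma> (js ! t) k * B $$ (t, i' - 1))" for i' k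
    have "(\<Sum>k\<le>n. (\<Sum>j=i..r. (if c = 1 then 1 else b (i, j)) * w i j * G j k) * \<gamma>' i' k) = of_bool (i = i')"
      if i: "i \<in> {1..c}" "i' \<in> {1..c}" for i i'
    proof -
      let ?\<beta> = "\<lambda>j. (if c = 1 then 1 else b (i, j)) * w i j"
      have "(\<Sum>k\<le>n. (\<Sum>j=i..r. ?\<beta> j * G j k) * \<gamma>' i' k) =
          (\<Sum>k\<le>n. \<Sum>j=i..r. \<Sum>t<c. ?\<beta> j * (G j k * \<gamma> (js ! t) k) * B $$ (t, i' - 1))"
        unfolding \<gamma>'_def by (simp add: sum_distrib_left sum_distrib_right mult_ac)
      also have "\<dots> = (\<Sum>k\<le>n. \<Sum>t<c. \<Sum>j=i..r. ?\<beta> j * (G j k * \<gamma> (js ! t) k) * B $$ (t, i' - 1))"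
        by (intro sum.cong refl sum.swap)
      also have "\<dots> = (\<Sum>t<c. \<Sum>k\<le>n. \<Sum>j=i..r. ?\<beta> j * (G j k * \<gamma> (js ! t) k) * B $$ (t, i' - 1))"
        by (rule sum.swap)
      also have "\<dots> = (\<Sum>t<c. \<Sum>j=i..r. \<Sum>k\<le>n. ?\<beta> j * (G j k * \<gamma> (js ! t) k) * B $$ (t, i' - 1))"
        by (intro sum.cong refl sum.swap)
      also have "\<dots> = (\<Sum>t<c. (\<Sum>j=i..r. ?\<beta> j * s j t) * B $$ (t, i' - 1))"
        by (simp add: s_def sum_distrib_left sum_distrib_right mult.assoc)
      also have "\<dots> = (\<Sum>t<c. N b $$ (i - 1, t) * B $$ (t, i' - 1))"
      proof (intro sum.cong refl)
        fix t assume "t \<in> {..<c}"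
        then have t: "i - 1 < c" "t < c" using i by auto
        have i1: "Suc (i - 1) = i" using i by simp
        show "(\<Sum>j=i..r. ?\<beta> j * s j t) * B $$ (t, i' - 1) = N b $$ (i - 1, t) * B $$ (t, i' - 1)"
          unfolding N_nth[OF t] i1 ..
      qed
      also have "\<dots> = (N b * B) $$ (i - 1, i' - 1)"
        using i N[of b] B(1) by (auto simp: scalar_prod_def lessThan_atLeast0)
      also have "\<dots> = of_bool (i = i')" using i by (auto simp: B(2))
      finally show ?thesis .
    qed
    then show ?thesis by blast
  qed
  then show ?thesis using vars nz by blast
qed

section \<open>The open set of coefficients and the two conclusions\<close>

theorem proposition6p1:
  fixes n d r m :: nat
    and I :: "(nat, 'k::alg_closed_field) mpoly set"
    and X :: "nat \<Rightarrow> (nat, 'k) mpoly set"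
    and f l :: "nat \<Rightarrow> (nat, 'k) mpoly"
    and \<delta> :: "nat \<Rightarrow> nat"
    and z :: "nat \<Rightarrow> nat \<Rightarrow> 'k"
  assumes "d < n"
    and "proj_ideal n I"
    and "reduced_scheme n I"
    and "cohen_macaulay_scheme n I"
    and "pure_dimensional n I d"
    and "bij_betw X {1..m} (generic_points n I)"
    and "\<forall>i \<in> {1..r}. f i \<in> carrier (coord_ring n) \<and> f i \<noteq> 0 \<and> homogeneous (\<delta> i) (f i)"
    and "\<forall>i \<in> {1..r}. \<forall>j \<in> {i..r}. \<delta> j \<le> \<delta> i"
    and "I = Idl\<^bsub>coord_ring n\<^esub> (f ` {1..r})"
    and "n = d + 1 \<longrightarrow> r = 1"
    and "\<forall>j \<in> {1..n - d - 1}. linear_form n (l j)"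
    and "d + 2 \<le> n \<longrightarrow>
      (\<forall>P. minimal_prime (coord_ring n) (Idl\<^bsub>coord_ring n\<^esub> {f 1}) P \<longrightarrow> l 1 \<notin> P)"
    and "\<forall>a \<in> {1..m}. smooth_point n I (z a) \<and> X a \<subseteq> closed_point n (z a) \<and>
      (\<forall>j \<in> {1..n - d - 1}. meval (l j) (z a) \<noteq> 0)"
  shows "for_general (coeff_index (n - d) r) (\<lambda>b. admissible n (n - d) r f \<delta> l b \<longrightarrow>
    (\<forall>a \<in> {1..m}.
       vec_space.rank (n - d) (jacobian_at n (n - d) (ftilde (n - d) r f \<delta> l b) (z a)) = n - d) \<and>
    generically_reduced_along n (Z_ideal n (n - d) r f \<delta> l b) I)"
proof (cases "\<exists>b. admissible n (n - d) r f \<delta> l b")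
  case False
  \<comment> \<open>The empty product is 1, so the open set is the whole affine space.\<close>
  then show ?thesis by (intro for_general_prodI[of "{}" "\<lambda>_. 0"]) auto
next
  case True
  then obtain b0 where b0: "admissible n (n - d) r f \<delta> l b0" by blast
  define c where "c = n - d"
  have cd: "c + d = n" "0 < c" using assms(1) by (auto simp: c_def)
  have c1: "r = 1" if "c = 1" using assms(10) cd that by simp
  \<comment> \<open>Rows 1 and 2 both use \<open>l 1\<close>.\<close>
  define L where "L i = (if i = 1 then l 1 else l (i - 1))" for i :: nat
  let ?\<beta> = "\<lambda>b i j. if c = 1 then 1 else b (i, j)"
  have ft: "ftilde c r f \<delta> l b i = (\<Sum>j=i..r. mconst (?\<beta> b i j) * L i ^ (\<delta> i - \<delta> j) * f j)"
    if "i \<in> {1..c}" for b i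
    using that c1 by (auto simp: ftilde_def L_def)
  have f: "f ` {1..r} \<subseteq> carrier (coord_ring n)" using assms(7) by auto
  have Iid: "ideal I (coord_ring n)" and fI: "f ` {1..r} \<subseteq> I"
    unfolding assms(9) by (rule ideal_genideal_coord_ring[OF f])+
  have fform: "form n (\<delta> j) (f j)" if "j \<in> {1..r}" for j using assms(7) that by (auto simp: form_def)
  \<comment> \<open>For \<open>c = 1\<close> there is a single generator and no linear form, but
    then only the exponent 0 occurs.\<close>
  have Lpow: "form n (\<delta> i - \<delta> j) (L i ^ (\<delta> i - \<delta> j))" "a \<in> {1..m} \<Longrightarrow> meval (L i) (z a) ^ (\<delta> i - \<delta> j) \<noteq> 0"
    if ij: "i \<in> {1..c}" "j \<in> {i..r}" for i j a
  proof -
    consider "\<delta> i - \<delta> j = 0" | i' where "L i = l i'" "i' \<in> {1..n - d - 1}"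
    proof (cases "c = 1")
      case True
      then show ?thesis using that(1) ij c1 by auto
    next
      case False
      then have "(if i = 1 then 1 else i - 1) \<in> {1..n - d - 1}" using ij cd by (auto simp: c_def)
      then show ?thesis using that(2)[of "if i = 1 then 1 else i - 1"] by (auto simp: L_def)
    qed
    then have "form n (\<delta> i - \<delta> j) (L i ^ (\<delta> i - \<delta> j)) \<and>
        (a \<in> {1..m} \<longrightarrow> meval (L i) (z a) ^ (\<delta> i - \<delta> j) \<noteq> 0)"
    proof cases
      case 1
      then show ?thesis by simp
    next
      case 2
      then have "form n 1 (L i)" using assms(11) by (auto simp: linear_form_def form_def)
      then have "form n (\<delta> i - \<delta> j) (L i ^ (\<delta> i - \<delta> j))" using form_power[of n 1] by fastforce
      then show ?thesis using 2 assms(13) by auto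
    qed
    then show "form n (\<delta> i - \<delta> j) (L i ^ (\<delta> i - \<delta> j))" "a \<in> {1..m} \<Longrightarrow> meval (L i) (z a) ^ (\<delta> i - \<delta> j) \<noteq> 0"
      by blast+
  qed
  have ft_form: "form n (\<delta> i) (ftilde c r f \<delta> l b i)" if i: "i \<in> {1..c}" for b i
    unfolding ft[OF i]
  proof (intro form_sum)
    fix j assume j: "j \<in> {i..r}"
    then have "\<delta> j \<le> \<delta> i" "j \<in> {1..r}" using assms(8) i by auto
    then show "form n (\<delta> i) (mconst (?\<beta> b i j) * L i ^ (\<delta> i - \<delta> j) * f j)"
      using form_mult[OF form_cmult[OF Lpow(1)[OF i j], of "?\<beta> b i j"] fform[of j]] by simp
  qed
  have ft_I: "ftilde c r f \<delta> l b i \<in> I" if i: "i \<in> {1..c}" for b i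
  proof -
    have I: "0 \<in> I" "\<And>x y. x \<in> I \<Longrightarrow> y \<in> I \<Longrightarrow> x + y \<in> I"
      "\<And>x e s. x \<in> I \<Longrightarrow> form n e s \<Longrightarrow> s * x \<in> I"
      using Iid by (auto simp: ideal_coord_ring_iff form_def)
    have Isum: "(\<And>j. j \<in> A \<Longrightarrow> h j \<in> I) \<Longrightarrow> sum h A \<in> I" for A :: "nat set" and h
      by (induction A rule: infinite_finite_induct) (auto intro: I(1,2))
    show ?thesis unfolding ft[OF i]
    proof (intro Isum)
      fix j assume j: "j \<in> {i..r}"
      then have "f j \<in> I" using fI i by auto
      then show "mconst (?\<beta> b i j) * L i ^ (\<delta> i - \<delta> j) * f j \<in> I"
        using form_cmult[OF Lpow(1)[OF i j]] by (rule I(3))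
    qed
  qed
  let ?G = "\<lambda>b. ftilde c r f \<delta> l b ` {1..c}"
  have G: "?G b \<subseteq> carrier (coord_ring n)" for b using ft_form by (auto simp: form_def)
  have JI: "Idl\<^bsub>coord_ring n\<^esub> (?G b) \<subseteq> I" for b
    by (rule genideal_coord_ring_minimal[OF Iid]) (use ft_I in auto)
  have set_G: "set (map (ftilde c r f \<delta> l b) [1..<c+1]) = ?G b" for b by auto
  have reg: "regular_sequence (coord_ring n) (map (ftilde c r f \<delta> l b) [1..<c+1])"
    if "admissible n c r f \<delta> l b" for b
    using that by (simp add: admissible_def)
  \<comment> \<open>The generators for \<open>b0\<close> lie in \<open>I\<close>, so the growth of
    \<open>I\<close> passes to their complete intersection.\<close>
  have bound: "q \<le> d" if q: "growth n I q" for q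
  proof -
    let ?gs = "map (ftilde c r f \<delta> l b0) [1..<c+1]"
    have "growth n (Idl\<^bsub>coord_ring n\<^esub> (set ?gs)) q"
      unfolding set_G by (rule growth_antimono[OF q]) (use JI in blast)
    moreover have "\<exists>e. form n e g" if "g \<in> set ?gs" for g
      using that ft_form unfolding set_G by blast
    moreover have "regular_sequence (coord_ring n) ?gs" using b0 by (intro reg) (simp only: c_def)
    ultimately have "q + length ?gs \<le> n" by (intro regular_sequence_growth)
    then show ?thesis using cd unfolding length_map length_upt by simp
  qed
  have fz: "meval (f j) (z a) = 0" if "a \<in> {1..m}" "j \<in> {1..r}" for a j
    using assms(13) that fI closed_pointD(2) by (fastforce simp: smooth_point_def proj_points_def)
  let ?w = "\<lambda>a i j. meval (L i) (z a) ^ (\<delta> i - \<delta> j)"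
  \<comment> \<open>Leibniz rule where all \<open>f j\<close> vanish: derivatives of the multipliers
    drop out, and the power of the linear form becomes a nonzero weight.\<close>
  have grad: "dat (z a) k (ftilde c r f \<delta> l b i) = (\<Sum>j=i..r. ?\<beta> b i j * ?w a i j * dat (z a) k (f j))"
    if "a \<in> {1..m}" "i \<in> {1..c}" for a b i k
    unfolding ft[OF that(2)] dat_sum
  proof (intro sum.cong refl)
    fix j assume "j \<in> {i..r}"
    then have "meval (f j) (z a) = 0" using fz that by simp
    then show "dat (z a) k (mconst (?\<beta> b i j) * L i ^ (\<delta> i - \<delta> j) * f j) = ?\<beta> b i j * ?w a i j * dat (z a) k (f j)"
      unfolding dat_mult[of _ _ "mconst (?\<beta> b i j) * L i ^ (\<delta> i - \<delta> j)"] by (simp add: meval_hom)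
  qed
  define dual where "dual a b \<gamma> \<longleftrightarrow> (\<forall>i\<in>{1..c}. \<forall>i'\<in>{1..c}.
      (\<Sum>k\<le>n. dat (z a) k (ftilde c r f \<delta> l b i) * \<gamma> i' k) = of_bool (i = i'))" for a b and \<gamma> :: "nat \<Rightarrow> nat \<Rightarrow> 'k"
  have "\<forall>a\<in>{1..m}. \<exists>p. mvars p \<subseteq> coeff_index c r \<and> (\<exists>b. meval p b \<noteq> 0) \<and>
      (\<forall>b. meval p b \<noteq> 0 \<longrightarrow> (\<exists>\<gamma>. dual a b \<gamma>))"
  proof
    fix a assume a: "a \<in> {1..m}"
    then have "smooth_point n I (z a)" using assms(13) by blast
    from gradient_rank_at_smooth_point[OF this assms(9) f finite_atLeastAtMost bound cd]
    obtain A \<gamma> where A: "A \<subseteq> {1..r}" "card A = c" "dual_family {..n} (\<lambda>j i. dat (z a) i (f j)) A \<gamma>" by blast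
    from general_coefficients_dual[OF A, of "?w a"] Lpow(2)[OF _ _ a] c1
    obtain p where p: "mvars p \<subseteq> coeff_index c r" "\<exists>b. meval p b \<noteq> 0"
      "\<And>b. meval p b \<noteq> 0 \<Longrightarrow> (\<exists>\<gamma>'. \<forall>i\<in>{1..c}. \<forall>i'\<in>{1..c}.
       (\<Sum>k\<le>n. (\<Sum>j=i..r. ?\<beta> b i j * ?w a i j * dat (z a) k (f j)) * \<gamma>' i' k) = of_bool (i = i'))"
      by auto
    have "\<exists>\<gamma>. dual a b \<gamma>" if "meval p b \<noteq> 0" for b
      using p(3)[OF that] unfolding dual_def by (simp add: grad[OF a])
    then show "\<exists>p. mvars p \<subseteq> coeff_index c r \<and> (\<exists>b. meval p b \<noteq> 0) \<and>
      (\<forall>b. meval p b \<noteq> 0 \<longrightarrow> (\<exists>\<gamma>. dual a b \<gamma>))" using p by blast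
  qed
  then obtain p where p: "\<And>a. a \<in> {1..m} \<Longrightarrow> mvars (p a) \<subseteq> coeff_index c r"
    "\<And>a. a \<in> {1..m} \<Longrightarrow> \<exists>b. meval (p a) b \<noteq> 0"
    "\<And>a b. a \<in> {1..m} \<Longrightarrow> meval (p a) b \<noteq> 0 \<Longrightarrow> \<exists>\<gamma>. dual a b \<gamma>"
    by metis
  have rank: "vec_space.rank c (jacobian_at n c (ftilde c r f \<delta> l b) (z a)) = c" if "dual a b \<gamma>" for a b \<gamma>
  proof (rule rank_eq_of_right_inverse)
    \<comment> \<open>The dual vectors form the columns of a right inverse.\<close>
    let ?B = "mat (n + 1) c (\<lambda>(k, i). \<gamma> (i + 1) k)"
    show "jacobian_at n c (ftilde c r f \<delta> l b) (z a) \<in> carrier_mat c (n + 1)" by (simp add: jacobian_at_def)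
    show "?B \<in> carrier_mat (n + 1) c" by simp
    show "jacobian_at n c (ftilde c r f \<delta> l b) (z a) * ?B = 1\<^sub>m c"
    proof (rule eq_matI)
      fix i t assume "i < dim_row (1\<^sub>m c)" "t < dim_col (1\<^sub>m c)"
      then have it: "i < c" "t < c" by auto
      then have "(jacobian_at n c (ftilde c r f \<delta> l b) (z a) * ?B) $$ (i, t) =
          (\<Sum>k = 0..<n + 1. dat (z a) k (ftilde c r f \<delta> l b (i + 1)) * \<gamma> (t + 1) k)"
        by (simp add: jacobian_at_def scalar_prod_def dat_def del: sum.op_ivl_Suc)
      also have "{0..<n + 1} = {..n}" by auto
      also have "(\<Sum>k\<le>n. dat (z a) k (ftilde c r f \<delta> l b (i + 1)) * \<gamma> (t + 1) k) = 1\<^sub>m c $$ (i, t)"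
        using that it by (simp add: dual_def)
      finally show "(jacobian_at n c (ftilde c r f \<delta> l b) (z a) * ?B) $$ (i, t) = 1\<^sub>m c $$ (i, t)" .
    qed (simp_all add: jacobian_at_def)
  qed
  have reduced: "local_ring n (Z_ideal n c r f \<delta> l b) P = local_ring n I P"
    if P: "P \<in> generic_points n I" and adm: "admissible n c r f \<delta> l b"
      and dual: "\<And>a. a \<in> {1..m} \<Longrightarrow> \<exists>\<gamma>. dual a b \<gamma>" for P b
  proof -
    have "P \<in> X ` {1..m}" using P unfolding bij_betw_imp_surj_on[OF assms(6)] .
    then obtain a where a: "a \<in> {1..m}" "X a = P" by blast
    obtain \<gamma> where \<gamma>: "dual a b \<gamma>" using dual[OF a(1)] by blast
    have PI: "P \<in> proj_points n I" using P by (simp add: generic_points_def)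
    then have PP: "P \<in> proj_points n P" "I \<subseteq> P" "primeideal P (coord_ring n)" by (auto simp: proj_points_def)
    have dim: "closure_dim n P = enat d" using assms(5) P by (simp add: pure_dimensional_def)
    have Pz: "P \<subseteq> closed_point n (z a)" using assms(13) a by blast
    show ?thesis
    proof (rule local_ring_eqI[OF PP(3) _ Iid])
      show "ideal (Z_ideal n c r f \<delta> l b) (coord_ring n)" "Z_ideal n c r f \<delta> l b \<subseteq> I"
        unfolding Z_ideal_def by (rule ideal_genideal_coord_ring(1)[OF G] JI)+
      \<comment> \<open>As \<open>I\<close> lies in \<open>P\<close>, it is enough to carry forms of
        \<open>P\<close> into the ideal of Z by a form outside \<open>P\<close>.\<close>
      fix e q assume q: "form n e q" "q \<in> I"
      show "\<exists>k s. form n k s \<and> s \<notin> P \<and> s * q \<in> Z_ideal n c r f \<delta> l b"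
        unfolding Z_ideal_def
      proof (rule complete_intersection_local_equality[OF reg[OF adm] _ _ PP(1) dim _ Pz cd(1) q(1)])
        show "\<exists>e. form n e (ftilde c r f \<delta> l b j)" if "j \<in> {1..c}" for j using ft_form[OF that] by blast
        show "(\<Sum>i\<le>n. dat (z a) i (ftilde c r f \<delta> l b j) * \<gamma> j' i) = of_bool (j = j')"
          if "j \<in> {1..c}" "j' \<in> {1..c}" for j j'
          using \<gamma> that unfolding dual_def by blast
        show "?G b \<subseteq> P" using ft_I PP(2) by blast
        show "q \<in> P" using q(2) PP(2) by blast
      qed
    qed
  qed
  show ?thesis
    unfolding c_def[symmetric]
  proof (rule for_general_prodI[of "{1..m}" p])
    fix b assume b: "\<And>a. a \<in> {1..m} \<Longrightarrow> meval (p a) b \<noteq> 0"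
    have dual: "\<exists>\<gamma>. dual a b \<gamma>" if "a \<in> {1..m}" for a using p(3) b that by blast
    show "admissible n c r f \<delta> l b \<longrightarrow>
      (\<forall>a \<in> {1..m}. vec_space.rank c (jacobian_at n c (ftilde c r f \<delta> l b) (z a)) = c) \<and>
      generically_reduced_along n (Z_ideal n c r f \<delta> l b) I"
      unfolding generically_reduced_along_def using dual rank reduced by blast
  qed (use p in auto)
qed

end
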